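(* For all PPT states $\rho=\rho_{C_AA}$ and $\tilde\rho=\tilde\rho_{C_BB}$, $$K_{A\leftrightarrow C\leftrightarrow B}(\rho\otimes\tilde\rho)\le E_R^\infty(\rho^\Gamma)+E_R^\infty(\tilde\rho^\Gamma).$$
   Context: All systems are finite-dimensional; $\log$ is base 2. Charlie holds $C=C_AC_B$; $\Gamma$ is the partial transpose on Charlie's systems. PPT means that the partial transpose is positive semidefinite. $\alpha\approx_\epsilon\beta$ means $\|\alpha-\beta\|_1\le\epsilon$. Private states: an $m$-bit private state $\gamma_m$ is a bipartite state (cut $AA':BB'$), with key systems $A,B$ of dimension $2^m$ and shield systems $A',B'$ of arbitrary finite dimension, of the form $\gamma_m=2^{-m}\sum_{i,j=0}^{2^m-1}|ii\rangle\langle jj|_{AB}\otimes U_i\,\sigma_{A'B'}\,U_j^\dagger$ with $\sigma_{A'B'}$ a state and $U_i$ unitaries. Quantum key repeater rate: $$K_{A\leftrightarrow C\leftrightarrow B}(\rho\otimes\tilde\rho)=\inf_{\epsilon>0}\limsup_{n\to\infty}\sup_{\Lambda_n,\gamma_m}\Big\{\tfrac mn:\ \mathrm{Tr}_C\Lambda_n\big((\rho_{AC_A}\otimes\tilde\rho_{C_BB})^{\otimes n}\big)\approx_\epsilon\gamma_m\Big\},$$ with $\Lambda_n$ ranging over tripartite LOCC protocols among Alice, Bob, Charlie and $\gamma_m$ over $m$-bit private states between Alice and Bob. $E_R(\rho)=\inf_{\sigma\text{ separable}}D(\rho\|\sigma)$ is the relative entropy of entanglement and $E_R^\infty(\rho)=\lim_n\frac1nE_R(\rho^{\otimes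 n})$. *)

theory Defs
  imports
    "Jordan_Normal_Form.Schur_Decomposition"
    "HOL-Library.Extended_Real"
begin

text \<open>
  Operators on a finite-dimensional Hilbert space with a fixed orthonormal basis are complex
  matrices. A basis vector of a composite system with local dimensions \<open>d1, ..., dk\<close>
  is numbered lexicographically, the last factor varying fastest: \<open>(x, y)\<close> in a
  system of dimensions \<open>d1, d2\<close> has number \<open>x * d2 + y\<close>.
\<close>

section \<open>Matrices\<close>

definition mtrace :: "complex mat \<Rightarrow> complex" where
  "mtrace A = (\<Sum>i<dim_row A. A $$ (i, i))"

text \<open>The type of matrices is not an additive monoid, so finite sums of square matrices of
  dimension \<open>d\<close> are taken entrywise.\<close>

definition msum :: "nat \<Rightarrow> 'i set \<Rightarrow> ('i \<Rightarrow> complex mat) \<Rightarrow> complex mat" where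
  "msum d S f = mat d d (\<lambda>ij. \<Sum>k\<in>S. f k $$ ij)"

definition ketbra :: "nat \<Rightarrow> nat \<Rightarrow> nat \<Rightarrow> complex mat" where
  "ketbra d i j = mat d d (\<lambda>(r, c). if r = i \<and> c = j then 1 else 0)"

definition is_hermitian :: "nat \<Rightarrow> complex mat \<Rightarrow> bool" where
  "is_hermitian d A \<longleftrightarrow> A \<in> carrier_mat d d \<and> mat_adjoint A = A"

definition is_unitary :: "nat \<Rightarrow> complex mat \<Rightarrow> bool" where
  "is_unitary d U \<longleftrightarrow> U \<in> carrier_mat d d \<and> mat_adjoint U * U = 1\<^sub>m d \<and> U * mat_adjoint U = 1\<^sub>m d"

definition is_psd :: "nat \<Rightarrow> complex mat \<Rightarrow> bool" where
  "is_psd d A \<longleftrightarrow> is_hermitian d A \<and> (\<forall>v\<in>carrier_vec d. 0 \<le> Re ((A *\<^sub>v v) \<bullet>c v))"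

definition is_state :: "nat \<Rightarrow> complex mat \<Rightarrow> bool" where
  "is_state d \<rho> \<longleftrightarrow> is_psd d \<rho> \<and> mtrace \<rho> = 1"

text \<open>Functional calculus for Hermitian matrices: the result does not depend on the choice of
  the unitary diagonalisation.\<close>

definition spectral_fun :: "(real \<Rightarrow> real) \<Rightarrow> complex mat \<Rightarrow> complex mat" where
  "spectral_fun f A = (SOME B. \<exists>U d.
     is_unitary (dim_row A) U \<and>
     A = U * mat_diag (dim_row A) (\<lambda>i. complex_of_real (d i)) * mat_adjoint U \<and>
     B = U * mat_diag (dim_row A) (\<lambda>i. complex_of_real (f (d i))) * mat_adjoint U)"

definition trace_norm :: "complex mat \<Rightarrow> real" where
  "trace_norm X = Re (mtrace (spectral_fun sqrt (mat_adjoint X * X)))"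


section \<open>Composite systems\<close>

definition kron :: "complex mat \<Rightarrow> complex mat \<Rightarrow> complex mat" where
  "kron A B = mat (dim_row A * dim_row B) (dim_col A * dim_col B)
     (\<lambda>(i, j). A $$ (i div dim_row B, j div dim_col B) * B $$ (i mod dim_row B, j mod dim_col B))"

text \<open>Given an operator on four systems of dimensions \<open>d1, d2, d3, d4\<close>, exchange the
  second and the third one; the result is an operator on systems of dimensions
  \<open>d1, d3, d2, d4\<close>. The auxiliary function sends the number of
  \<open>(x1, x3, x2, x4)\<close> to that of \<open>(x1, x2, x3, x4)\<close>.\<close>

definition swap_middle_index :: "nat \<Rightarrow> nat \<Rightarrow> nat \<Rightarrow> nat \<Rightarrow> nat" where
  "swap_middle_index d2 d3 d4 i =
     (let x4 = i mod d4; x2 = i div d4 mod d2; x3 = i div (d4 * d2) mod d3;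
          x1 = i div (d4 * d2 * d3)
      in ((x1 * d2 + x2) * d3 + x3) * d4 + x4)"

definition swap_middle :: "nat \<Rightarrow> nat \<Rightarrow> nat \<Rightarrow> nat \<Rightarrow> complex mat \<Rightarrow> complex mat" where
  "swap_middle d1 d2 d3 d4 X =
     mat (d1 * d2 * d3 * d4) (d1 * d2 * d3 * d4)
       (\<lambda>(i, j). X $$ (swap_middle_index d2 d3 d4 i, swap_middle_index d2 d3 d4 j))"

text \<open>Tensor product of \<open>X\<close> on \<open>A1 B1\<close> and \<open>Y\<close> on
  \<open>A2 B2\<close>, regrouped along the cut \<open>A1 A2 : B1 B2\<close>, and the resulting
  tensor powers, which live on systems of dimensions \<open>a ^ n, b ^ n\<close>.\<close>

definition bip_tensor ::
  "nat \<Rightarrow> nat \<Rightarrow> nat \<Rightarrow> nat \<Rightarrow> complex mat \<Rightarrow> complex mat \<Rightarrow> complex mat" where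
  "bip_tensor a1 b1 a2 b2 X Y = swap_middle a1 b1 a2 b2 (kron X Y)"

primrec bip_power :: "nat \<Rightarrow> nat \<Rightarrow> complex mat \<Rightarrow> nat \<Rightarrow> complex mat" where
  "bip_power a b X 0 = 1\<^sub>m 1"
| "bip_power a b X (Suc n) = bip_tensor (a ^ n) (b ^ n) a b (bip_power a b X n) X"

text \<open>The same for operators on three systems \<open>A C B\<close>:
  \<open>A1 C1 B1 A2 C2 B2\<close> is reordered to \<open>A1 A2 C1 B1 C2 B2\<close> and then to
  \<open>A1 A2 C1 C2 B1 B2\<close>.\<close>

definition tri_tensor ::
  "nat \<Rightarrow> nat \<Rightarrow> nat \<Rightarrow> nat \<Rightarrow> nat \<Rightarrow> nat \<Rightarrow> complex mat \<Rightarrow> complex mat \<Rightarrow> complex mat" where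
  "tri_tensor a1 c1 b1 a2 c2 b2 X Y =
     swap_middle (a1 * a2 * c1) b1 c2 b2
       (swap_middle a1 (c1 * b1) a2 (c2 * b2) (kron X Y))"

primrec tri_power :: "nat \<Rightarrow> nat \<Rightarrow> nat \<Rightarrow> complex mat \<Rightarrow> nat \<Rightarrow> complex mat" where
  "tri_power a c b X 0 = 1\<^sub>m 1"
| "tri_power a c b X (Suc n) =
     tri_tensor (a ^ n) (c ^ n) (b ^ n) a c b (tri_power a c b X n) X"

definition ptranspose_fst :: "nat \<Rightarrow> nat \<Rightarrow> complex mat \<Rightarrow> complex mat" where
  "ptranspose_fst d1 d2 X = mat (d1 * d2) (d1 * d2)
     (\<lambda>(i, j). X $$ ((j div d2) * d2 + i mod d2, (i div d2) * d2 + j mod d2))"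

definition ptranspose_snd :: "nat \<Rightarrow> nat \<Rightarrow> complex mat \<Rightarrow> complex mat" where
  "ptranspose_snd d1 d2 X = mat (d1 * d2) (d1 * d2)
     (\<lambda>(i, j). X $$ ((i div d2) * d2 + j mod d2, (j div d2) * d2 + i mod d2))"

definition ptrace_middle :: "nat \<Rightarrow> nat \<Rightarrow> nat \<Rightarrow> complex mat \<Rightarrow> complex mat" where
  "ptrace_middle d1 d2 d3 X = mat (d1 * d3) (d1 * d3)
     (\<lambda>(i, j). \<Sum>k<d2. X $$ (((i div d3) * d2 + k) * d3 + i mod d3,
                              ((j div d3) * d2 + k) * d3 + j mod d3))"


section \<open>Relative entropy of entanglement\<close>

definition is_separable :: "nat \<Rightarrow> nat \<Rightarrow> complex mat \<Rightarrow> bool" where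
  "is_separable d1 d2 \<sigma> \<longleftrightarrow>
     (\<exists>(r::nat) (p :: nat \<Rightarrow> real) \<alpha> \<beta>.
        (\<forall>k<r. 0 \<le> p k \<and> is_state d1 (\<alpha> k) \<and> is_state d2 (\<beta> k)) \<and> (\<Sum>k<r. p k) = 1 \<and>
        \<sigma> = msum (d1 * d2) {..<r} (\<lambda>k. complex_of_real (p k) \<cdot>\<^sub>m kron (\<alpha> k) (\<beta> k)))"

text \<open>The logarithm of a positive semidefinite matrix is taken on its support and extended by
  zero. The relative entropy is finite iff \<open>supp \<rho> \<subseteq> supp \<sigma>\<close>, that is,
  \<open>ker \<sigma> \<subseteq> ker \<rho>\<close>.\<close>

definition mlog :: "complex mat \<Rightarrow> complex mat" where
  "mlog = spectral_fun (\<lambda>x. if x = 0 then 0 else log 2 x)"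

definition rel_entropy :: "complex mat \<Rightarrow> complex mat \<Rightarrow> ereal" where
  "rel_entropy \<rho> \<sigma> =
     (if \<forall>v\<in>carrier_vec (dim_row \<sigma>). \<sigma> *\<^sub>v v = 0\<^sub>v (dim_row \<sigma>) \<longrightarrow> \<rho> *\<^sub>v v = 0\<^sub>v (dim_row \<rho>)
      then ereal (Re (mtrace (\<rho> * (mlog \<rho> - mlog \<sigma>)))) else \<infinity>)"

definition rel_ent_entanglement :: "nat \<Rightarrow> nat \<Rightarrow> complex mat \<Rightarrow> ereal" where
  "rel_ent_entanglement d1 d2 \<rho> = (INF \<sigma>\<in>{\<sigma>. is_separable d1 d2 \<sigma>}. rel_entropy \<rho> \<sigma>)"

definition reg_rel_ent_entanglement :: "nat \<Rightarrow> nat \<Rightarrow> complex mat \<Rightarrow> ereal" where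
  "reg_rel_ent_entanglement d1 d2 \<rho> =
     lim (\<lambda>n. rel_ent_entanglement (d1 ^ n) (d2 ^ n) (bip_power d1 d2 \<rho> n) / ereal (real n))"


section \<open>Tripartite LOCC protocols\<close>

text \<open>Local dimensions are listed in the order Alice, Charlie, Bob.\<close>

datatype party = Alice | Charlie | Bob

type_synonym dims = "nat \<times> nat \<times> nat"

fun total_dim :: "dims \<Rightarrow> nat" where
  "total_dim (a, c, b) = a * c * b"

fun local_dim :: "party \<Rightarrow> dims \<Rightarrow> nat" where
  "local_dim Alice (a, c, b) = a"
| "local_dim Charlie (a, c, b) = c"
| "local_dim Bob (a, c, b) = b"

fun set_local_dim :: "party \<Rightarrow> nat \<Rightarrow> dims \<Rightarrow> dims" where
  "set_local_dim Alice d (a, c, b) = (d, c, b)"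
| "set_local_dim Charlie d (a, c, b) = (a, d, b)"
| "set_local_dim Bob d (a, c, b) = (a, c, d)"

fun embed_local :: "party \<Rightarrow> dims \<Rightarrow> complex mat \<Rightarrow> complex mat" where
  "embed_local Alice (a, c, b) K = kron (kron K (1\<^sub>m c)) (1\<^sub>m b)"
| "embed_local Charlie (a, c, b) K = kron (kron (1\<^sub>m a) K) (1\<^sub>m b)"
| "embed_local Bob (a, c, b) K = kron (kron (1\<^sub>m a) (1\<^sub>m c)) K"

text \<open>A quantum instrument on a system of dimension \<open>d\<close> with outcomes
  \<open>x < r\<close>: on outcome \<open>x\<close> it acts by the completely positive map with Kraus
  operators \<open>K x l\<close>, \<open>l < s\<close>, into a system of dimension \<open>e x\<close>.
  Using the same number \<open>s\<close> of Kraus operators for all outcomes is no restriction,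
  since Kraus operators may be zero.\<close>

definition is_instrument ::
  "nat \<Rightarrow> nat \<Rightarrow> nat \<Rightarrow> (nat \<Rightarrow> nat) \<Rightarrow> (nat \<Rightarrow> nat \<Rightarrow> complex mat) \<Rightarrow> bool" where
  "is_instrument d r s e K \<longleftrightarrow>
     (\<forall>x<r. \<forall>l<s. K x l \<in> carrier_mat (e x) d) \<and>
     msum d ({..<r} \<times> {..<s}) (\<lambda>(x, l). mat_adjoint (K x l) * K x l) = 1\<^sub>m d"

definition local_cp ::
  "party \<Rightarrow> dims \<Rightarrow> nat \<Rightarrow> nat \<Rightarrow> (nat \<Rightarrow> complex mat) \<Rightarrow> complex mat \<Rightarrow> complex mat" where
  "local_cp p ds d' s L X = msum (total_dim (set_local_dim p d' ds)) {..<s}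
     (\<lambda>l. embed_local p ds (L l) * X * mat_adjoint (embed_local p ds (L l)))"

text \<open>Finite-round protocols: one party applies an instrument and broadcasts the outcome
  \<open>x\<close>, and the parties continue with a protocol that may depend on \<open>x\<close>.
  Since the outcome selects the rest of the protocol, it serves as the classical message; any
  record of it in the output has to be kept in a local system.\<close>

inductive locc :: "dims \<Rightarrow> dims \<Rightarrow> (complex mat \<Rightarrow> complex mat) \<Rightarrow> bool" where
  locc_stop: "locc ds ds (\<lambda>X. X)"
| locc_round:
    "is_instrument (local_dim p ds) r s e K \<Longrightarrow>
     (\<And>x. x < r \<Longrightarrow> locc (set_local_dim p (e x) ds) ds' (\<Lambda> x)) \<Longrightarrow>
     locc ds ds' (\<lambda>X. msum (total_dim ds') {..<r} (\<lambda>x. \<Lambda> x (local_cp p ds (e x) s (K x) X)))"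


section \<open>Private states and the key repeater rate\<close>

text \<open>An \<open>m\<close>-bit private state with shield dimensions \<open>sA, sB\<close>. The formula
  produces an operator on \<open>A B A' B'\<close>, which is reordered to \<open>A A' B B'\<close>.\<close>

definition is_private_state :: "nat \<Rightarrow> nat \<Rightarrow> nat \<Rightarrow> complex mat \<Rightarrow> bool" where
  "is_private_state m sA sB \<gamma> \<longleftrightarrow>
     (\<exists>\<sigma> U. is_state (sA * sB) \<sigma> \<and> (\<forall>i<2^m. is_unitary (sA * sB) (U i)) \<and>
        \<gamma> = swap_middle (2^m) (2^m) sA sB
          ((1 / 2^m) \<cdot>\<^sub>m msum (2^m * 2^m * (sA * sB)) ({..<2^m} \<times> {..<2^m})
             (\<lambda>(i, j). kron (ketbra (2^m * 2^m) (i * 2^m + i) (j * 2^m + j))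
                            (U i * \<sigma> * mat_adjoint (U j)))))"

definition key_repeater_achievable ::
  "nat \<Rightarrow> nat \<Rightarrow> nat \<Rightarrow> complex mat \<Rightarrow> real \<Rightarrow> nat \<Rightarrow> nat \<Rightarrow> bool" where
  "key_repeater_achievable dA dC dB \<tau> \<epsilon> n m \<longleftrightarrow>
     (\<exists>\<Lambda> dC' sA sB \<gamma>.
        locc (dA ^ n, dC ^ n, dB ^ n) (2^m * sA, dC', 2^m * sB) \<Lambda> \<and>
        is_private_state m sA sB \<gamma> \<and>
        trace_norm (ptrace_middle (2^m * sA) dC' (2^m * sB) (\<Lambda> (tri_power dA dC dB \<tau> n)) - \<gamma>) \<le> \<epsilon>)"

definition key_repeater_rate :: "nat \<Rightarrow> nat \<Rightarrow> nat \<Rightarrow> complex mat \<Rightarrow> ereal" where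
  "key_repeater_rate dA dC dB \<tau> =
     (INF \<epsilon>\<in>{0<..}. limsup (\<lambda>n.
        SUP m\<in>{m. key_repeater_achievable dA dC dB \<tau> \<epsilon> n m}. ereal (real m / real n)))"

end

theory Submission
  imports Defs "Jordan_Normal_Form.Spectral_Radius" "HOL-Analysis.L2_Norm"
begin

text \<open>
  Already the first summand bounds the rate; the second is nonnegative. Transposing Charlie's
  systems turns the Kraus operators of a tripartite protocol into those of another one and does
  not affect its output after Charlie is traced out. So distilling key from \<open>\<rho> \<otimes> \<rho>'\<close> amounts to
  distilling it from the partially transposed states, which are states because of the PPT
  assumption. Following a protocol by the test that untwists the private state and projects the
  key onto the maximally entangled state, and fixing Bob's input, yields an effect on Alice's
  systems and Charlie's matching ones. It accepts the \<open>n\<close>-fold partially transposed \<open>\<rho>\<close> with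
  probability at least \<open>1 - \<epsilon>\<close> and every separable state with probability at most \<open>1 / 2 ^ m\<close>,
  which forces the relative entropy to all separable states to be at least roughly
  \<open>(1 - 4 * \<epsilon>) * m\<close>. The regularised quantity exists as a limit by Fekete's lemma.
\<close>

section \<open>Matrices and the spectral theorem\<close>

text \<open>The cut that matters is Alice against Charlie and Bob together. A separable state of
  Alice's half, tensored with Bob's input, is still separable for this cut, and every round is local
  for it, whoever acts. The protocol is followed backwards: the test is a linear functional that is
  pulled back round by round, and the data kept about it are its values on partially transposed
  rank-one operators. There Charlie's transposition can be absorbed, because a Kraus operator turns
  a partially transposed outer product into another one, with Charlie's operators replaced by their
  complex conjugates. The relative entropy is then bounded from below by the two error probabilities
  of this one test. That bound has a free threshold \<open>c\<close>; the choice
  \<open>c = \<epsilon> * 2 ^ m\<close> makes both error terms equal to \<epsilon>, and doubling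
  their sum gives \<open>4 * \<epsilon>\<close>. The price is a summand
  \<open>log 2 \<epsilon>\<close> that vanishes after division by \<open>n\<close>.\<close>

lemma pair_index [simp]:
  fixes x y b :: nat
  assumes "y < b"
  shows "(x * b + y) div b = x" "(x * b + y) mod b = y"
  using assms by auto

lemma pair_index_less:
  fixes x y a b :: nat
  assumes "x < a" "y < b"
  shows "x * b + y < a * b"
proof -
  have "x * b + y < Suc x * b" using assms by simp
  also have "\<dots> \<le> a * b" using assms by (intro mult_right_mono) auto
  finally show ?thesis .
qed

lemma div_index_less: "(i::nat) < a * b \<Longrightarrow> i div b < a"
  by (simp add: less_mult_imp_div_less)

lemma mod_index_less: "(i::nat) < a * b \<Longrightarrow> i mod b < b"
  by (cases "b = 0") auto

lemma sum_pair_index: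
  fixes f :: "nat \<Rightarrow> 'a::comm_monoid_add"
  shows "(\<Sum>i<a * b. f i) = (\<Sum>x<a. \<Sum>y<b. f (x * b + y))"
proof -
  have "(\<Sum>x<a. \<Sum>y<b. f (x * b + y)) = (\<Sum>(x, y)\<in>{..<a} \<times> {..<b}. f (x * b + y))"
    by (simp add: sum.cartesian_product)
  also have "\<dots> = (\<Sum>i<a * b. f i)"
    by (rule sum.reindex_bij_witness[where i = "\<lambda>i. (i div b, i mod b)" and j = "\<lambda>(x, y). x * b + y"])
      (auto simp: pair_index_less div_index_less mod_index_less)
  finally show ?thesis by simp
qed

lemma dim_adjoint [simp]:
  "dim_row (mat_adjoint A) = dim_col A" "dim_col (mat_adjoint A) = dim_row A"
  by (auto simp: mat_adjoint_def mat_of_rows_def)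

lemma index_adjoint [simp]:
  "i < dim_col A \<Longrightarrow> j < dim_row A \<Longrightarrow> mat_adjoint A $$ (i, j) = cnj (A $$ (j, i))"
  by (auto simp: mat_adjoint_def mat_of_rows_def)

lemma adjoint_carrier [simp]: "A \<in> carrier_mat n m \<Longrightarrow> mat_adjoint A \<in> carrier_mat m n"
  by (intro carrier_matI) (simp_all add: carrier_matD)

lemma adjoint_adjoint [simp]: "mat_adjoint (mat_adjoint A) = (A :: complex mat)"
  by (rule eq_matI) auto

lemma index_mult:
  assumes "A \<in> carrier_mat n k" "B \<in> carrier_mat k m" "i < n" "j < m"
  shows "(A * B) $$ (i, j) = (\<Sum>l<k. A $$ (i, l) * B $$ (l, j))"
  using assms by (auto simp: scalar_prod_def atLeast0LessThan)

lemma adjoint_mult: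
  assumes "A \<in> carrier_mat n k" "B \<in> carrier_mat k m"
  shows "mat_adjoint (A * B) = mat_adjoint B * mat_adjoint (A :: complex mat)"
proof (rule eq_matI)
  fix i j assume "i < dim_row (mat_adjoint B * mat_adjoint A)" "j < dim_col (mat_adjoint B * mat_adjoint A)"
  then have ij: "i < m" "j < n" using assms by auto
  have "mat_adjoint (A * B) $$ (i, j) = cnj ((A * B) $$ (j, i))"
    using ij assms by (subst index_adjoint) auto
  also have "\<dots> = (\<Sum>l<k. cnj (A $$ (j, l)) * cnj (B $$ (l, i)))"
    using ij by (subst index_mult[OF assms]) auto
  also have "\<dots> = (mat_adjoint B * mat_adjoint A) $$ (i, j)"
    using ij assms by (subst index_mult[OF adjoint_carrier[OF assms(2)] adjoint_carrier[OF assms(1)]])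
      (auto intro!: sum.cong simp: mult.commute)
  finally show "mat_adjoint (A * B) $$ (i, j) = (mat_adjoint B * mat_adjoint A) $$ (i, j)" .
qed (use assms in auto)

lemma mtrace_comm:
  assumes "A \<in> carrier_mat n m" "B \<in> carrier_mat m n"
  shows "mtrace (A * B) = mtrace (B * A)"
proof -
  have "mtrace (A * B) = (\<Sum>i<n. \<Sum>j<m. A $$ (i, j) * B $$ (j, i))"
    unfolding mtrace_def using assms index_mult[OF assms] by (auto intro!: sum.cong simp del: index_mult_mat(1))
  also have "\<dots> = (\<Sum>j<m. \<Sum>i<n. B $$ (j, i) * A $$ (i, j))"
    by (subst sum.swap) (simp add: mult.commute)
  also have "\<dots> = mtrace (B * A)"
    unfolding mtrace_def using assms index_mult[OF assms(2,1)] by (auto intro!: sum.cong simp del: index_mult_mat(1))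
  finally show ?thesis .
qed

lemma is_unitaryI:
  assumes "U \<in> carrier_mat d d" "mat_adjoint U * U = 1\<^sub>m d"
  shows "is_unitary d U"
  using assms mat_mult_left_right_inverse[of "mat_adjoint U" d U] by (auto simp: is_unitary_def)

lemma is_unitary_carrier: "is_unitary d U \<Longrightarrow> U \<in> carrier_mat d d"
  by (simp add: is_unitary_def)

lemma is_unitary_adjoint: "is_unitary d U \<Longrightarrow> is_unitary d (mat_adjoint U)"
  by (auto simp: is_unitary_def)

lemma is_unitary_mult:
  assumes "is_unitary d U" "is_unitary d V"
  shows "is_unitary d (U * V)"
proof (rule is_unitaryI)
  have c: "U \<in> carrier_mat d d" "V \<in> carrier_mat d d" using assms by (auto simp: is_unitary_def)
  then show "U * V \<in> carrier_mat d d" by auto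
  have "mat_adjoint (U * V) * (U * V) = mat_adjoint V * ((mat_adjoint U * U) * V)"
    using c by (simp add: adjoint_mult[OF c] assoc_mult_mat[of _ d d _ d _ d])
  also have "\<dots> = 1\<^sub>m d" using assms c by (simp add: is_unitary_def)
  finally show "mat_adjoint (U * V) * (U * V) = 1\<^sub>m d" .
qed

lemma is_unitary_cols:
  assumes "is_unitary d U" "i < d" "j < d"
  shows "(\<Sum>k<d. cnj (U $$ (k, i)) * U $$ (k, j)) = (if i = j then 1 else 0)"
proof -
  have c: "U \<in> carrier_mat d d" and u: "mat_adjoint U * U = 1\<^sub>m d" using assms by (auto simp: is_unitary_def)
  have "(mat_adjoint U * U) $$ (i, j) = (\<Sum>k<d. cnj (U $$ (k, i)) * U $$ (k, j))"
    using c assms by (subst index_mult[OF adjoint_carrier[OF c] c]) (auto intro!: sum.cong)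
  then show ?thesis using u assms by simp
qed

lemma is_unitary_rows:
  assumes "is_unitary d U" "i < d" "j < d"
  shows "(\<Sum>k<d. U $$ (i, k) * cnj (U $$ (j, k))) = (if i = j then 1 else 0)"
proof -
  have c: "U \<in> carrier_mat d d" using assms by (auto simp: is_unitary_def)
  show ?thesis using is_unitary_cols[OF is_unitary_adjoint[OF assms(1)] assms(2,3)] c assms by simp
qed

section \<open>Diagonalisation of Hermitian matrices and functional calculus\<close>

abbreviation real_diag :: "nat \<Rightarrow> (nat \<Rightarrow> real) \<Rightarrow> complex mat" where
  "real_diag d p \<equiv> mat_diag d (\<lambda>i. complex_of_real (p i))"

text \<open>Eigenbasis and eigenvalues are explicit data, neither sorted nor unique, so that tensor
  products and reorderings act on them directly and relative entropies become finite double
  sums.\<close>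

definition diagonalizes :: "nat \<Rightarrow> complex mat \<Rightarrow> (nat \<Rightarrow> real) \<Rightarrow> complex mat \<Rightarrow> bool" where
  "diagonalizes d U p A \<longleftrightarrow>
     is_unitary d U \<and> A = U * real_diag d p * mat_adjoint U"

lemma unitary_diag_index:
  assumes U: "U \<in> carrier_mat d d" and "i < d" "j < d"
  shows "(U * mat_diag d f * mat_adjoint U) $$ (i, j) = (\<Sum>k<d. f k * U $$ (i, k) * cnj (U $$ (j, k)))"
proof -
  have c: "U * mat_diag d f \<in> carrier_mat d d" using U by auto
  show ?thesis
    using U assms by (subst index_mult[OF c adjoint_carrier[OF U] assms(2,3)])
      (auto intro!: sum.cong simp: mat_diag_mult_right[OF U])
qed

lemma diagonalizes_index:
  assumes "diagonalizes d U p A" "i < d" "j < d"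
  shows "A $$ (i, j) = (\<Sum>k<d. complex_of_real (p k) * U $$ (i, k) * cnj (U $$ (j, k)))"
  using assms by (simp add: diagonalizes_def unitary_diag_index is_unitary_carrier)

lemma diagonalizes_carrier: "diagonalizes d U p A \<Longrightarrow> A \<in> carrier_mat d d"
  by (auto simp: diagonalizes_def is_unitary_def)

lemma diagonalizesI:
  assumes "is_unitary d U" "A \<in> carrier_mat d d"
    "\<And>i j. i < d \<Longrightarrow> j < d \<Longrightarrow> A $$ (i, j) = (\<Sum>k<d. complex_of_real (p k) * U $$ (i, k) * cnj (U $$ (j, k)))"
  shows "diagonalizes d U p A"
  unfolding diagonalizes_def
proof (intro conjI eq_matI)
  have U: "U \<in> carrier_mat d d" using assms by (simp add: is_unitary_def)
  fix i j assume "i < dim_row (U * real_diag d p * mat_adjoint U)"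
    "j < dim_col (U * real_diag d p * mat_adjoint U)"
  then have "i < d" "j < d" using U by auto
  then show "A $$ (i, j) = (U * real_diag d p * mat_adjoint U) $$ (i, j)"
    using assms(3) by (simp add: unitary_diag_index[OF U])
qed (use assms in \<open>auto simp: is_unitary_def\<close>)

text \<open>Gram-Schmidt on a basis completion of \<open>v\<close> gives orthogonal but unnormalised
  columns, the first still being \<open>v\<close>. Dividing each column by its norm makes the matrix
  unitary, which is why its first column is only a multiple of \<open>v\<close>.\<close>

lemma unitary_with_first_column:
  fixes v :: "complex vec"
  assumes v: "v \<in> carrier_vec n" "v \<noteq> 0\<^sub>v n"
  shows "\<exists>U c. is_unitary n U \<and> c \<noteq> 0 \<and> col U 0 = c \<cdot>\<^sub>v v"
proof -
  interpret cof_vec_space n "TYPE(complex)" .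
  define b where "b = basis_completion v"
  from basis_completion[OF v, folded b_def]
  have span_b: "span (set b) = carrier_vec n" and dist_b: "distinct b"
    and indep: "\<not> lin_dep (set b)" and b: "set b \<subseteq> carrier_vec n" and hdb: "hd b = v"
    and len_b: "length b = n" by auto
  have n: "n \<noteq> 0" using v by auto
  from hdb len_b n obtain vs where bv: "b = v # vs" by (cases b, auto)
  define ws where "ws = gram_schmidt n b"
  from gram_schmidt_result[OF b dist_b indep refl, folded ws_def]
  have ws: "set ws \<subseteq> carrier_vec n" "corthogonal ws" "length ws = n"
    by (auto simp: len_b)
  from gram_schmidt_hd[OF v(1), of vs, folded bv] have hdws: "hd ws = v" unfolding ws_def .
  define W where "W = mat_of_cols n ws"
  have orth_W: "corthogonal_mat W" using orthogonal_mat_of_cols ws unfolding W_def .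
  have W: "W \<in> carrier_mat n n"
    using ws unfolding W_def using mat_of_cols_carrier(1)[of n ws] by auto
  define N where "N j = (\<Sum>k<n. (cmod (W $$ (k, j)))\<^sup>2)" for j
  have ip: "(col W i \<bullet>c col W j) = (\<Sum>k<n. W $$ (k, i) * cnj (W $$ (k, j)))" if "i < n" "j < n" for i j
    using W that by (auto simp: scalar_prod_def atLeast0LessThan intro!: sum.cong)
  have orth: "((\<Sum>k<n. W $$ (k, i) * cnj (W $$ (k, j))) = 0) = (i \<noteq> j)" if "i < n" "j < n" for i j
    using corthogonal_matD[OF orth_W, of i j] W that ip[OF that] by auto
  have N: "complex_of_real (N j) = (\<Sum>k<n. W $$ (k, j) * cnj (W $$ (k, j)))" if "j < n" for j
    unfolding N_def of_real_sum by (intro sum.cong refl) (rule complex_norm_square)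
  \<comment> \<open>Orthogonality in the sense of \<open>corthogonal_mat\<close> includes that no
    column is orthogonal to itself, so no norm vanishes.\<close>
  have Npos: "N j > 0" if "j < n" for j
  proof -
    have "N j \<noteq> 0" using orth[OF that that] N[OF that] by auto
    moreover have "N j \<ge> 0" unfolding N_def by (simp add: sum_nonneg)
    ultimately show ?thesis by simp
  qed
  define U where "U = mat n n (\<lambda>(i, j). W $$ (i, j) / complex_of_real (sqrt (N j)))"
  have U: "U \<in> carrier_mat n n" by (simp add: U_def)
  have "mat_adjoint U * U = 1\<^sub>m n"
  proof (rule eq_matI)
    fix i j assume "i < dim_row (1\<^sub>m n :: complex mat)" "j < dim_col (1\<^sub>m n :: complex mat)"
    then have ij: "i < n" "j < n" by auto
    have "(mat_adjoint U * U) $$ (i, j) = (\<Sum>k<n. cnj (U $$ (k, i)) * U $$ (k, j))"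
      using ij U by (subst index_mult[OF adjoint_carrier[OF U] U]) (auto intro!: sum.cong)
    also have "\<dots> = (\<Sum>k<n. W $$ (k, j) * cnj (W $$ (k, i))) / complex_of_real (sqrt (N i) * sqrt (N j))"
      using ij by (auto simp: U_def sum_divide_distrib intro!: sum.cong)
    also have "\<dots> = (if i = j then 1 else 0)"
    proof (cases "i = j")
      case True
      have "complex_of_real (sqrt (N j) * sqrt (N j)) = complex_of_real (N j)"
        using Npos[OF ij(2)] by simp
      then show ?thesis using True N[OF ij(2)] Npos[OF ij(2)] by auto
    next
      case False
      then show ?thesis using orth[OF ij(2,1)] by auto
    qed
    finally show "(mat_adjoint U * U) $$ (i, j) = 1\<^sub>m n $$ (i, j)" using ij by simp
  qed (use U in auto)
  then have uU: "is_unitary n U" by (rule is_unitaryI[OF U])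
  have colW: "col W 0 = v" using hdws ws n unfolding W_def
    by (cases ws) (auto simp: col_mat_of_cols)
  have "col U 0 = (1 / complex_of_real (sqrt (N 0))) \<cdot>\<^sub>v v"
  proof (rule eq_vecI)
    fix i assume "i < dim_vec ((1 / complex_of_real (sqrt (N 0))) \<cdot>\<^sub>v v)"
    then have i: "i < n" using v by auto
    have "v $ i = W $$ (i, 0)" using colW[symmetric] W n i by simp
    then show "col U 0 $ i = ((1 / complex_of_real (sqrt (N 0))) \<cdot>\<^sub>v v) $ i"
      using i n v by (simp add: U_def)
  qed (use v U in auto)
  then show ?thesis using uU Npos[of 0] n by (intro exI[of _ U] exI[of _ "1 / complex_of_real (sqrt (N 0))"]) auto
qed

lemma complex_eigenvector_exists:
  assumes "A \<in> carrier_mat n n" "n \<noteq> 0"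
  shows "\<exists>v e. v \<in> carrier_vec n \<and> v \<noteq> 0\<^sub>v n \<and> A *\<^sub>v v = (e::complex) \<cdot>\<^sub>v v"
proof -
  obtain e where "eigenvalue A e" using spectrum_non_empty[OF assms(1)] assms(2) by (auto simp: spectrum_def)
  then show ?thesis using assms by (auto simp: eigenvalue_def eigenvector_def)
qed

lemma hermitian_index:
  assumes "is_hermitian n A" "i < n" "j < n"
  shows "cnj (A $$ (j, i)) = A $$ (i, j)"
  using assms index_adjoint[of i A j] by (auto simp: is_hermitian_def)

lemma is_hermitianI:
  assumes "A \<in> carrier_mat n n" "\<And>i j. i < n \<Longrightarrow> j < n \<Longrightarrow> cnj (A $$ (j, i)) = A $$ (i, j)"
  shows "is_hermitian n A"
  using assms by (auto simp: is_hermitian_def intro!: eq_matI)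

lemma hermitian_conj:
  assumes "is_hermitian n A" "U \<in> carrier_mat n m"
  shows "is_hermitian m (mat_adjoint U * A * U)"
proof -
  have A: "A \<in> carrier_mat n n" "mat_adjoint A = A" using assms by (auto simp: is_hermitian_def)
  have "mat_adjoint (mat_adjoint U * A * U) = mat_adjoint U * (A * U)"
    using A assms(2)
    by (simp add: adjoint_mult[of "mat_adjoint U * A" m n U m] adjoint_mult[of "mat_adjoint U" m n A n]
        mult_carrier_mat[of _ m n _ n])
  also have "\<dots> = mat_adjoint U * A * U"
    using assoc_mult_mat[OF adjoint_carrier[OF assms(2)] A(1) assms(2)] by simp
  finally show ?thesis using A(1) assms(2)
    by (simp add: is_hermitian_def mult_carrier_mat[of _ m n _ m] mult_carrier_mat[of _ m n _ n])
qed

text \<open>Deflation, by induction on the dimension: in an orthonormal basis that starts with an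
  eigenvector the first column is a multiple of the first unit vector. Hermiticity then clears the
  first row as well and makes the eigenvalue real, and the remaining block is Hermitian of one
  dimension less.\<close>

theorem hermitian_diagonalizable:
  "is_hermitian n A \<Longrightarrow> \<exists>U p. diagonalizes n U p A"
proof (induction n arbitrary: A)
  case 0
  then have "diagonalizes 0 (1\<^sub>m 0) (\<lambda>_. 0) A"
    by (intro diagonalizesI is_unitaryI) (auto simp: is_hermitian_def)
  then show ?case by blast
next
  case (Suc n)
  have A: "A \<in> carrier_mat (Suc n) (Suc n)" using Suc.prems by (auto simp: is_hermitian_def)
  obtain v e where v: "v \<in> carrier_vec (Suc n)" "v \<noteq> 0\<^sub>v (Suc n)" "A *\<^sub>v v = (e::complex) \<cdot>\<^sub>v v"
    using complex_eigenvector_exists[OF A] by auto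
  obtain U c where U: "is_unitary (Suc n) U" and c: "c \<noteq> 0" "col U 0 = c \<cdot>\<^sub>v v"
    using unitary_with_first_column[OF v(1,2)] by auto
  have Uc: "U \<in> carrier_mat (Suc n) (Suc n)" using U by (simp add: is_unitary_def)
  define A' where "A' = mat_adjoint U * A * U"
  have A': "A' \<in> carrier_mat (Suc n) (Suc n)" using A Uc by (auto simp: A'_def)
  have hA': "is_hermitian (Suc n) A'" unfolding A'_def by (rule hermitian_conj[OF Suc.prems Uc])
  have AU0: "(A * U) $$ (i, 0) = e * U $$ (i, 0)" if "i < Suc n" for i
  proof -
    have "(A * U) $$ (i, 0) = (A *\<^sub>v col U 0) $ i" using A Uc that by simp
    also have "\<dots> = c * (A *\<^sub>v v) $ i" using A v(1) that by (simp add: c(2) mult_mat_vec[OF A v(1)])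
    also have "\<dots> = e * (c \<cdot>\<^sub>v v) $ i" using v that by simp
    also have "\<dots> = e * U $$ (i, 0)" using Uc that by (simp flip: c(2))
    finally show ?thesis .
  qed
  have A'col: "A' $$ (i, 0) = (if i = 0 then e else 0)" if "i < Suc n" for i
  proof -
    have "A' = mat_adjoint U * (A * U)"
      unfolding A'_def by (rule assoc_mult_mat[OF adjoint_carrier[OF Uc] A Uc])
    then have "A' $$ (i, 0) = (\<Sum>k<Suc n. mat_adjoint U $$ (i, k) * (A * U) $$ (k, 0))"
      using index_mult[OF adjoint_carrier[OF Uc] mult_carrier_mat[OF A Uc] that, of 0] by simp
    also have "\<dots> = e * (\<Sum>k<Suc n. cnj (U $$ (k, i)) * U $$ (k, 0))"
      unfolding sum_distrib_left using Uc that by (intro sum.cong) (auto simp: AU0)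
    also have "\<dots> = (if i = 0 then e else 0)"
      using is_unitary_cols[OF U that, of 0] by simp
    finally show ?thesis .
  qed
  have A'row: "A' $$ (0, i) = (if i = 0 then e else 0)" if "i < Suc n" for i
    using hermitian_index[OF hA', of 0 i] hermitian_index[OF hA', of 0 0] A'col[OF that] A'col[of 0] that by auto
  have e: "e = complex_of_real (Re e)"
    using hermitian_index[OF hA', of 0 0] A'col[of 0] by (simp add: complex_eq_iff)
  define B where "B = mat n n (\<lambda>(i, j). A' $$ (Suc i, Suc j))"
  have "is_hermitian n B"
    by (rule is_hermitianI) (auto simp: B_def hermitian_index[OF hA'])
  from Suc.IH[OF this] obtain V p where V: "diagonalizes n V p B" by blast
  have uV: "is_unitary n V" using V by (simp add: diagonalizes_def)
  have Vc: "V \<in> carrier_mat n n" using uV by (simp add: is_unitary_def)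
  \<comment> \<open>The direct sum of the scalar 1 and the unitary that diagonalises the lower
    block.\<close>
  define V' where "V' = mat (Suc n) (Suc n)
    (\<lambda>(i, j). case (i, j) of (Suc i, Suc j) \<Rightarrow> V $$ (i, j) | (0, 0) \<Rightarrow> 1 | _ \<Rightarrow> 0)"
  have V': "V' \<in> carrier_mat (Suc n) (Suc n)" by (simp add: V'_def)
  have "mat_adjoint V' * V' = 1\<^sub>m (Suc n)"
  proof (rule eq_matI)
    fix i j assume "i < dim_row (1\<^sub>m (Suc n) :: complex mat)" "j < dim_col (1\<^sub>m (Suc n) :: complex mat)"
    then have ij: "i < Suc n" "j < Suc n" by auto
    have "(mat_adjoint V' * V') $$ (i, j) = (\<Sum>k<Suc n. cnj (V' $$ (k, i)) * V' $$ (k, j))"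
      using ij V' by (subst index_mult[OF adjoint_carrier[OF V'] V']) (auto intro!: sum.cong)
    also have "\<dots> = cnj (V' $$ (0, i)) * V' $$ (0, j) + (\<Sum>k<n. cnj (V' $$ (Suc k, i)) * V' $$ (Suc k, j))"
      by (rule sum.lessThan_Suc_shift)
    also have "\<dots> = (if i = j then 1 else 0)"
      using ij is_unitary_cols[OF uV] by (cases i; cases j) (auto simp: V'_def)
    finally show "(mat_adjoint V' * V') $$ (i, j) = 1\<^sub>m (Suc n) $$ (i, j)" using ij by simp
  qed (use V' in auto)
  then have uV': "is_unitary (Suc n) V'" by (rule is_unitaryI[OF V'])
  have dA': "diagonalizes (Suc n) V' (case_nat (Re e) p) A'"
  proof (rule diagonalizesI[OF uV' A'])
    fix i j assume ij: "i < Suc n" "j < Suc n"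
    have "(\<Sum>k<Suc n. complex_of_real (case_nat (Re e) p k) * V' $$ (i, k) * cnj (V' $$ (j, k)))
      = e * V' $$ (i, 0) * cnj (V' $$ (j, 0)) + (\<Sum>k<n. complex_of_real (p k) * V' $$ (i, Suc k) * cnj (V' $$ (j, Suc k)))"
      by (subst sum.lessThan_Suc_shift) (simp flip: e)
    also have "\<dots> = A' $$ (i, j)"
      using ij A'row A'col diagonalizes_index[OF V]
      by (cases i; cases j) (auto simp: V'_def B_def)
    finally show "A' $$ (i, j) = (\<Sum>k<Suc n. complex_of_real (case_nat (Re e) p k) * V' $$ (i, k) * cnj (V' $$ (j, k)))" ..
  qed
  define D where "D = mat_diag (Suc n) (\<lambda>i. complex_of_real (case_nat (Re e) p i))"
  have D: "D \<in> carrier_mat (Suc n) (Suc n)" by (simp add: D_def)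
  have "U * A' * mat_adjoint U = (U * mat_adjoint U) * A * (U * mat_adjoint U)"
    using A Uc by (simp add: A'_def assoc_mult_mat[of _ "Suc n" "Suc n" _ "Suc n" _ "Suc n"]
        mult_carrier_mat[of _ "Suc n" "Suc n" _ "Suc n"])
  also have "\<dots> = A" using A U by (simp add: is_unitary_def)
  finally have "A = U * (V' * D * mat_adjoint V') * mat_adjoint U"
    using dA' by (simp add: diagonalizes_def D_def)
  also have "\<dots> = (U * V') * D * mat_adjoint (U * V')"
    using Uc V' D by (simp add: adjoint_mult[OF Uc V'] assoc_mult_mat[of _ "Suc n" "Suc n" _ "Suc n" _ "Suc n"]
        mult_carrier_mat[of _ "Suc n" "Suc n" _ "Suc n"])
  finally have "diagonalizes (Suc n) (U * V') (case_nat (Re e) p) A"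
    using is_unitary_mult[OF U uV'] by (simp add: diagonalizes_def D_def)
  then show ?case by blast
qed

lemmas square_mat_simps = mult_carrier_mat[of _ d d _ d] right_mult_one_mat[of _ d d] left_mult_one_mat[of _ d d] for d

lemmas square_mat_assoc = assoc_mult_mat[of _ d d _ d _ d] square_mat_simps[where d = d] for d

lemma diagonalizes_unitary: "diagonalizes d U p A \<Longrightarrow> is_unitary d U"
  by (simp add: diagonalizes_def)

lemma diagonalizes_mult_unitary:
  assumes "diagonalizes d U p A"
  shows "A * U = U * real_diag d p"
proof -
  have U: "U \<in> carrier_mat d d" "mat_adjoint U * U = 1\<^sub>m d" using assms by (auto simp: diagonalizes_def is_unitary_def)
  have "A * U = U * real_diag d p * (mat_adjoint U * U)"
    using assms U(1) by (simp add: diagonalizes_def square_mat_assoc[where d = d])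
  then show ?thesis using U by (simp add: square_mat_simps[where d = d])
qed

lemma diagonalizes_transfer:
  assumes "diagonalizes d U p A" "diagonalizes d V q A"
  shows "(mat_adjoint V * U) * real_diag d p =
    real_diag d q * (mat_adjoint V * U)"
proof -
  let ?P = "real_diag d p" and ?Q = "real_diag d q"
  have U: "U \<in> carrier_mat d d" and V: "V \<in> carrier_mat d d" "mat_adjoint V * V = 1\<^sub>m d"
    using assms by (auto simp: diagonalizes_def is_unitary_def)
  have "(mat_adjoint V * U) * ?P = mat_adjoint V * (A * U)"
    using U V by (simp add: diagonalizes_mult_unitary[OF assms(1)] assoc_mult_mat[of _ d d _ d _ d])
  also have "A = V * ?Q * mat_adjoint V" using assms by (simp add: diagonalizes_def)
  also have "mat_adjoint V * (V * ?Q * mat_adjoint V * U) = (mat_adjoint V * V) * ?Q * (mat_adjoint V * U)"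
    using U V(1) by (simp add: square_mat_assoc[where d = d])
  finally show ?thesis using U V by (simp add: square_mat_simps[where d = d])
qed

text \<open>The change of basis \<open>W\<close> intertwines the two diagonal matrices, so
  \<open>W $$ (i, j)\<close> is nonzero only where \<open>p j = q i\<close>. There
  \<open>f (p j) = f (q i)\<close>, hence \<open>W\<close> also intertwines the diagonals after
  \<open>f\<close> is applied.\<close>

lemma functional_calculus_unique:
  assumes "diagonalizes d U p A" "diagonalizes d V q A"
  shows "U * mat_diag d (\<lambda>i. complex_of_real (f (p i))) * mat_adjoint U =
    V * mat_diag d (\<lambda>i. complex_of_real (f (q i))) * mat_adjoint V"
proof -
  let ?P = "mat_diag d (\<lambda>i. complex_of_real (f (p i)))" and ?Q = "mat_diag d (\<lambda>i. complex_of_real (f (q i)))"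
  define W where "W = mat_adjoint V * U"
  have U: "U \<in> carrier_mat d d" "U * mat_adjoint U = 1\<^sub>m d" and V: "V \<in> carrier_mat d d" "V * mat_adjoint V = 1\<^sub>m d"
    using assms by (auto simp: diagonalizes_def is_unitary_def)
  have W: "W \<in> carrier_mat d d" using U V by (simp add: W_def square_mat_simps[where d = d])
  have "W * ?P = ?Q * W"
  proof (rule eq_matI)
    fix i j assume "i < dim_row (?Q * W)" "j < dim_col (?Q * W)"
    then have ij: "i < d" "j < d" using W by (auto simp: mat_diag_def)
    have "(W * real_diag d p) $$ (i, j) = (real_diag d q * W) $$ (i, j)"
      using diagonalizes_transfer[OF assms] by (simp add: W_def)
    then have "W $$ (i, j) = 0 \<or> p j = q i"
      using ij W by (simp add: mat_diag_mult_left[OF W] mat_diag_mult_right[OF W])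
    then show "(W * ?P) $$ (i, j) = (?Q * W) $$ (i, j)"
      using ij W by (auto simp: mat_diag_mult_left[OF W] mat_diag_mult_right[OF W])
  qed (use W in \<open>auto simp: mat_diag_def\<close>)
  then have *: "V * (W * ?P) * mat_adjoint U = V * (?Q * W) * mat_adjoint U" by simp
  have "V * (W * ?P) * mat_adjoint U = (V * mat_adjoint V) * U * ?P * mat_adjoint U"
    using U(1) V(1) by (simp add: W_def square_mat_assoc[where d = d])
  moreover have "V * (?Q * W) * mat_adjoint U = V * ?Q * mat_adjoint V * (U * mat_adjoint U)"
    using U(1) V(1) by (simp add: W_def square_mat_assoc[where d = d])
  ultimately show ?thesis using * U V by (simp add: square_mat_simps[where d = d])
qed

text \<open>Whatever diagonalisation the choice operator picks, the result is the same matrix, so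
  any known one may be used to compute it.\<close>

lemma spectral_fun_eq:
  assumes "diagonalizes d U p A"
  shows "spectral_fun f A = U * mat_diag d (\<lambda>i. complex_of_real (f (p i))) * mat_adjoint U"
proof -
  have d: "dim_row A = d" using diagonalizes_carrier[OF assms] by auto
  have "\<exists>V q. is_unitary d V \<and> A = V * real_diag d q * mat_adjoint V \<and>
     spectral_fun f A = V * mat_diag d (\<lambda>i. complex_of_real (f (q i))) * mat_adjoint V"
    unfolding spectral_fun_def d by (rule someI_ex) (use assms in \<open>auto simp: diagonalizes_def\<close>)
  then obtain V q where "diagonalizes d V q A"
    "spectral_fun f A = V * mat_diag d (\<lambda>i. complex_of_real (f (q i))) * mat_adjoint V"
    by (auto simp: diagonalizes_def)
  then show ?thesis using functional_calculus_unique[OF assms] by simp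
qed

text \<open>Two operators with different eigenbases meet only in the squared overlaps of their
  eigenvectors. These weights form a doubly stochastic array, which is what turns relative entropy
  into a classical expression.\<close>

lemma mtrace_diag_product:
  assumes U: "is_unitary d U" and V: "is_unitary d V"
  shows "mtrace ((U * mat_diag d f * mat_adjoint U) * (V * mat_diag d g * mat_adjoint V)) =
    (\<Sum>i<d. \<Sum>j<d. f i * g j * complex_of_real ((cmod ((mat_adjoint U * V) $$ (i, j)))\<^sup>2))"
proof -
  have Uc: "U \<in> carrier_mat d d" and Vc: "V \<in> carrier_mat d d" using assms by (auto simp: is_unitary_def)
  define W where "W = mat_adjoint U * V"
  have W: "W \<in> carrier_mat d d" using Uc Vc by (simp add: W_def square_mat_simps[where d = d])
  have adjW: "mat_adjoint W = mat_adjoint V * U"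
    using Uc Vc by (simp add: W_def adjoint_mult[of _ d d _ d])
  have "mtrace ((U * mat_diag d f * mat_adjoint U) * (V * mat_diag d g * mat_adjoint V)) =
      mtrace (U * (mat_diag d f * mat_adjoint U * V * mat_diag d g * mat_adjoint V))"
    using Uc Vc by (simp add: square_mat_assoc[where d = d])
  also have "\<dots> = mtrace ((mat_diag d f * mat_adjoint U * V * mat_diag d g * mat_adjoint V) * U)"
    using Uc Vc by (intro mtrace_comm[of _ d d]) (simp_all add: square_mat_simps[where d = d])
  also have "\<dots> = mtrace ((mat_diag d f * W) * (mat_diag d g * mat_adjoint W))"
    using Uc Vc unfolding adjW by (simp add: W_def square_mat_assoc[where d = d])
  also have "\<dots> = (\<Sum>i<d. \<Sum>j<d. f i * g j * complex_of_real ((cmod (W $$ (i, j)))\<^sup>2))"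
  proof -
    have "((mat_diag d f * W) * (mat_diag d g * mat_adjoint W)) $$ (i, i) =
      (\<Sum>j<d. f i * g j * complex_of_real ((cmod (W $$ (i, j)))\<^sup>2))" if "i < d" for i
    proof -
      have "((mat_diag d f * W) * (mat_diag d g * mat_adjoint W)) $$ (i, i) =
        (\<Sum>j<d. (mat_diag d f * W) $$ (i, j) * (mat_diag d g * mat_adjoint W) $$ (j, i))"
        using W that by (intro index_mult) (simp_all add: square_mat_simps[where d = d])
      also have "\<dots> = (\<Sum>j<d. f i * g j * (W $$ (i, j) * cnj (W $$ (i, j))))"
        using W that by (intro sum.cong)
          (simp_all add: mat_diag_mult_left[OF W] mat_diag_mult_left[OF adjoint_carrier[OF W]])
      finally show ?thesis by (simp only: complex_norm_square)
    qed
    then show ?thesis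
      using W unfolding mtrace_def by (simp add: mat_diag_def del: index_mult_mat(1))
  qed
  finally show ?thesis by (simp add: W_def)
qed

lemma mtrace_diagonalizes:
  assumes "diagonalizes d U p A"
  shows "mtrace A = complex_of_real (\<Sum>i<d. p i)"
proof -
  have U: "is_unitary d U" using assms by (simp add: diagonalizes_def)
  have "mtrace A = (\<Sum>i<d. \<Sum>k<d. complex_of_real (p k) * (cnj (U $$ (i, k)) * U $$ (i, k)))"
    using diagonalizes_carrier[OF assms] diagonalizes_index[OF assms] unfolding mtrace_def
    by (auto intro!: sum.cong simp: mult_ac)
  also have "\<dots> = (\<Sum>k<d. complex_of_real (p k) * (\<Sum>i<d. cnj (U $$ (i, k)) * U $$ (i, k)))"
    by (subst sum.swap) (simp add: sum_distrib_left)
  also have "\<dots> = complex_of_real (\<Sum>i<d. p i)" using is_unitary_cols[OF U] by simp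
  finally show ?thesis .
qed

lemma quadratic_form_index:
  assumes "A \<in> carrier_mat d d" "v \<in> carrier_vec d"
  shows "(A *\<^sub>v v) \<bullet>c v = (\<Sum>i<d. \<Sum>j<d. A $$ (i, j) * v $ j * cnj (v $ i))"
  using assms by (auto simp: scalar_prod_def atLeast0LessThan sum_distrib_right intro!: sum.cong)

lemma diagonalizes_form:
  assumes "diagonalizes d U p A"
  shows "(\<Sum>i<d. \<Sum>j<d. A $$ (i, j) * x j * cnj (y i)) =
    (\<Sum>k<d. complex_of_real (p k) * (\<Sum>j<d. cnj (U $$ (j, k)) * x j) * cnj (\<Sum>i<d. cnj (U $$ (i, k)) * y i))"
proof -
  have "(\<Sum>i<d. \<Sum>j<d. A $$ (i, j) * x j * cnj (y i)) =
    (\<Sum>i<d. \<Sum>j<d. \<Sum>k<d. complex_of_real (p k) * (cnj (U $$ (j, k)) * x j) * cnj (cnj (U $$ (i, k)) * y i))"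
    by (auto simp: diagonalizes_index[OF assms] sum_distrib_right sum_distrib_left mult_ac intro!: sum.cong)
  also have "\<dots> = (\<Sum>i<d. \<Sum>k<d. \<Sum>j<d. complex_of_real (p k) * (cnj (U $$ (j, k)) * x j) * cnj (cnj (U $$ (i, k)) * y i))"
    by (rule sum.cong[OF refl], rule sum.swap)
  also have "\<dots> = (\<Sum>k<d. \<Sum>i<d. \<Sum>j<d. complex_of_real (p k) * (cnj (U $$ (j, k)) * x j) * cnj (cnj (U $$ (i, k)) * y i))"
    by (rule sum.swap)
  also have "\<dots> = (\<Sum>k<d. complex_of_real (p k) * (\<Sum>j<d. cnj (U $$ (j, k)) * x j) * cnj (\<Sum>i<d. cnj (U $$ (i, k)) * y i))"
    by (simp only: sum_distrib_left sum_distrib_right cnj_sum)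
  finally show ?thesis .
qed

text \<open>The eigenvalues are the values of the quadratic form at the eigenvectors, the columns of
  \<open>U\<close>; conversely the form is a sum of squares weighted by the eigenvalues.\<close>

lemma is_psd_iff:
  "is_psd d A \<longleftrightarrow> (\<exists>U p. diagonalizes d U p A \<and> (\<forall>i<d. 0 \<le> p i))"
proof
  assume psd: "is_psd d A"
  then obtain U p where D: "diagonalizes d U p A"
    using hermitian_diagonalizable[of d A] by (auto simp: is_psd_def)
  have U: "is_unitary d U" and A: "A \<in> carrier_mat d d"
    using diagonalizes_unitary[OF D] diagonalizes_carrier[OF D] .
  have Uc: "U \<in> carrier_mat d d" using U by (simp add: is_unitary_def)
  have "0 \<le> p i" if i: "i < d" for i
  proof -
    have c: "col U i \<in> carrier_vec d" using Uc by auto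
    have "(A *\<^sub>v col U i) \<bullet>c col U i =
      (\<Sum>k<d. complex_of_real (p k) * (\<Sum>j<d. cnj (U $$ (j, k)) * U $$ (j, i)) * cnj (\<Sum>j<d. cnj (U $$ (j, k)) * U $$ (j, i)))"
      unfolding quadratic_form_index[OF A c] using Uc i
      by (subst diagonalizes_form[OF D, symmetric]) (auto intro!: sum.cong)
    also have "\<dots> = (\<Sum>k<d. if k = i then complex_of_real (p k) else 0)"
      using is_unitary_cols[OF U] i by (intro sum.cong) auto
    also have "\<dots> = complex_of_real (p i)" using i by simp
    finally show ?thesis using psd c by (auto simp: is_psd_def)
  qed
  with D show "\<exists>U p. diagonalizes d U p A \<and> (\<forall>i<d. 0 \<le> p i)" by blast
next
  assume "\<exists>U p. diagonalizes d U p A \<and> (\<forall>i<d. 0 \<le> p i)"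
  then obtain U p where D: "diagonalizes d U p A" and p: "\<And>i. i < d \<Longrightarrow> 0 \<le> p i" by blast
  have A: "A \<in> carrier_mat d d" using diagonalizes_carrier[OF D] .
  have "is_hermitian d A"
    by (rule is_hermitianI[OF A]) (auto simp: diagonalizes_index[OF D] mult_ac)
  moreover have "0 \<le> Re ((A *\<^sub>v v) \<bullet>c v)" if v: "v \<in> carrier_vec d" for v
  proof -
    have "(A *\<^sub>v v) \<bullet>c v = complex_of_real (\<Sum>k<d. p k * (cmod (\<Sum>j<d. cnj (U $$ (j, k)) * v $ j))\<^sup>2)"
      unfolding quadratic_form_index[OF A v] diagonalizes_form[OF D] of_real_sum of_real_mult complex_norm_square
      by (simp add: mult.assoc)
    then show ?thesis using p by (auto intro!: sum_nonneg)
  qed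
  ultimately show "is_psd d A" by (auto simp: is_psd_def)
qed

lemma is_state_iff:
  "is_state d A \<longleftrightarrow> (\<exists>U p. diagonalizes d U p A \<and> (\<forall>i<d. 0 \<le> p i) \<and> (\<Sum>i<d. p i) = 1)"
proof -
  have "mtrace A = 1 \<longleftrightarrow> (\<Sum>i<d. p i) = 1" if "diagonalizes d U p A" for U p
    unfolding mtrace_diagonalizes[OF that] by (rule of_real_eq_1_iff)
  then show ?thesis unfolding is_state_def is_psd_iff by blast
qed

lemma is_state_carrier: "is_state d A \<Longrightarrow> A \<in> carrier_mat d d"
  by (auto simp: is_state_def is_psd_def is_hermitian_def)

lemma unitary_row_norm:
  assumes "is_unitary d U" "i < d"
  shows "(\<Sum>j<d. (cmod (U $$ (i, j)))\<^sup>2) = 1"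
proof -
  have "complex_of_real (\<Sum>j<d. (cmod (U $$ (i, j)))\<^sup>2) = 1"
    unfolding of_real_sum complex_norm_square using is_unitary_rows[OF assms assms(2)] by simp
  then show ?thesis by (simp only: of_real_eq_1_iff)
qed

lemma unitary_col_norm:
  assumes "is_unitary d U" "j < d"
  shows "(\<Sum>i<d. (cmod (U $$ (i, j)))\<^sup>2) = 1"
proof -
  have "complex_of_real (\<Sum>i<d. (cmod (U $$ (i, j)))\<^sup>2) = 1"
    unfolding of_real_sum complex_norm_square using is_unitary_cols[OF assms assms(2)] by (simp add: mult.commute)
  then show ?thesis by (simp only: of_real_eq_1_iff)
qed

section \<open>Relative entropy in eigenbases\<close>

definition log_or_0 :: "real \<Rightarrow> real" where
  "log_or_0 x = (if x = 0 then 0 else log 2 x)"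

text \<open>The classical relative entropy in bits of the joint distributions
  \<open>|W i j|^2 * p i\<close> and \<open>|W i j|^2 * q j\<close>; the common weight cancels
  inside the logarithm.\<close>

definition spectral_divergence :: "nat \<Rightarrow> complex mat \<Rightarrow> (nat \<Rightarrow> real) \<Rightarrow> (nat \<Rightarrow> real) \<Rightarrow> real" where
  "spectral_divergence d W p q =
     (\<Sum>i<d. \<Sum>j<d. (cmod (W $$ (i, j)))\<^sup>2 * (p i * (log_or_0 (p i) - log_or_0 (q j))))"

text \<open>Absolute continuity of the joint distribution \<open>|W i j|^2 * p i\<close> with
  respect to \<open>|W i j|^2 * q j\<close>.\<close>

definition supported :: "nat \<Rightarrow> complex mat \<Rightarrow> (nat \<Rightarrow> real) \<Rightarrow> (nat \<Rightarrow> real) \<Rightarrow> bool" where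
  "supported d W p q \<longleftrightarrow> (\<forall>i<d. \<forall>j<d. q j = 0 \<longrightarrow> p i = 0 \<or> W $$ (i, j) = 0)"

lemma unitary_vec_eq_0:
  assumes "is_unitary d U" "v \<in> carrier_vec d" "U *\<^sub>v v = 0\<^sub>v d"
  shows "v = 0\<^sub>v d"
proof -
  have "v = (mat_adjoint U * U) *\<^sub>v v" using assms by (simp add: is_unitary_def)
  also have "\<dots> = mat_adjoint U *\<^sub>v (U *\<^sub>v v)"
    using assms by (intro assoc_mult_mat_vec) (auto simp: is_unitary_def)
  also have "\<dots> = 0\<^sub>v d" unfolding assms(3) using assms(1)
    by (intro eq_vecI) (auto simp: is_unitary_def scalar_prod_def)
  finally show ?thesis .
qed

text \<open>In coordinates with respect to the eigenbasis \<open>V\<close>, the kernel of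
  \<open>\<sigma>\<close> consists of the vectors supported where \<open>q\<close> vanishes, and
  \<open>\<rho>\<close> becomes \<open>U\<close> times the matrix with entries
  \<open>p i * W i j\<close>. The unitary \<open>U\<close> in front does not affect
  vanishing.\<close>

lemma support_iff:
  assumes D: "diagonalizes d U p \<rho>" and E: "diagonalizes d V q \<sigma>"
  shows "(\<forall>v\<in>carrier_vec d. \<sigma> *\<^sub>v v = 0\<^sub>v d \<longrightarrow> \<rho> *\<^sub>v v = 0\<^sub>v d) \<longleftrightarrow> supported d (mat_adjoint U * V) p q"
proof -
  let ?P = "real_diag d p" and ?Q = "real_diag d q"
  define W where "W = mat_adjoint U * V"
  have U: "U \<in> carrier_mat d d" "mat_adjoint U * U = 1\<^sub>m d" and V: "V \<in> carrier_mat d d" "V * mat_adjoint V = 1\<^sub>m d"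
    and uU: "is_unitary d U" and uV: "is_unitary d V"
    using assms by (auto simp: diagonalizes_def is_unitary_def)
  have W: "W \<in> carrier_mat d d" using U V by (simp add: W_def square_mat_simps[where d = d])
  have c: "\<rho> \<in> carrier_mat d d" "\<sigma> \<in> carrier_mat d d"
    using diagonalizes_carrier[OF D] diagonalizes_carrier[OF E] .
  have sV: "\<sigma> * V = V * ?Q" by (rule diagonalizes_mult_unitary[OF E])
  have rV: "\<rho> * V = U * (?P * W)"
    using D U V by (simp add: diagonalizes_def W_def square_mat_assoc[where d = d])
  have s_iff: "\<sigma> *\<^sub>v (V *\<^sub>v y) = 0\<^sub>v d \<longleftrightarrow> (\<forall>j<d. q j = 0 \<or> y $ j = 0)" if y: "y \<in> carrier_vec d" for y
  proof -
    have "\<sigma> *\<^sub>v (V *\<^sub>v y) = (V * ?Q) *\<^sub>v y"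
      unfolding sV[symmetric] using c V y by (simp add: assoc_mult_mat_vec[of _ d d _ d])
    also have "\<dots> = V *\<^sub>v (?Q *\<^sub>v y)" using V y by (intro assoc_mult_mat_vec[of _ d d _ d]) auto
    finally have "\<sigma> *\<^sub>v (V *\<^sub>v y) = 0\<^sub>v d \<longleftrightarrow> ?Q *\<^sub>v y = 0\<^sub>v d"
      using unitary_vec_eq_0[OF uV, of "?Q *\<^sub>v y"] V y by (auto simp: mult_mat_vec_carrier[of _ d d])
    also have "?Q *\<^sub>v y = vec d (\<lambda>j. complex_of_real (q j) * y $ j)"
      using y by (intro eq_vecI) (auto simp: mat_diag_def scalar_prod_def if_distrib[of "\<lambda>x. x * _"] cong: if_cong)
    also have "\<dots> = 0\<^sub>v d \<longleftrightarrow> (\<forall>j<d. q j = 0 \<or> y $ j = 0)" by (auto simp: vec_eq_iff)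
    finally show ?thesis .
  qed
  have r_iff: "\<rho> *\<^sub>v (V *\<^sub>v y) = 0\<^sub>v d \<longleftrightarrow> (\<forall>i<d. complex_of_real (p i) * (\<Sum>j<d. W $$ (i, j) * y $ j) = 0)"
    if y: "y \<in> carrier_vec d" for y
  proof -
    have "\<rho> *\<^sub>v (V *\<^sub>v y) = (U * (?P * W)) *\<^sub>v y"
      unfolding rV[symmetric] using c V y by (simp add: assoc_mult_mat_vec[of _ d d _ d])
    also have "\<dots> = U *\<^sub>v ((?P * W) *\<^sub>v y)" using U W y
      by (intro assoc_mult_mat_vec[of _ d d _ d]) (auto simp: square_mat_simps[where d = d])
    finally have "\<rho> *\<^sub>v (V *\<^sub>v y) = 0\<^sub>v d \<longleftrightarrow> (?P * W) *\<^sub>v y = 0\<^sub>v d"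
      using unitary_vec_eq_0[OF uU, of "(?P * W) *\<^sub>v y"] U W y
      by (auto simp: mult_mat_vec_carrier[of _ d d] square_mat_simps[where d = d])
    also have "(?P * W) *\<^sub>v y = vec d (\<lambda>i. complex_of_real (p i) * (\<Sum>j<d. W $$ (i, j) * y $ j))"
      using y W by (intro eq_vecI) (auto simp: mat_diag_mult_left[OF W] scalar_prod_def sum_distrib_left mult_ac
        atLeast0LessThan intro!: sum.cong)
    also have "\<dots> = 0\<^sub>v d \<longleftrightarrow> (\<forall>i<d. complex_of_real (p i) * (\<Sum>j<d. W $$ (i, j) * y $ j) = 0)"
      by (auto simp: vec_eq_iff)
    finally show ?thesis .
  qed
  show ?thesis unfolding W_def[symmetric]
  proof
    assume L: "\<forall>v\<in>carrier_vec d. \<sigma> *\<^sub>v v = 0\<^sub>v d \<longrightarrow> \<rho> *\<^sub>v v = 0\<^sub>v d"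
    show "supported d W p q" unfolding supported_def
    proof (intro allI impI)
      fix i j assume ij: "i < d" "j < d" "q j = 0"
      have y: "unit_vec d j \<in> carrier_vec d" by simp
      have "\<sigma> *\<^sub>v (V *\<^sub>v unit_vec d j) = 0\<^sub>v d" unfolding s_iff[OF y] using ij by (auto simp: unit_vec_def)
      then have "\<rho> *\<^sub>v (V *\<^sub>v unit_vec d j) = 0\<^sub>v d" using L V by (auto simp: mult_mat_vec_carrier[of _ d d])
      then have "complex_of_real (p i) * (\<Sum>k<d. W $$ (i, k) * unit_vec d j $ k) = 0"
        unfolding r_iff[OF y] using ij by blast
      moreover have "(\<Sum>k<d. W $$ (i, k) * unit_vec d j $ k) = (\<Sum>k<d. if k = j then W $$ (i, k) else 0)"
        using ij by (intro sum.cong) auto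
      ultimately show "p i = 0 \<or> W $$ (i, j) = 0" using ij by auto
    qed
  next
    assume S: "supported d W p q"
    show "\<forall>v\<in>carrier_vec d. \<sigma> *\<^sub>v v = 0\<^sub>v d \<longrightarrow> \<rho> *\<^sub>v v = 0\<^sub>v d"
    proof (intro ballI impI)
      fix v assume v: "v \<in> carrier_vec d" "\<sigma> *\<^sub>v v = 0\<^sub>v d"
      define y where "y = mat_adjoint V *\<^sub>v v"
      have y: "y \<in> carrier_vec d" using V v by (auto simp: y_def mult_mat_vec_carrier[of _ d d])
      have vy: "v = V *\<^sub>v y"
        using V v by (simp add: y_def assoc_mult_mat_vec[of V d d _ d, symmetric])
      have "complex_of_real (p i) * (\<Sum>j<d. W $$ (i, j) * y $ j) = 0" if i: "i < d" for i
        using v(2) S i unfolding vy s_iff[OF y] supported_def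
        by (cases "p i = 0") (force intro!: sum.neutral)+
      then show "\<rho> *\<^sub>v v = 0\<^sub>v d" unfolding vy r_iff[OF y] by blast
    qed
  qed
qed

lemma mtrace_minus:
  assumes "A \<in> carrier_mat d d" "B \<in> carrier_mat d d"
  shows "mtrace (A - B) = mtrace A - mtrace B"
  using assms by (simp add: mtrace_def sum_subtractf)

lemma rel_entropy_eq:
  assumes D: "diagonalizes d U p \<rho>" and E: "diagonalizes d V q \<sigma>"
  shows "rel_entropy \<rho> \<sigma> = (if supported d (mat_adjoint U * V) p q
    then ereal (spectral_divergence d (mat_adjoint U * V) p q) else \<infinity>)"
proof -
  have U: "is_unitary d U" and V: "is_unitary d V" using D E by (auto simp: diagonalizes_def)
  have c: "\<rho> \<in> carrier_mat d d" "\<sigma> \<in> carrier_mat d d" "U \<in> carrier_mat d d" "V \<in> carrier_mat d d"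
    using diagonalizes_carrier[OF D] diagonalizes_carrier[OF E] U V by (auto simp: is_unitary_def)
  define W where "W = mat_adjoint U * V"
  have W: "is_unitary d W" unfolding W_def by (intro is_unitary_mult is_unitary_adjoint U V)
  note rowsum = unitary_row_norm[OF W]
  define lr where "lr = U * mat_diag d (\<lambda>i. complex_of_real (log_or_0 (p i))) * mat_adjoint U"
  define ls where "ls = V * mat_diag d (\<lambda>i. complex_of_real (log_or_0 (q i))) * mat_adjoint V"
  have mlog: "mlog = spectral_fun log_or_0" by (simp add: mlog_def log_or_0_def[abs_def])
  have l: "mlog \<rho> = lr" "mlog \<sigma> = ls"
    unfolding mlog lr_def ls_def by (rule spectral_fun_eq[OF D], rule spectral_fun_eq[OF E])
  have lc: "lr \<in> carrier_mat d d" "ls \<in> carrier_mat d d"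
    using c by (auto simp: lr_def ls_def)
  have rho: "\<rho> = U * real_diag d p * mat_adjoint U" using D by (simp add: diagonalizes_def)
  have "mtrace (\<rho> * (lr - ls)) = mtrace (\<rho> * lr) - mtrace (\<rho> * ls)"
    unfolding mult_minus_distrib_mat[OF c(1) lc] using c lc by (intro mtrace_minus[of _ d]) auto
  also have "mtrace (\<rho> * ls) = complex_of_real (\<Sum>i<d. \<Sum>j<d. p i * log_or_0 (q j) * (cmod (W $$ (i, j)))\<^sup>2)"
    unfolding rho lr_def ls_def mtrace_diag_product[OF U V] W_def[symmetric] by simp
  also have "mtrace (\<rho> * lr) = complex_of_real (\<Sum>i<d. \<Sum>j<d. p i * log_or_0 (p j) * (cmod ((mat_adjoint U * U) $$ (i, j)))\<^sup>2)"
    unfolding rho lr_def ls_def mtrace_diag_product[OF U U] by simp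
  also have "(\<Sum>i<d. \<Sum>j<d. p i * log_or_0 (p j) * (cmod ((mat_adjoint U * U) $$ (i, j)))\<^sup>2) =
      (\<Sum>i<d. \<Sum>j<d. if j = i then p i * log_or_0 (p i) else 0)"
    using U by (intro sum.cong refl) (simp add: is_unitary_def del: index_mult_mat(1))
  \<comment> \<open>The entropy term involves a single basis. Since every row of the squared
    overlaps sums to 1, it can be spread over the same double sum as the cross term.\<close>
  also have "\<dots> = (\<Sum>i<d. \<Sum>j<d. p i * log_or_0 (p i) * (cmod (W $$ (i, j)))\<^sup>2)"
    by (simp add: sum_distrib_left[symmetric] rowsum)
  finally have "Re (mtrace (\<rho> * (mlog \<rho> - mlog \<sigma>))) =
    (\<Sum>i<d. \<Sum>j<d. p i * log_or_0 (p i) * (cmod (W $$ (i, j)))\<^sup>2) - (\<Sum>i<d. \<Sum>j<d. p i * log_or_0 (q j) * (cmod (W $$ (i, j)))\<^sup>2)"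
    unfolding l by simp
  also have "\<dots> = spectral_divergence d W p q"
    unfolding spectral_divergence_def sum_subtractf[symmetric] by (intro sum.cong refl) (simp add: algebra_simps)
  finally have *: "Re (mtrace (\<rho> * (mlog \<rho> - mlog \<sigma>))) = spectral_divergence d W p q" .
  show ?thesis
    using c support_iff[OF D E] unfolding rel_entropy_def * W_def by (simp only: carrier_matD)
qed

section \<open>Tensor products\<close>

lemma pair_index_cases:
  fixes i a b :: nat
  assumes "i < a * b"
  obtains x y where "x < a" "y < b" "i = x * b + y"
  using div_index_less[OF assms] mod_index_less[OF assms] by (metis div_mult_mod_eq)

lemma kron_carrier: "A \<in> carrier_mat n m \<Longrightarrow> B \<in> carrier_mat n' m' \<Longrightarrow> kron A B \<in> carrier_mat (n * n') (m * m')"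
  by (auto simp: kron_def)

lemma kron_dims [simp]:
  "dim_row (kron A B) = dim_row A * dim_row B" "dim_col (kron A B) = dim_col A * dim_col B"
  by (auto simp: kron_def)

lemma kron_index:
  assumes "A \<in> carrier_mat n m" "B \<in> carrier_mat n' m'" "i < n" "j < m" "i' < n'" "j' < m'"
  shows "kron A B $$ (i * n' + i', j * m' + j') = A $$ (i, j) * B $$ (i', j')"
  using assms by (auto simp: kron_def pair_index_less)

lemma kron_eqI:
  assumes "X \<in> carrier_mat (n * n') (m * m')" "Y \<in> carrier_mat (n * n') (m * m')"
    "\<And>i i' j j'. i < n \<Longrightarrow> i' < n' \<Longrightarrow> j < m \<Longrightarrow> j' < m' \<Longrightarrow>
      X $$ (i * n' + i', j * m' + j') = Y $$ (i * n' + i', j * m' + j')"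
  shows "X = Y"
proof (rule eq_matI)
  fix i j assume "i < dim_row Y" "j < dim_col Y"
  then have "i < n * n'" "j < m * m'" using assms by auto
  then show "X $$ (i, j) = Y $$ (i, j)" by (metis pair_index_cases assms(3))
qed (use assms in auto)

lemma kron_mult:
  assumes "A \<in> carrier_mat n k" "B \<in> carrier_mat n' k'" "C \<in> carrier_mat k m" "D \<in> carrier_mat k' m'"
  shows "kron A B * kron C D = kron (A * C) (B * D)"
proof (rule kron_eqI[of _ n n' m m'])
  fix i i' j j' assume ij: "i < n" "i' < n'" "j < m" "j' < m'"
  have "(kron A B * kron C D) $$ (i * n' + i', j * m' + j') =
    (\<Sum>l<k * k'. kron A B $$ (i * n' + i', l) * kron C D $$ (l, j * m' + j'))"
    using assms ij by (intro index_mult kron_carrier) (auto simp: pair_index_less)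
  also have "\<dots> = (\<Sum>l<k. \<Sum>l'<k'. (A $$ (i, l) * C $$ (l, j)) * (B $$ (i', l') * D $$ (l', j')))"
    unfolding sum_pair_index using assms ij
    by (intro sum.cong refl) (simp add: kron_index[of _ n k _ n' k'] kron_index[of _ k m _ k' m'])
  also have "\<dots> = (A * C) $$ (i, j) * (B * D) $$ (i', j')"
    using index_mult[OF assms(1,3) ij(1,3)] index_mult[OF assms(2,4) ij(2,4)]
    by (simp only: sum_product)
  also have "\<dots> = kron (A * C) (B * D) $$ (i * n' + i', j * m' + j')"
    using assms ij by (intro kron_index[symmetric]) auto
  finally show "(kron A B * kron C D) $$ (i * n' + i', j * m' + j') = kron (A * C) (B * D) $$ (i * n' + i', j * m' + j')" .
qed (use assms in \<open>auto intro!: kron_carrier mult_carrier_mat\<close>)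

lemma adjoint_kron: "mat_adjoint (kron A B) = kron (mat_adjoint A) (mat_adjoint B)"
  by (rule kron_eqI[of _ "dim_col A" "dim_col B" "dim_row A" "dim_row B"])
    (auto simp: kron_index[of _ "dim_col A" "dim_row A" _ "dim_col B" "dim_row B"]
      kron_index[of _ "dim_row A" "dim_col A" _ "dim_row B" "dim_col B"] pair_index_less)

lemma kron_one: "kron (1\<^sub>m n) (1\<^sub>m m) = 1\<^sub>m (n * m)"
proof (rule kron_eqI[of _ n m n m])
  fix i i' j j' assume ij: "i < n" "i' < m" "j < n" "j' < m"
  have "i * m + i' = j * m + j' \<longleftrightarrow> i = j \<and> i' = j'" using ij by (metis pair_index)
  then show "kron (1\<^sub>m n) (1\<^sub>m m) $$ (i * m + i', j * m + j') = (1\<^sub>m (n * m) :: complex mat) $$ (i * m + i', j * m + j')"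
    using ij by (simp add: kron_index[of _ n n _ m m] pair_index_less)
qed (auto intro: kron_carrier)

lemma is_unitary_kron:
  assumes "is_unitary n U" "is_unitary m V"
  shows "is_unitary (n * m) (kron U V)"
proof -
  have c: "U \<in> carrier_mat n n" "V \<in> carrier_mat m m" using assms by (auto simp: is_unitary_def)
  show ?thesis
    using assms c by (intro is_unitaryI)
      (auto simp: is_unitary_def adjoint_kron kron_mult[of _ n n _ m m _ n _ m] kron_one intro: kron_carrier)
qed

lemma diagonalizes_kron:
  assumes D: "diagonalizes n U p A" and E: "diagonalizes m V q B"
  shows "diagonalizes (n * m) (kron U V) (\<lambda>i. p (i div m) * q (i mod m)) (kron A B)"
proof (rule diagonalizesI)
  have c: "U \<in> carrier_mat n n" "V \<in> carrier_mat m m" "A \<in> carrier_mat n n" "B \<in> carrier_mat m m"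
    using diagonalizes_unitary[OF D] diagonalizes_unitary[OF E] diagonalizes_carrier[OF D] diagonalizes_carrier[OF E]
    by (auto simp: is_unitary_def)
  show "is_unitary (n * m) (kron U V)"
    by (intro is_unitary_kron diagonalizes_unitary[OF D] diagonalizes_unitary[OF E])
  show "kron A B \<in> carrier_mat (n * m) (n * m)" using c by (intro kron_carrier)
  fix i j assume "i < n * m" "j < n * m"
  obtain x x' where i: "x < n" "x' < m" "i = x * m + x'" using \<open>i < n * m\<close> by (rule pair_index_cases)
  obtain y y' where j: "y < n" "y' < m" "j = y * m + y'" using \<open>j < n * m\<close> by (rule pair_index_cases)
  have "kron A B $$ (i, j) = A $$ (x, y) * B $$ (x', y')"
    using c i j by (simp add: kron_index)
  also have "\<dots> = (\<Sum>k<n. \<Sum>k'<m. (complex_of_real (p k) * U $$ (x, k) * cnj (U $$ (y, k))) *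
     (complex_of_real (q k') * V $$ (x', k') * cnj (V $$ (y', k'))))"
    using i j by (simp only: diagonalizes_index[OF D] diagonalizes_index[OF E] sum_product)
  also have "\<dots> = (\<Sum>l<n * m. complex_of_real (p (l div m) * q (l mod m)) * kron U V $$ (i, l) * cnj (kron U V $$ (j, l)))"
    unfolding sum_pair_index using c i j by (intro sum.cong refl) (simp add: kron_index)
  finally show "kron A B $$ (i, j) =
    (\<Sum>l<n * m. complex_of_real (p (l div m) * q (l mod m)) * kron U V $$ (i, l) * cnj (kron U V $$ (j, l)))" .
qed

section \<open>Reordering of tensor factors\<close>

definition permute_mat :: "nat \<Rightarrow> (nat \<Rightarrow> nat) \<Rightarrow> complex mat \<Rightarrow> complex mat" where
  "permute_mat d \<pi> X = mat d d (\<lambda>(i, j). X $$ (\<pi> i, \<pi> j))"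

lemma permute_mat_carrier [simp]: "permute_mat d \<pi> X \<in> carrier_mat d d"
  by (simp add: permute_mat_def)

lemma permute_mat_index [simp]: "i < d \<Longrightarrow> j < d \<Longrightarrow> permute_mat d \<pi> X $$ (i, j) = X $$ (\<pi> i, \<pi> j)"
  by (simp add: permute_mat_def)

context
  fixes d :: nat and \<pi> :: "nat \<Rightarrow> nat"
  assumes bij: "bij_betw \<pi> {..<d} {..<d}"
begin

lemma permute_less: "i < d \<Longrightarrow> \<pi> i < d"
  using bij by (auto simp: bij_betw_def)

lemma permute_adjoint_mult:
  assumes "U \<in> carrier_mat d d" "V \<in> carrier_mat d d"
  shows "mat_adjoint (permute_mat d \<pi> U) * permute_mat d \<pi> V = permute_mat d \<pi> (mat_adjoint U * V)"
proof (rule eq_matI)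
  fix i j assume "i < dim_row (permute_mat d \<pi> (mat_adjoint U * V))" "j < dim_col (permute_mat d \<pi> (mat_adjoint U * V))"
  then have ij: "i < d" "j < d" by (auto simp: permute_mat_def)
  have c: "permute_mat d \<pi> U \<in> carrier_mat d d" for U by simp
  have "(mat_adjoint (permute_mat d \<pi> U) * permute_mat d \<pi> V) $$ (i, j) =
    (\<Sum>k<d. mat_adjoint (permute_mat d \<pi> U) $$ (i, k) * permute_mat d \<pi> V $$ (k, j))"
    by (rule index_mult[OF adjoint_carrier[OF c] c ij])
  also have "\<dots> = (\<Sum>k<d. cnj (U $$ (\<pi> k, \<pi> i)) * V $$ (\<pi> k, \<pi> j))"
    using ij by (intro sum.cong) (simp_all add: carrier_matD[OF c])
  also have "\<dots> = (\<Sum>k<d. cnj (U $$ (k, \<pi> i)) * V $$ (k, \<pi> j))"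
    by (rule sum.reindex_bij_betw[OF bij])
  also have "\<dots> = (\<Sum>k<d. mat_adjoint U $$ (\<pi> i, k) * V $$ (k, \<pi> j))"
    using assms permute_less ij by (intro sum.cong) auto
  also have "\<dots> = (mat_adjoint U * V) $$ (\<pi> i, \<pi> j)"
    by (rule index_mult[OF adjoint_carrier[OF assms(1)] assms(2) permute_less[OF ij(1)] permute_less[OF ij(2)], symmetric])
  finally show "(mat_adjoint (permute_mat d \<pi> U) * permute_mat d \<pi> V) $$ (i, j) = permute_mat d \<pi> (mat_adjoint U * V) $$ (i, j)"
    using ij by simp
qed (auto simp: permute_mat_def)

lemma is_unitary_permute:
  assumes "is_unitary d U"
  shows "is_unitary d (permute_mat d \<pi> U)"
proof (rule is_unitaryI)
  have "\<pi> i = \<pi> j \<longleftrightarrow> i = j" if "i < d" "j < d" for i j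
    using bij that by (auto simp: bij_betw_def inj_on_def)
  then have "permute_mat d \<pi> (1\<^sub>m d) = 1\<^sub>m d"
    by (intro eq_matI) (auto simp: permute_mat_def permute_less)
  then show "mat_adjoint (permute_mat d \<pi> U) * permute_mat d \<pi> U = 1\<^sub>m d"
    using assms by (simp add: permute_adjoint_mult is_unitary_def)
qed simp

text \<open>The labels of the eigenvectors are permuted together with the basis, so that the one
  operation \<open>permute_mat\<close> serves the operator and its unitary; the eigenvalues follow
  by composition with \<open>\<pi>\<close>.\<close>

lemma diagonalizes_permute:
  assumes "diagonalizes d U p A"
  shows "diagonalizes d (permute_mat d \<pi> U) (\<lambda>i. p (\<pi> i)) (permute_mat d \<pi> A)"
proof (rule diagonalizesI)
  fix i j assume ij: "i < d" "j < d"
  have "(\<Sum>k<d. complex_of_real (p (\<pi> k)) * permute_mat d \<pi> U $$ (i, k) * cnj (permute_mat d \<pi> U $$ (j, k))) =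
    (\<Sum>k<d. complex_of_real (p (\<pi> k)) * U $$ (\<pi> i, \<pi> k) * cnj (U $$ (\<pi> j, \<pi> k)))"
    using ij by (intro sum.cong) auto
  also have "\<dots> = (\<Sum>k<d. complex_of_real (p k) * U $$ (\<pi> i, k) * cnj (U $$ (\<pi> j, k)))"
    by (rule sum.reindex_bij_betw[OF bij])
  finally show "permute_mat d \<pi> A $$ (i, j) =
    (\<Sum>k<d. complex_of_real (p (\<pi> k)) * permute_mat d \<pi> U $$ (i, k) * cnj (permute_mat d \<pi> U $$ (j, k)))"
    using ij by (simp add: diagonalizes_index[OF assms] permute_less)
qed (auto intro: is_unitary_permute diagonalizes_unitary[OF assms])

end

lemma swap_middle_index_pair:
  assumes "x2 < d2" "x3 < d3" "x4 < d4"
  shows "swap_middle_index d2 d3 d4 (((x1 * d3 + x3) * d2 + x2) * d4 + x4) = ((x1 * d2 + x2) * d3 + x3) * d4 + x4"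
  using assms by (simp add: swap_middle_index_def div_mult2_eq Let_def)

text \<open>The inverse is the same formula with the two middle dimensions interchanged.\<close>

lemma swap_middle_index_bij:
  "bij_betw (swap_middle_index d2 d3 d4) {..<d1 * d2 * d3 * d4} {..<d1 * d2 * d3 * d4}"
proof (rule bij_betw_byWitness[where f' = "swap_middle_index d3 d2 d4"])
  have *: "swap_middle_index e2 e3 d4 i < d1 * e2 * e3 * d4 \<and> swap_middle_index e3 e2 d4 (swap_middle_index e2 e3 d4 i) = i"
    if "i < d1 * e2 * e3 * d4" for i e2 e3
  proof -
    have "i < d1 * e3 * e2 * d4" using that by (simp add: mult_ac)
    then obtain j x4 where 1: "j < d1 * e3 * e2" "x4 < d4" "i = j * d4 + x4" by (rule pair_index_cases)
    from 1(1) obtain k x2 where 2: "k < d1 * e3" "x2 < e2" "j = k * e2 + x2" by (rule pair_index_cases)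
    from 2(1) obtain x1 x3 where 3: "x1 < d1" "x3 < e3" "k = x1 * e3 + x3" by (rule pair_index_cases)
    show ?thesis using 1 2 3 by (simp add: swap_middle_index_pair pair_index_less)
  qed
  show "\<forall>i\<in>{..<d1 * d2 * d3 * d4}. swap_middle_index d3 d2 d4 (swap_middle_index d2 d3 d4 i) = i"
    using *[of _ d2 d3] by auto
  show "\<forall>i\<in>{..<d1 * d2 * d3 * d4}. swap_middle_index d2 d3 d4 (swap_middle_index d3 d2 d4 i) = i"
    using *[of _ d3 d2] by (auto simp: mult_ac)
  show "swap_middle_index d2 d3 d4 ` {..<d1 * d2 * d3 * d4} \<subseteq> {..<d1 * d2 * d3 * d4}"
    using *[of _ d2 d3] by auto
  show "swap_middle_index d3 d2 d4 ` {..<d1 * d2 * d3 * d4} \<subseteq> {..<d1 * d2 * d3 * d4}"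
    using *[of _ d3 d2] by (auto simp: mult_ac)
qed

lemma swap_middle_permute:
  "swap_middle d1 d2 d3 d4 X = permute_mat (d1 * d2 * d3 * d4) (swap_middle_index d2 d3 d4) X"
  by (simp add: swap_middle_def permute_mat_def)

lemma swap_middle_index_eq:
  assumes "x1 < d1" "x2 < d2" "x3 < d3" "x4 < d4" "y1 < d1" "y2 < d2" "y3 < d3" "y4 < d4"
  shows "swap_middle d1 d2 d3 d4 X $$ (((x1 * d3 + x3) * d2 + x2) * d4 + x4, ((y1 * d3 + y3) * d2 + y2) * d4 + y4) =
    X $$ (((x1 * d2 + x2) * d3 + x3) * d4 + x4, ((y1 * d2 + y2) * d3 + y3) * d4 + y4)"
proof -
  have "((x1 * d3 + x3) * d2 + x2) * d4 + x4 < d1 * d3 * d2 * d4" "((y1 * d3 + y3) * d2 + y2) * d4 + y4 < d1 * d3 * d2 * d4"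
    using assms by (simp_all add: pair_index_less)
  moreover have "d1 * d3 * d2 * d4 = d1 * d2 * d3 * d4" by simp
  ultimately show ?thesis using assms by (simp add: swap_middle_permute swap_middle_index_pair)
qed

text \<open>\<open>r\<close> flattens the regrouped index into the mixed-radix digits on which
  \<open>swap_middle\<close> acts, and \<open>r2\<close> collects the exchanged digits into the pair
  that \<open>kron\<close> expects.\<close>

lemma bip_tensor_index:
  assumes X: "X \<in> carrier_mat (a1 * b1) (a1 * b1)" and Y: "Y \<in> carrier_mat (a2 * b2) (a2 * b2)"
    and x: "x1 < a1" "x2 < a2" "y1 < b1" "y2 < b2" and x': "x1' < a1" "x2' < a2" "y1' < b1" "y2' < b2"
  shows "bip_tensor a1 b1 a2 b2 X Y $$ ((x1 * a2 + x2) * (b1 * b2) + (y1 * b2 + y2), (x1' * a2 + x2') * (b1 * b2) + (y1' * b2 + y2')) =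
    X $$ (x1 * b1 + y1, x1' * b1 + y1') * Y $$ (x2 * b2 + y2, x2' * b2 + y2')"
proof -
  have r: "(u * a2 + u') * (b1 * b2) + (w * b2 + w') = ((u * a2 + u') * b1 + w) * b2 + w'" for u u' w w'
    by (simp add: algebra_simps)
  have r2: "((u * b1 + w) * a2 + u') * b2 + w' = (u * b1 + w) * (a2 * b2) + (u' * b2 + w')" for u u' w w'
    by (simp add: algebra_simps)
  show ?thesis unfolding bip_tensor_def r swap_middle_index_eq[OF x(1,3,2,4) x'(1,3,2,4)]
    unfolding r2 using x x' by (intro kron_index[OF X Y]) (auto simp: pair_index_less)
qed

lemma bip_tensor_carrier: "bip_tensor a1 b1 a2 b2 X Y \<in> carrier_mat ((a1 * a2) * (b1 * b2)) ((a1 * a2) * (b1 * b2))"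
proof -
  have "(a1 * a2) * (b1 * b2) = a1 * b1 * a2 * b2" by simp
  then show ?thesis unfolding bip_tensor_def swap_middle_permute by (metis permute_mat_carrier)
qed

lemma bip_tensor_eqI:
  assumes "X \<in> carrier_mat ((a1 * a2) * (b1 * b2)) ((a1 * a2) * (b1 * b2))"
    "Y \<in> carrier_mat ((a1 * a2) * (b1 * b2)) ((a1 * a2) * (b1 * b2))"
    "\<And>x1 x2 y1 y2 x1' x2' y1' y2'. x1 < a1 \<Longrightarrow> x2 < a2 \<Longrightarrow> y1 < b1 \<Longrightarrow> y2 < b2 \<Longrightarrow>
      x1' < a1 \<Longrightarrow> x2' < a2 \<Longrightarrow> y1' < b1 \<Longrightarrow> y2' < b2 \<Longrightarrow>
      X $$ ((x1 * a2 + x2) * (b1 * b2) + (y1 * b2 + y2), (x1' * a2 + x2') * (b1 * b2) + (y1' * b2 + y2')) =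
      Y $$ ((x1 * a2 + x2) * (b1 * b2) + (y1 * b2 + y2), (x1' * a2 + x2') * (b1 * b2) + (y1' * b2 + y2'))"
  shows "X = Y"
proof (rule kron_eqI[OF assms(1,2)])
  fix i i' j j' assume "i < a1 * a2" "i' < b1 * b2" "j < a1 * a2" "j' < b1 * b2"
  then show "X $$ (i * (b1 * b2) + i', j * (b1 * b2) + j') = Y $$ (i * (b1 * b2) + i', j * (b1 * b2) + j')"
    by (elim pair_index_cases) (simp add: assms(3))
qed

lemma bip_tensor_diagonalizes:
  assumes "diagonalizes (a1 * b1) U p X" "diagonalizes (a2 * b2) V q Y"
  defines "\<pi> \<equiv> swap_middle_index b1 a2 b2" and "d \<equiv> a1 * b1 * a2 * b2"
  shows "diagonalizes d (permute_mat d \<pi> (kron U V)) (\<lambda>i. p (\<pi> i div (a2 * b2)) * q (\<pi> i mod (a2 * b2)))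
    (bip_tensor a1 b1 a2 b2 X Y)"
proof -
  have d: "d = (a1 * b1) * (a2 * b2)" by (simp add: d_def)
  show ?thesis unfolding bip_tensor_def swap_middle_permute \<pi>_def[symmetric] d_def[symmetric]
    using diagonalizes_kron[OF assms(1,2)]
    by (intro diagonalizes_permute[where p = "\<lambda>i. p (i div (a2 * b2)) * q (i mod (a2 * b2))"])
      (auto simp: d \<pi>_def mult.assoc[symmetric] swap_middle_index_bij)
qed

lemma sum_product_eigenvalues:
  fixes p q :: "nat \<Rightarrow> 'a::comm_semiring_0"
  shows "(\<Sum>i<n * m. p (i div m) * q (i mod m)) = (\<Sum>i<n. p i) * (\<Sum>j<m. q j)"
  by (simp add: sum_pair_index sum_product)

lemma is_state_kron:
  assumes "is_state n A" "is_state m B"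
  shows "is_state (n * m) (kron A B)"
proof -
  obtain U p where D: "diagonalizes n U p A" "\<forall>i<n. 0 \<le> p i" "(\<Sum>i<n. p i) = 1" using assms(1) by (auto simp: is_state_iff)
  obtain V q where E: "diagonalizes m V q B" "\<forall>i<m. 0 \<le> q i" "(\<Sum>i<m. q i) = 1" using assms(2) by (auto simp: is_state_iff)
  show ?thesis unfolding is_state_iff
    using diagonalizes_kron[OF D(1) E(1)] D(2,3) E(2,3)
    by (intro exI[of _ "kron U V"] exI[of _ "\<lambda>i. p (i div m) * q (i mod m)"])
      (auto simp: sum_product_eigenvalues div_index_less mod_index_less)
qed

lemma is_state_bip_tensor:
  assumes "is_state (a1 * b1) X" "is_state (a2 * b2) Y"
  shows "is_state ((a1 * a2) * (b1 * b2)) (bip_tensor a1 b1 a2 b2 X Y)"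
proof -
  let ?\<pi> = "swap_middle_index b1 a2 b2" and ?d = "a1 * b1 * a2 * b2"
  have d: "(a1 * a2) * (b1 * b2) = ?d" by simp
  obtain U p where D: "diagonalizes (a1 * b1) U p X" "\<forall>i<a1 * b1. 0 \<le> p i" "(\<Sum>i<a1 * b1. p i) = 1"
    using assms(1) by (auto simp: is_state_iff)
  obtain V q where E: "diagonalizes (a2 * b2) V q Y" "\<forall>i<a2 * b2. 0 \<le> q i" "(\<Sum>i<a2 * b2. q i) = 1"
    using assms(2) by (auto simp: is_state_iff)
  have lt: "?\<pi> i < a1 * b1 * (a2 * b2)" if "i < ?d" for i
    using permute_less[OF swap_middle_index_bij that] by (simp add: mult_ac)
  have "(\<Sum>i<?d. p (?\<pi> i div (a2 * b2)) * q (?\<pi> i mod (a2 * b2))) = (\<Sum>i<?d. p (i div (a2 * b2)) * q (i mod (a2 * b2)))"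
    by (rule sum.reindex_bij_betw[OF swap_middle_index_bij])
  also have "\<dots> = 1" using D(3) E(3) sum_product_eigenvalues[of p "a2 * b2" q "a1 * b1"] by (simp add: mult.assoc)
  finally show ?thesis unfolding d is_state_iff
    using bip_tensor_diagonalizes[OF D(1) E(1)] D(2) E(2) lt
    by (blast intro: mult_nonneg_nonneg div_index_less mod_index_less)
qed

section \<open>Additivity and separable states\<close>

text \<open>This is \<open>ln x \<le> x - 1\<close> at \<open>x = q / p\<close>. Summed against a
  doubly stochastic array of weights, the left side cancels for \<open>p\<close> and
  \<open>q\<close> of equal mass, which gives Klein's inequality.\<close>

lemma divergence_term_ge:
  assumes "0 \<le> p" "0 \<le> q" "0 \<le> w" "q = 0 \<Longrightarrow> p = 0 \<or> w = 0"
  shows "(w * p - w * q) / ln 2 \<le> w * (p * (log_or_0 p - log_or_0 q))"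
proof (cases "p = 0 \<or> q = 0")
  case True
  then show ?thesis using assms by (auto simp: divide_nonpos_pos)
next
  case False
  then have pq: "0 < p" "0 < q" using assms by auto
  have "ln (q / p) \<le> q / p - 1" using pq by (intro ln_le_minus_one) auto
  then have "1 - q / p \<le> ln p - ln q" using pq by (simp add: ln_div)
  then have "p * (1 - q / p) \<le> p * (ln p - ln q)" using pq by (intro mult_left_mono) auto
  then have "p - q \<le> p * (ln p - ln q)" using pq by (simp add: algebra_simps)
  then have "w * (p - q) / ln 2 \<le> w * (p * (ln p - ln q)) / ln 2"
    using assms(3) by (intro divide_right_mono mult_left_mono) auto
  then show ?thesis using pq by (simp add: log_or_0_def log_def algebra_simps diff_divide_distrib)
qed

lemma sum_weighted_rows:
  assumes "is_unitary d W"
  shows "(\<Sum>i<d. \<Sum>j<d. (cmod (W $$ (i, j)))\<^sup>2 * f i) = (\<Sum>i<d. f i :: real)"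
  using unitary_row_norm[OF assms] by (simp flip: sum_distrib_right)

lemma sum_weighted_cols:
  assumes "is_unitary d W"
  shows "(\<Sum>i<d. \<Sum>j<d. (cmod (W $$ (i, j)))\<^sup>2 * f j) = (\<Sum>j<d. f j :: real)"
  using unitary_col_norm[OF assms] by (subst sum.swap) (simp flip: sum_distrib_right)

lemma spectral_divergence_nonneg:
  assumes "is_unitary d W" "\<And>i. i < d \<Longrightarrow> 0 \<le> p i" "\<And>i. i < d \<Longrightarrow> 0 \<le> q i" "(\<Sum>i<d. p i) = (\<Sum>i<d. q i)"
    "supported d W p q"
  shows "0 \<le> spectral_divergence d W p q"
proof -
  have "(\<Sum>i<d. \<Sum>j<d. ((cmod (W $$ (i, j)))\<^sup>2 * p i - (cmod (W $$ (i, j)))\<^sup>2 * q j) / ln 2) \<le> spectral_divergence d W p q"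
    unfolding spectral_divergence_def using assms(2,3,5)
    by (intro sum_mono divergence_term_ge) (auto simp: supported_def)
  moreover have "(\<Sum>i<d. \<Sum>j<d. ((cmod (W $$ (i, j)))\<^sup>2 * p i - (cmod (W $$ (i, j)))\<^sup>2 * q j) / ln 2) = 0"
    unfolding sum_divide_distrib[symmetric] sum_subtractf sum_weighted_rows[OF assms(1)] sum_weighted_cols[OF assms(1)]
    using assms(4) by simp
  ultimately show ?thesis by simp
qed

lemma unitary_change_of_basis:
  assumes "diagonalizes d U p A" "diagonalizes d V q B"
  shows "is_unitary d (mat_adjoint U * V)"
  using assms by (auto simp: diagonalizes_def intro!: is_unitary_mult is_unitary_adjoint)

lemma rel_entropy_nonneg:
  assumes "is_state d \<rho>" "is_state d \<sigma>"
  shows "0 \<le> rel_entropy \<rho> \<sigma>"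
proof -
  obtain U p where D: "diagonalizes d U p \<rho>" "\<forall>i<d. 0 \<le> p i" "(\<Sum>i<d. p i) = 1" using assms(1) by (auto simp: is_state_iff)
  obtain V q where E: "diagonalizes d V q \<sigma>" "\<forall>i<d. 0 \<le> q i" "(\<Sum>i<d. q i) = 1" using assms(2) by (auto simp: is_state_iff)
  show ?thesis unfolding rel_entropy_eq[OF D(1) E(1)]
    using spectral_divergence_nonneg[OF unitary_change_of_basis[OF D(1) E(1)], of p q] D E by auto
qed

text \<open>Where the weights and the first eigenvalues are nonzero, the support conditions make all
  four eigenvalues positive and both logarithms split; elsewhere both sides are 0. Each resulting
  summand is a product in which the factor without logarithm sums to 1.\<close>

lemma spectral_divergence_kron:
  assumes W: "is_unitary n W" and X: "is_unitary m X"
    and p: "(\<Sum>i<n. p i) = 1" and p': "(\<Sum>i<m. p' i) = 1"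
    and s: "supported n W p q" "supported m X p' q'"
    and nonneg: "\<And>i. i < n \<Longrightarrow> 0 \<le> p i" "\<And>i. i < n \<Longrightarrow> 0 \<le> q i" "\<And>i. i < m \<Longrightarrow> 0 \<le> p' i" "\<And>i. i < m \<Longrightarrow> 0 \<le> q' i"
  shows "spectral_divergence (n * m) (kron W X) (\<lambda>i. p (i div m) * p' (i mod m)) (\<lambda>i. q (i div m) * q' (i mod m)) =
    spectral_divergence n W p q + spectral_divergence m X p' q'"
proof -
  have c: "W \<in> carrier_mat n n" "X \<in> carrier_mat m m" using W X by (auto simp: is_unitary_def)
  have t: "(cmod (kron W X $$ (i * m + i', j * m + j')))\<^sup>2 * (p i * p' i' * (log_or_0 (p i * p' i') - log_or_0 (q j * q' j'))) =
    ((cmod (W $$ (i, j)))\<^sup>2 * (p i * (log_or_0 (p i) - log_or_0 (q j)))) * ((cmod (X $$ (i', j')))\<^sup>2 * p' i') +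
    ((cmod (W $$ (i, j)))\<^sup>2 * p i) * ((cmod (X $$ (i', j')))\<^sup>2 * (p' i' * (log_or_0 (p' i') - log_or_0 (q' j'))))"
    if i: "i < n" "j < n" "i' < m" "j' < m" for i j i' j'
  proof (cases "p i = 0 \<or> p' i' = 0 \<or> W $$ (i, j) = 0 \<or> X $$ (i', j') = 0")
    case True
    then show ?thesis using i by (auto simp: kron_index[OF c])
  next
    case False
    then have "q j \<noteq> 0" "q' j' \<noteq> 0" using s i by (auto simp: supported_def)
    then have "0 < p i" "0 < p' i'" "0 < q j" "0 < q' j'" using False nonneg i by (auto simp: order.strict_iff_order)
    then have "log_or_0 (p i * p' i') = log_or_0 (p i) + log_or_0 (p' i')" "log_or_0 (q j * q' j') = log_or_0 (q j) + log_or_0 (q' j')"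
      by (auto simp: log_or_0_def log_mult)
    then show ?thesis unfolding kron_index[OF c i(1,2,3,4)] norm_mult power_mult_distrib by (simp add: algebra_simps)
  qed
  have rearr: "(\<Sum>i<n. \<Sum>i'<m. \<Sum>j<n. \<Sum>j'<m. f i j * g i' j') = (\<Sum>i<n. \<Sum>j<n. f i j) * (\<Sum>i'<m. \<Sum>j'<m. g i' j')"
    for f g :: "nat \<Rightarrow> nat \<Rightarrow> real"
    unfolding sum_product by (rule sum.cong[OF refl], rule sum.cong[OF refl]) (simp add: sum_product)
  have "spectral_divergence (n * m) (kron W X) (\<lambda>i. p (i div m) * p' (i mod m)) (\<lambda>i. q (i div m) * q' (i mod m)) =
    (\<Sum>i<n. \<Sum>i'<m. \<Sum>j<n. \<Sum>j'<m. (cmod (kron W X $$ (i * m + i', j * m + j')))\<^sup>2 *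
      (p i * p' i' * (log_or_0 (p i * p' i') - log_or_0 (q j * q' j'))))"
    unfolding spectral_divergence_def sum_pair_index by (intro sum.cong refl) simp
  also have "\<dots> = (\<Sum>i<n. \<Sum>i'<m. \<Sum>j<n. \<Sum>j'<m.
    ((cmod (W $$ (i, j)))\<^sup>2 * (p i * (log_or_0 (p i) - log_or_0 (q j)))) * ((cmod (X $$ (i', j')))\<^sup>2 * p' i') +
    ((cmod (W $$ (i, j)))\<^sup>2 * p i) * ((cmod (X $$ (i', j')))\<^sup>2 * (p' i' * (log_or_0 (p' i') - log_or_0 (q' j')))))"
    by (intro sum.cong refl) (rule t, auto)
  also have "\<dots> = spectral_divergence n W p q + spectral_divergence m X p' q'"
    unfolding sum.distrib rearr sum_weighted_rows[OF W] sum_weighted_rows[OF X] p p'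
    by (simp add: spectral_divergence_def)
  finally show ?thesis .
qed

lemma spectral_divergence_permute:
  assumes bij: "bij_betw \<pi> {..<d} {..<d}"
  shows "spectral_divergence d (permute_mat d \<pi> W) (\<lambda>i. p (\<pi> i)) (\<lambda>i. q (\<pi> i)) = spectral_divergence d W p q"
proof -
  have "spectral_divergence d (permute_mat d \<pi> W) (\<lambda>i. p (\<pi> i)) (\<lambda>i. q (\<pi> i)) =
    (\<Sum>i<d. \<Sum>j<d. (cmod (W $$ (\<pi> i, \<pi> j)))\<^sup>2 * (p (\<pi> i) * (log_or_0 (p (\<pi> i)) - log_or_0 (q (\<pi> j)))))"
    unfolding spectral_divergence_def by (intro sum.cong refl) simp
  also have "\<dots> = (\<Sum>i<d. \<Sum>j<d. (cmod (W $$ (\<pi> i, j)))\<^sup>2 * (p (\<pi> i) * (log_or_0 (p (\<pi> i)) - log_or_0 (q j))))"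
    by (intro sum.cong refl sum.reindex_bij_betw[OF bij])
  also have "\<dots> = spectral_divergence d W p q"
    unfolding spectral_divergence_def
    by (rule sum.reindex_bij_betw[OF bij, of "\<lambda>i. \<Sum>j<d. (cmod (W $$ (i, j)))\<^sup>2 * (p i * (log_or_0 (p i) - log_or_0 (q j)))"])
  finally show ?thesis .
qed

text \<open>Eigenvectors of the tensor product are tensor products of eigenvectors, so the
  divergences add when both support conditions hold. If one of them fails, the right side is
  infinite.\<close>

lemma rel_entropy_bip_tensor_le:
  assumes "is_state (a1 * b1) \<rho>" "is_state (a2 * b2) \<rho>'" "is_state (a1 * b1) \<sigma>" "is_state (a2 * b2) \<sigma>'"
  shows "rel_entropy (bip_tensor a1 b1 a2 b2 \<rho> \<rho>') (bip_tensor a1 b1 a2 b2 \<sigma> \<sigma>') \<le> rel_entropy \<rho> \<sigma> + rel_entropy \<rho>' \<sigma>'"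
proof -
  define n m d \<pi> where "n = a1 * b1" and "m = a2 * b2" and "d = a1 * b1 * a2 * b2" and "\<pi> = swap_middle_index b1 a2 b2"
  have d: "d = n * m" by (simp add: d_def n_def m_def)
  have bij: "bij_betw \<pi> {..<d} {..<d}" unfolding d_def \<pi>_def by (rule swap_middle_index_bij)
  obtain U p where D: "diagonalizes n U p \<rho>" "\<forall>i<n. 0 \<le> p i" "(\<Sum>i<n. p i) = 1" using assms(1) by (auto simp: is_state_iff n_def)
  obtain U' p' where D': "diagonalizes m U' p' \<rho>'" "\<forall>i<m. 0 \<le> p' i" "(\<Sum>i<m. p' i) = 1" using assms(2) by (auto simp: is_state_iff m_def)
  obtain V q where E: "diagonalizes n V q \<sigma>" "\<forall>i<n. 0 \<le> q i" "(\<Sum>i<n. q i) = 1" using assms(3) by (auto simp: is_state_iff n_def)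
  obtain V' q' where E': "diagonalizes m V' q' \<sigma>'" "\<forall>i<m. 0 \<le> q' i" "(\<Sum>i<m. q' i) = 1" using assms(4) by (auto simp: is_state_iff m_def)
  have c: "U \<in> carrier_mat n n" "V \<in> carrier_mat n n" "U' \<in> carrier_mat m m" "V' \<in> carrier_mat m m"
    using D(1) E(1) D'(1) E'(1) by (auto simp: diagonalizes_def is_unitary_def)
  define W W' where "W = mat_adjoint U * V" and "W' = mat_adjoint U' * V'"
  have W: "is_unitary n W" and W': "is_unitary m W'"
    unfolding W_def W'_def using unitary_change_of_basis D(1) E(1) D'(1) E'(1) by blast+
  have Wc: "W \<in> carrier_mat n n" "W' \<in> carrier_mat m m" using W W' by (auto simp: is_unitary_def)
  define r where "r i = p (i div m) * p' (i mod m)" for i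
  define s where "s i = q (i div m) * q' (i mod m)" for i
  have T: "mat_adjoint (permute_mat d \<pi> (kron U U')) * permute_mat d \<pi> (kron V V') = permute_mat d \<pi> (kron W W')"
    using c kron_carrier[OF c(1,3)] kron_carrier[OF c(2,4)]
    by (subst permute_adjoint_mult[OF bij]) (auto simp: d adjoint_kron W_def W'_def kron_mult[of _ n n _ m m _ n _ m])
  have eq: "rel_entropy (bip_tensor a1 b1 a2 b2 \<rho> \<rho>') (bip_tensor a1 b1 a2 b2 \<sigma> \<sigma>') =
    (if supported d (permute_mat d \<pi> (kron W W')) (\<lambda>i. r (\<pi> i)) (\<lambda>i. s (\<pi> i))
     then ereal (spectral_divergence d (permute_mat d \<pi> (kron W W')) (\<lambda>i. r (\<pi> i)) (\<lambda>i. s (\<pi> i))) else \<infinity>)"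
    unfolding T[symmetric] r_def s_def
    using bip_tensor_diagonalizes[OF D(1)[unfolded n_def] D'(1)[unfolded m_def]]
      bip_tensor_diagonalizes[OF E(1)[unfolded n_def] E'(1)[unfolded m_def]]
    unfolding d_def[symmetric] \<pi>_def[symmetric] m_def[symmetric]
    by (rule rel_entropy_eq)
  show ?thesis
  proof (cases "supported n W p q \<and> supported m W' p' q'")
    case True
    have "supported d (permute_mat d \<pi> (kron W W')) (\<lambda>i. r (\<pi> i)) (\<lambda>i. s (\<pi> i))"
      unfolding supported_def
    proof (intro allI impI)
      fix i j assume ij: "i < d" "j < d" "s (\<pi> j) = 0"
      have "\<pi> i < n * m" "\<pi> j < n * m" using permute_less[OF bij] ij by (auto simp: d)
      then obtain x x' y y' where x: "x < n" "x' < m" "\<pi> i = x * m + x'" and y: "y < n" "y' < m" "\<pi> j = y * m + y'"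
        by (metis pair_index_cases)
      have "q y = 0 \<or> q' y' = 0" using ij(3) y by (simp add: s_def)
      then have "p x = 0 \<or> W $$ (x, y) = 0 \<or> p' x' = 0 \<or> W' $$ (x', y') = 0"
        using True x y by (auto simp: supported_def)
      then show "r (\<pi> i) = 0 \<or> permute_mat d \<pi> (kron W W') $$ (i, j) = 0"
        using ij x y by (auto simp: r_def kron_index[OF Wc])
    qed
    moreover have "spectral_divergence d (permute_mat d \<pi> (kron W W')) (\<lambda>i. r (\<pi> i)) (\<lambda>i. s (\<pi> i)) =
      spectral_divergence n W p q + spectral_divergence m W' p' q'"
      unfolding spectral_divergence_permute[OF bij, of "kron W W'" r s] unfolding d r_def s_def
      using True D(2,3) D'(2,3) E(2) E'(2) by (intro spectral_divergence_kron[OF W W']) auto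
    ultimately show ?thesis
      using True unfolding eq rel_entropy_eq[OF D(1) E(1)] rel_entropy_eq[OF D'(1) E'(1)] W_def[symmetric] W'_def[symmetric]
      by simp
  next
    case False
    then have "rel_entropy \<rho> \<sigma> + rel_entropy \<rho>' \<sigma>' = \<infinity>"
      unfolding rel_entropy_eq[OF D(1) E(1)] rel_entropy_eq[OF D'(1) E'(1)] W_def[symmetric] W'_def[symmetric] by auto
    then show ?thesis by (simp only: ereal_less_eq)
  qed
qed

section \<open>Mixtures and separable states\<close>

lemma msum_carrier [simp]: "msum d S f \<in> carrier_mat d d"
  by (simp add: msum_def)

lemma msum_index [simp]: "i < d \<Longrightarrow> j < d \<Longrightarrow> msum d S f $$ (i, j) = (\<Sum>k\<in>S. f k $$ (i, j))"
  by (simp add: msum_def)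

text \<open>The parts of a mixture need not share an eigenbasis, so positivity is checked on the
  quadratic form, which is linear in the operator.\<close>

lemma is_state_mixture:
  assumes "\<And>k. k < (r::nat) \<Longrightarrow> 0 \<le> p k \<and> is_state d (A k)" "(\<Sum>k<r. p k) = 1"
  shows "is_state d (msum d {..<r} (\<lambda>k. complex_of_real (p k) \<cdot>\<^sub>m A k))"
proof -
  let ?M = "msum d {..<r} (\<lambda>k. complex_of_real (p k) \<cdot>\<^sub>m A k)"
  have A: "A k \<in> carrier_mat d d" if "k < r" for k using assms(1)[OF that] is_state_carrier by blast
  have idx: "?M $$ (i, j) = (\<Sum>k<r. complex_of_real (p k) * A k $$ (i, j))" if "i < d" "j < d" for i j
    unfolding msum_index[OF that] using that carrier_matD[OF A] by (intro sum.cong) auto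
  have h: "is_hermitian d (A k)" if "k < r" for k using assms(1)[OF that] by (auto simp: is_state_def is_psd_def)
  have "is_hermitian d ?M"
    by (rule is_hermitianI) (auto simp: idx hermitian_index[OF h] simp del: msum_index)
  moreover have "0 \<le> Re ((?M *\<^sub>v v) \<bullet>c v)" if v: "v \<in> carrier_vec d" for v
  proof -
    have "(?M *\<^sub>v v) \<bullet>c v = (\<Sum>i<d. \<Sum>j<d. \<Sum>k<r. complex_of_real (p k) * (A k $$ (i, j) * v $ j * cnj (v $ i)))"
      unfolding quadratic_form_index[OF msum_carrier v]
      by (intro sum.cong refl) (simp add: idx sum_distrib_left sum_distrib_right mult_ac del: msum_index)
    also have "\<dots> = (\<Sum>i<d. \<Sum>k<r. \<Sum>j<d. complex_of_real (p k) * (A k $$ (i, j) * v $ j * cnj (v $ i)))"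
      by (intro sum.cong refl sum.swap)
    also have "\<dots> = (\<Sum>k<r. \<Sum>i<d. \<Sum>j<d. complex_of_real (p k) * (A k $$ (i, j) * v $ j * cnj (v $ i)))"
      by (rule sum.swap)
    also have "\<dots> = (\<Sum>k<r. complex_of_real (p k) * ((A k *\<^sub>v v) \<bullet>c v))"
      using quadratic_form_index[OF A v] by (intro sum.cong) (simp_all add: sum_distrib_left)
    finally have "Re ((?M *\<^sub>v v) \<bullet>c v) = (\<Sum>k<r. p k * Re ((A k *\<^sub>v v) \<bullet>c v))" by simp
    then show ?thesis using assms(1) v by (auto simp: is_state_def is_psd_def intro!: sum_nonneg)
  qed
  moreover have "mtrace ?M = 1"
  proof -
    have "mtrace ?M = (\<Sum>i<d. \<Sum>k<r. complex_of_real (p k) * A k $$ (i, i))"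
      unfolding mtrace_def using idx by (intro sum.cong) (auto simp: msum_def)
    also have "\<dots> = (\<Sum>k<r. complex_of_real (p k) * mtrace (A k))"
      unfolding mtrace_def using carrier_matD[OF A] by (subst sum.swap) (auto intro!: sum.cong simp: sum_distrib_left)
    also have "\<dots> = complex_of_real (\<Sum>k<r. p k)" using assms(1) by (auto simp: is_state_def)
    finally show ?thesis using assms(2) by simp
  qed
  ultimately show ?thesis by (auto simp: is_state_def is_psd_def)
qed

lemma is_separableE:
  assumes "is_separable d1 d2 \<sigma>"
  obtains r :: nat and p :: "nat \<Rightarrow> real" and \<alpha> \<beta> :: "nat \<Rightarrow> complex mat"
  where "\<forall>k<r. 0 \<le> p k \<and> is_state d1 (\<alpha> k) \<and> is_state d2 (\<beta> k)" "(\<Sum>k<r. p k) = 1"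
    "\<sigma> = msum (d1 * d2) {..<r} (\<lambda>k. complex_of_real (p k) \<cdot>\<^sub>m kron (\<alpha> k) (\<beta> k))"
  using assms unfolding is_separable_def by (elim exE conjE) (rule that; assumption)

lemma is_separable_state: "is_separable d1 d2 \<sigma> \<Longrightarrow> is_state (d1 * d2) \<sigma>"
  unfolding is_separable_def by (elim exE conjE) (auto intro!: is_state_mixture is_state_kron)

text \<open>Multiplying the two convex decompositions gives one with \<open>r * r'\<close> terms,
  numbered by quotient and remainder modulo \<open>r'\<close>. Regrouping puts both first factors on
  one side of the cut and both second factors on the other.\<close>

lemma is_separable_bip_tensor:
  assumes "is_separable a1 b1 \<sigma>" "is_separable a2 b2 \<sigma>'"
  shows "is_separable (a1 * a2) (b1 * b2) (bip_tensor a1 b1 a2 b2 \<sigma> \<sigma>')"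
proof -
  obtain r :: nat and p \<alpha> \<beta> where "\<forall>k<r. 0 \<le> p k \<and> is_state a1 (\<alpha> k) \<and> is_state b1 (\<beta> k)" "(\<Sum>k<r. p k) = 1"
    "\<sigma> = msum (a1 * b1) {..<r} (\<lambda>k. complex_of_real (p k) \<cdot>\<^sub>m kron (\<alpha> k) (\<beta> k))"
    using assms(1) by (rule is_separableE)
  then have 1: "\<And>k. k < r \<Longrightarrow> 0 \<le> p k \<and> is_state a1 (\<alpha> k) \<and> is_state b1 (\<beta> k)" "(\<Sum>k<r. p k) = 1"
    "\<sigma> = msum (a1 * b1) {..<r} (\<lambda>k. complex_of_real (p k) \<cdot>\<^sub>m kron (\<alpha> k) (\<beta> k))" by blast+
  obtain r' :: nat and p' \<alpha>' \<beta>' where "\<forall>k<r'. 0 \<le> p' k \<and> is_state a2 (\<alpha>' k) \<and> is_state b2 (\<beta>' k)" "(\<Sum>k<r'. p' k) = 1"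
    "\<sigma>' = msum (a2 * b2) {..<r'} (\<lambda>k. complex_of_real (p' k) \<cdot>\<^sub>m kron (\<alpha>' k) (\<beta>' k))"
    using assms(2) by (rule is_separableE)
  then have 2: "\<And>k. k < r' \<Longrightarrow> 0 \<le> p' k \<and> is_state a2 (\<alpha>' k) \<and> is_state b2 (\<beta>' k)" "(\<Sum>k<r'. p' k) = 1"
    "\<sigma>' = msum (a2 * b2) {..<r'} (\<lambda>k. complex_of_real (p' k) \<cdot>\<^sub>m kron (\<alpha>' k) (\<beta>' k))" by blast+
  have c1: "\<alpha> k \<in> carrier_mat a1 a1" "\<beta> k \<in> carrier_mat b1 b1" if "k < r" for k using 1(1)[OF that] is_state_carrier by blast+
  have c2: "\<alpha>' k \<in> carrier_mat a2 a2" "\<beta>' k \<in> carrier_mat b2 b2" if "k < r'" for k using 2(1)[OF that] is_state_carrier by blast+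
  have i1: "\<sigma> $$ (x * b1 + y, x' * b1 + y') = (\<Sum>k<r. complex_of_real (p k) * (\<alpha> k $$ (x, x') * \<beta> k $$ (y, y')))"
    if "x < a1" "y < b1" "x' < a1" "y' < b1" for x y x' y'
    unfolding 1(3) using that c1 by (auto intro!: sum.cong simp: pair_index_less kron_index[OF c1] carrier_matD[OF c1(1)] carrier_matD[OF c1(2)])
  have i2: "\<sigma>' $$ (x * b2 + y, x' * b2 + y') = (\<Sum>k<r'. complex_of_real (p' k) * (\<alpha>' k $$ (x, x') * \<beta>' k $$ (y, y')))"
    if "x < a2" "y < b2" "x' < a2" "y' < b2" for x y x' y'
    unfolding 2(3) using that c2 by (auto intro!: sum.cong simp: pair_index_less kron_index[OF c2] carrier_matD[OF c2(1)] carrier_matD[OF c2(2)])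
  have c: "\<sigma> \<in> carrier_mat (a1 * b1) (a1 * b1)" "\<sigma>' \<in> carrier_mat (a2 * b2) (a2 * b2)" by (auto simp: 1(3) 2(3))
  let ?A = "\<lambda>k. kron (\<alpha> (k div r')) (\<alpha>' (k mod r'))" and ?B = "\<lambda>k. kron (\<beta> (k div r')) (\<beta>' (k mod r'))"
  have eq: "bip_tensor a1 b1 a2 b2 \<sigma> \<sigma>' = msum ((a1 * a2) * (b1 * b2)) {..<r * r'}
      (\<lambda>k. complex_of_real (p (k div r') * p' (k mod r')) \<cdot>\<^sub>m kron (?A k) (?B k))"
  proof (rule bip_tensor_eqI[OF bip_tensor_carrier msum_carrier])
    fix x1 x2 y1 y2 x1' x2' y1' y2'
    assume l: "x1 < a1" "x2 < a2" "y1 < b1" "y2 < b2" "x1' < a1" "x2' < a2" "y1' < b1" "y2' < b2"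
    let ?i = "(x1 * a2 + x2) * (b1 * b2) + (y1 * b2 + y2)" and ?j = "(x1' * a2 + x2') * (b1 * b2) + (y1' * b2 + y2')"
    have ij: "?i < (a1 * a2) * (b1 * b2)" "?j < (a1 * a2) * (b1 * b2)" using l by (auto intro!: pair_index_less)
    have "(complex_of_real (p (k div r') * p' (k mod r')) \<cdot>\<^sub>m kron (?A k) (?B k)) $$ (?i, ?j) =
       (complex_of_real (p (k div r')) * (\<alpha> (k div r') $$ (x1, x1') * \<beta> (k div r') $$ (y1, y1'))) *
       (complex_of_real (p' (k mod r')) * (\<alpha>' (k mod r') $$ (x2, x2') * \<beta>' (k mod r') $$ (y2, y2')))" if k: "k < r * r'" for k
    proof -
      have ca: "\<alpha> (k div r') \<in> carrier_mat a1 a1" "\<beta> (k div r') \<in> carrier_mat b1 b1"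
        "\<alpha>' (k mod r') \<in> carrier_mat a2 a2" "\<beta>' (k mod r') \<in> carrier_mat b2 b2"
        using c1 c2 div_index_less[OF k] mod_index_less[OF k] by blast+
      have "kron (?A k) (?B k) $$ (?i, ?j) = ?A k $$ (x1 * a2 + x2, x1' * a2 + x2') * ?B k $$ (y1 * b2 + y2, y1' * b2 + y2')"
        using l ca by (intro kron_index kron_carrier) (auto simp: pair_index_less)
      then show ?thesis using l ca ij by (simp add: kron_index)
    qed
    then have "msum ((a1 * a2) * (b1 * b2)) {..<r * r'} (\<lambda>k. complex_of_real (p (k div r') * p' (k mod r')) \<cdot>\<^sub>m kron (?A k) (?B k)) $$ (?i, ?j) =
      (\<Sum>k<r * r'. (complex_of_real (p (k div r')) * (\<alpha> (k div r') $$ (x1, x1') * \<beta> (k div r') $$ (y1, y1'))) *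
       (complex_of_real (p' (k mod r')) * (\<alpha>' (k mod r') $$ (x2, x2') * \<beta>' (k mod r') $$ (y2, y2'))))"
      unfolding msum_index[OF ij] by (intro sum.cong) auto
    also have "\<dots> = \<sigma> $$ (x1 * b1 + y1, x1' * b1 + y1') * \<sigma>' $$ (x2 * b2 + y2, x2' * b2 + y2')"
      unfolding i1[OF l(1,3,5,7)] i2[OF l(2,4,6,8)]
      by (rule sum_product_eigenvalues[of "\<lambda>k. complex_of_real (p k) * (\<alpha> k $$ (x1, x1') * \<beta> k $$ (y1, y1'))" r'
         "\<lambda>k. complex_of_real (p' k) * (\<alpha>' k $$ (x2, x2') * \<beta>' k $$ (y2, y2'))" r])
    finally show "bip_tensor a1 b1 a2 b2 \<sigma> \<sigma>' $$ (?i, ?j) =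
       msum ((a1 * a2) * (b1 * b2)) {..<r * r'} (\<lambda>k. complex_of_real (p (k div r') * p' (k mod r')) \<cdot>\<^sub>m kron (?A k) (?B k)) $$ (?i, ?j)"
      using bip_tensor_index[OF c l] by simp
  qed
  show ?thesis unfolding is_separable_def eq
  proof (intro exI conjI allI impI)
    show "(\<Sum>k<r * r'. p (k div r') * p' (k mod r')) = 1" using 1(2) 2(2) by (simp add: sum_product_eigenvalues)
    fix k assume "k < r * r'"
    then have k: "k div r' < r" "k mod r' < r'" by (auto simp: div_index_less mod_index_less)
    show "0 \<le> p (k div r') * p' (k mod r')" using 1(1)[OF k(1)] 2(1)[OF k(2)] by simp
    show "is_state (a1 * a2) (?A k)" "is_state (b1 * b2) (?B k)"
      using 1(1)[OF k(1)] 2(1)[OF k(2)] by (auto intro: is_state_kron)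
  qed (rule refl)
qed

section \<open>Testing states by effects\<close>

definition norm2 :: "nat \<Rightarrow> (nat \<Rightarrow> complex) \<Rightarrow> real" where
  "norm2 d z = (\<Sum>i<d. (cmod (z i))\<^sup>2)"

text \<open>A linear functional given by its coefficients. As a trace against \<open>X\<close> it
  belongs to the transposed array of coefficients, which is
  \<open>effect_mat d \<Theta>\<close>.\<close>

definition pairing :: "nat \<Rightarrow> (nat \<Rightarrow> nat \<Rightarrow> complex) \<Rightarrow> complex mat \<Rightarrow> complex" where
  "pairing d \<Theta> X = (\<Sum>i<d. \<Sum>j<d. \<Theta> i j * X $$ (i, j))"

definition outer :: "nat \<Rightarrow> (nat \<Rightarrow> complex) \<Rightarrow> complex mat" where
  "outer d z = mat d d (\<lambda>(i, j). z i * cnj (z j))"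

text \<open>The operator inequalities \<open>0 \<le> M \<le> 1\<close>, stated through values on
  rank-one operators because these are what is transported through a protocol. The vanishing
  imaginary part encodes hermiticity.\<close>

definition effect :: "nat \<Rightarrow> (nat \<Rightarrow> nat \<Rightarrow> complex) \<Rightarrow> bool" where
  "effect d \<Theta> \<longleftrightarrow> (\<forall>z. Im (pairing d \<Theta> (outer d z)) = 0 \<and>
     0 \<le> Re (pairing d \<Theta> (outer d z)) \<and> Re (pairing d \<Theta> (outer d z)) \<le> norm2 d z)"

lemma norm2_nonneg [simp]: "0 \<le> norm2 d z"
  by (simp add: norm2_def sum_nonneg)

lemma outer_carrier [simp]: "outer d z \<in> carrier_mat d d"
  by (simp add: outer_def)

lemma outer_index [simp]: "i < d \<Longrightarrow> j < d \<Longrightarrow> outer d z $$ (i, j) = z i * cnj (z j)"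
  by (simp add: outer_def)

lemma pairing_outer: "pairing d \<Theta> (outer d z) = (\<Sum>i<d. \<Sum>j<d. \<Theta> i j * (z i * cnj (z j)))"
  unfolding pairing_def by (intro sum.cong refl) simp

lemma pairing_lincomb:
  assumes "finite S" "\<And>i j. i < d \<Longrightarrow> j < d \<Longrightarrow> X $$ (i, j) = (\<Sum>k\<in>S. c k * F k $$ (i, j))"
  shows "pairing d \<Theta> X = (\<Sum>k\<in>S. c k * pairing d \<Theta> (F k))"
proof -
  have "pairing d \<Theta> X = (\<Sum>i<d. \<Sum>j<d. \<Sum>k\<in>S. c k * (\<Theta> i j * F k $$ (i, j)))"
    unfolding pairing_def by (intro sum.cong refl) (simp add: assms(2) sum_distrib_left mult_ac)
  also have "\<dots> = (\<Sum>i<d. \<Sum>k\<in>S. \<Sum>j<d. c k * (\<Theta> i j * F k $$ (i, j)))"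
    by (intro sum.cong refl sum.swap)
  also have "\<dots> = (\<Sum>k\<in>S. \<Sum>i<d. \<Sum>j<d. c k * (\<Theta> i j * F k $$ (i, j)))"
    by (rule sum.swap)
  finally show ?thesis by (simp add: pairing_def sum_distrib_left)
qed

lemma pairing_diagonalizes:
  assumes "diagonalizes d U p A"
  shows "pairing d \<Theta> A = (\<Sum>k<d. complex_of_real (p k) * pairing d \<Theta> (outer d (\<lambda>i. U $$ (i, k))))"
  by (rule pairing_lincomb) (auto simp: diagonalizes_index[OF assms] mult.assoc)

lemma norm2_unitary:
  assumes V: "is_unitary d V"
  shows "norm2 d (\<lambda>j. \<Sum>i<d. cnj (V $$ (i, j)) * x i) = norm2 d x"
proof -
  have "complex_of_real (norm2 d (\<lambda>j. \<Sum>i<d. cnj (V $$ (i, j)) * x i)) =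
    (\<Sum>j<d. \<Sum>i<d. \<Sum>k<d. (x i * cnj (x k)) * (V $$ (k, j) * cnj (V $$ (i, j))))"
    unfolding norm2_def of_real_sum complex_norm_square by (simp add: sum_product mult_ac)
  also have "\<dots> = (\<Sum>i<d. \<Sum>j<d. \<Sum>k<d. (x i * cnj (x k)) * (V $$ (k, j) * cnj (V $$ (i, j))))"
    by (rule sum.swap)
  also have "\<dots> = (\<Sum>i<d. \<Sum>k<d. \<Sum>j<d. (x i * cnj (x k)) * (V $$ (k, j) * cnj (V $$ (i, j))))"
    by (intro sum.cong refl sum.swap)
  also have "\<dots> = (\<Sum>i<d. \<Sum>k<d. (x i * cnj (x k)) * (if k = i then 1 else 0))"
    unfolding sum_distrib_left[symmetric] using is_unitary_rows[OF V] by (intro sum.cong refl) auto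
  also have "\<dots> = (\<Sum>i<d. \<Sum>k<d. if k = i then x i * cnj (x i) else 0)"
    by (intro sum.cong refl) auto
  also have "\<dots> = (\<Sum>i<d. x i * cnj (x i))"
    by (intro sum.cong refl) simp
  also have "\<dots> = complex_of_real (norm2 d x)"
    unfolding norm2_def of_real_sum complex_norm_square ..
  finally show ?thesis by (simp only: of_real_eq_iff)
qed

lemma norm2_unitary':
  assumes "is_unitary d V"
  shows "norm2 d (\<lambda>i. \<Sum>k<d. V $$ (i, k) * x k) = norm2 d x"
proof -
  have c: "V \<in> carrier_mat d d" using assms by (simp add: is_unitary_def)
  have "norm2 d (\<lambda>i. \<Sum>k<d. cnj (mat_adjoint V $$ (k, i)) * x k) = norm2 d x"
    by (rule norm2_unitary[OF is_unitary_adjoint[OF assms]])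
  moreover have "norm2 d (\<lambda>i. \<Sum>k<d. cnj (mat_adjoint V $$ (k, i)) * x k) = norm2 d (\<lambda>i. \<Sum>k<d. V $$ (i, k) * x k)"
    unfolding norm2_def using c by (intro sum.cong refl) simp
  ultimately show ?thesis by simp
qed

definition effect_mat :: "nat \<Rightarrow> (nat \<Rightarrow> nat \<Rightarrow> complex) \<Rightarrow> complex mat" where
  "effect_mat d \<Theta> = mat d d (\<lambda>(i, j). \<Theta> j i)"

lemma pairing_outer_effect_mat:
  "pairing d \<Theta> (outer d z) = (\<Sum>i<d. \<Sum>j<d. effect_mat d \<Theta> $$ (i, j) * z j * cnj (z i))"
  unfolding pairing_outer by (subst sum.swap) (auto intro!: sum.cong simp: effect_mat_def)

lemma pairing_outer_two:
  assumes "i < d" "j < d" "i \<noteq> j"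
  shows "pairing d \<Theta> (outer d (\<lambda>l. if l = i then x else if l = j then y else 0)) =
    \<Theta> i i * (x * cnj x) + \<Theta> i j * (x * cnj y) + \<Theta> j i * (y * cnj x) + \<Theta> j j * (y * cnj y)"
proof -
  have s: "(\<Sum>l<d. if l = i then f l else if l = j then g l else 0) = f i + g j" for f g :: "nat \<Rightarrow> complex"
  proof -
    have "(\<Sum>l<d. if l = i then f l else if l = j then g l else 0) = (\<Sum>l<d. (if l = i then f l else 0) + (if l = j then g l else 0))"
      using assms by (intro sum.cong) auto
    then show ?thesis using assms by (simp add: sum.distrib)
  qed
  let ?z = "\<lambda>l. if l = i then x else if l = j then y else 0"
  have r: "(\<Sum>l<d. \<Theta> k l * (w * cnj (?z l))) = \<Theta> k i * (w * cnj x) + \<Theta> k j * (w * cnj y)" for k w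
  proof -
    have "(\<Sum>l<d. \<Theta> k l * (w * cnj (?z l))) = (\<Sum>l<d. if l = i then \<Theta> k l * (w * cnj x) else if l = j then \<Theta> k l * (w * cnj y) else 0)"
      by (intro sum.cong) auto
    then show ?thesis by (simp only: s)
  qed
  have "pairing d \<Theta> (outer d ?z) = (\<Sum>k<d. \<Theta> k i * (?z k * cnj x) + \<Theta> k j * (?z k * cnj y))"
    unfolding pairing_outer r ..
  also have "\<dots> = (\<Sum>k<d. if k = i then \<Theta> k i * (x * cnj x) + \<Theta> k j * (x * cnj y)
      else if k = j then \<Theta> k i * (y * cnj x) + \<Theta> k j * (y * cnj y) else 0)"
    by (intro sum.cong) auto
  finally show ?thesis unfolding s by simp
qed

text \<open>Polarisation: unit vectors show that the diagonal is real, and the vectors with entries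
  \<open>1, 1\<close> and \<open>1, \<i>\<close> at positions \<open>i, j\<close> relate the
  imaginary and the real parts of the two opposite off-diagonal entries.\<close>

lemma effect_hermitian:
  assumes E: "effect d \<Theta>"
  shows "is_hermitian d (effect_mat d \<Theta>)"
proof (rule is_hermitianI)
  have im: "Im (pairing d \<Theta> (outer d z)) = 0" for z using E by (auto simp: effect_def)
  have diag: "Im (\<Theta> i i) = 0" if "i < d" for i
  proof -
    let ?z = "\<lambda>l. if l = i then 1 else 0 :: complex"
    have "pairing d \<Theta> (outer d ?z) = (\<Sum>k<d. if k = i then \<Theta> i i else 0)"
    proof -
      have "(\<Sum>l<d. \<Theta> k l * (?z k * cnj (?z l))) = (\<Sum>l<d. if l = i then if k = i then \<Theta> i i else 0 else 0)" for k
        by (intro sum.cong) auto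
      then show ?thesis unfolding pairing_outer using that by simp
    qed
    then show ?thesis using im[of ?z] that by simp
  qed
  fix i j assume ij: "i < d" "j < d"
  show "cnj (effect_mat d \<Theta> $$ (j, i)) = effect_mat d \<Theta> $$ (i, j)"
  proof (cases "i = j")
    case True
    then show ?thesis using diag[OF ij(1)] ij by (simp add: effect_mat_def complex_eq_iff)
  next
    case False
    have "Im (\<Theta> i j + \<Theta> j i) = 0" "Im (\<Theta> j i * \<i> - \<Theta> i j * \<i>) = 0"
      using im[of "\<lambda>l. if l = i then 1 else if l = j then 1 else 0"] im[of "\<lambda>l. if l = i then 1 else if l = j then \<i> else 0"]
        diag[OF ij(1)] diag[OF ij(2)]
      unfolding pairing_outer_two[OF ij False] by simp_all
    then show ?thesis using ij by (simp add: effect_mat_def complex_eq_iff)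
  qed
qed (simp add: effect_mat_def)

text \<open>The matrix \<open>M\<close> of an effect satisfies \<open>M^2 \<le> M\<close>, since its
  eigenvalues \<open>\<mu>\<close> lie in the unit interval.\<close>

lemma effect_square_le:
  assumes E: "effect d \<Theta>"
  shows "norm2 d (\<lambda>i. \<Sum>j<d. effect_mat d \<Theta> $$ (i, j) * x j) \<le> Re (pairing d \<Theta> (outer d x))"
proof -
  obtain Q \<mu> where D: "diagonalizes d Q \<mu> (effect_mat d \<Theta>)"
    using hermitian_diagonalizable[OF effect_hermitian[OF E]] by blast
  have Q: "is_unitary d Q" by (rule diagonalizes_unitary[OF D])
  define y where "y z k = (\<Sum>j<d. cnj (Q $$ (j, k)) * z j)" for z k
  have form: "pairing d \<Theta> (outer d z) = complex_of_real (\<Sum>k<d. \<mu> k * (cmod (y z k))\<^sup>2)" for z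
    unfolding pairing_outer_effect_mat diagonalizes_form[OF D] of_real_sum of_real_mult complex_norm_square y_def
    by (simp add: mult.assoc)
  have mu: "0 \<le> \<mu> k \<and> \<mu> k \<le> 1" if k: "k < d" for k
  proof -
    let ?z = "\<lambda>i. Q $$ (i, k)"
    have y: "y ?z l = (if l = k then 1 else 0)" if "l < d" for l
      unfolding y_def using is_unitary_cols[OF Q that k] .
    have "Re (pairing d \<Theta> (outer d ?z)) = (\<Sum>l<d. \<mu> l * (cmod (y ?z l))\<^sup>2)"
      unfolding form by simp
    also have "\<dots> = (\<Sum>l<d. if l = k then \<mu> k else 0)"
      by (intro sum.cong refl) (use y in auto)
    finally have "Re (pairing d \<Theta> (outer d ?z)) = \<mu> k" using k by simp
    moreover have "norm2 d ?z = 1" unfolding norm2_def by (rule unitary_col_norm[OF Q k])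
    ultimately show ?thesis using E unfolding effect_def by metis
  qed
  have "(\<Sum>j<d. effect_mat d \<Theta> $$ (i, j) * x j) = (\<Sum>k<d. Q $$ (i, k) * (complex_of_real (\<mu> k) * y x k))" if "i < d" for i
  proof -
    have "(\<Sum>j<d. effect_mat d \<Theta> $$ (i, j) * x j) = (\<Sum>j<d. \<Sum>k<d. Q $$ (i, k) * (complex_of_real (\<mu> k) * (cnj (Q $$ (j, k)) * x j)))"
      using that by (intro sum.cong refl) (simp add: diagonalizes_index[OF D] sum_distrib_left sum_distrib_right mult_ac)
    also have "\<dots> = (\<Sum>k<d. \<Sum>j<d. Q $$ (i, k) * (complex_of_real (\<mu> k) * (cnj (Q $$ (j, k)) * x j)))"
      by (rule sum.swap)
    finally show ?thesis by (simp only: y_def sum_distrib_left)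
  qed
  then have "norm2 d (\<lambda>i. \<Sum>j<d. effect_mat d \<Theta> $$ (i, j) * x j) = norm2 d (\<lambda>i. \<Sum>k<d. Q $$ (i, k) * (complex_of_real (\<mu> k) * y x k))"
    unfolding norm2_def by (intro sum.cong) auto
  also have "\<dots> = norm2 d (\<lambda>k. complex_of_real (\<mu> k) * y x k)" by (rule norm2_unitary'[OF Q])
  also have "\<dots> = (\<Sum>k<d. (\<mu> k)\<^sup>2 * (cmod (y x k))\<^sup>2)"
    by (simp add: norm2_def norm_mult power_mult_distrib)
  also have "\<dots> \<le> (\<Sum>k<d. \<mu> k * (cmod (y x k))\<^sup>2)"
    using mu by (intro sum_mono mult_right_mono) (auto simp: power2_eq_square mult_left_le_one_le)
  also have "\<dots> = Re (pairing d \<Theta> (outer d x))" unfolding form by simp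
  finally show ?thesis .
qed

text \<open>Expanding the square gives \<open>|x|^2 - 2 <x, M x> + |M x|^2\<close>, and the last
  term is at most \<open><x, M x>\<close> by \<open>M^2 \<le> M\<close>.\<close>

lemma effect_complement_square_le:
  assumes E: "effect d \<Theta>"
  shows "norm2 d (\<lambda>i. x i - (\<Sum>j<d. effect_mat d \<Theta> $$ (i, j) * x j)) \<le> norm2 d x - Re (pairing d \<Theta> (outer d x))"
proof -
  define y where "y i = (\<Sum>j<d. effect_mat d \<Theta> $$ (i, j) * x j)" for i
  have sq: "(cmod (a - b))\<^sup>2 = (cmod a)\<^sup>2 - 2 * Re (b * cnj a) + (cmod b)\<^sup>2" for a b
    by (simp only: cmod_power2) (simp add: power2_eq_square algebra_simps)
  have "pairing d \<Theta> (outer d x) = (\<Sum>i<d. y i * cnj (x i))"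
    unfolding pairing_outer_effect_mat y_def by (simp add: sum_distrib_right)
  then have "norm2 d (\<lambda>i. x i - y i) = norm2 d x - 2 * Re (pairing d \<Theta> (outer d x)) + norm2 d y"
    by (simp add: norm2_def sq sum.distrib sum_subtractf sum_distrib_left)
  then show ?thesis using effect_square_le[OF E, of x] unfolding y_def by simp
qed

text \<open>If \<open>p \<le> c * q\<close>, the minimum is \<open>p\<close> and the summand with
  \<open>ln 2\<close> pays for a possibly negative logarithm, by \<open>ln x \<le> x - 1\<close>.
  Otherwise the log-ratio is at least \<open>log 2 c\<close>, and the other terms on the left only
  lower it.\<close>

lemma divergence_term_threshold:
  assumes "0 \<le> p" "0 \<le> q" "0 \<le> w" "q = 0 \<Longrightarrow> p = 0 \<or> w = 0" "1 \<le> c"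
  shows "(w * p - w * min p (c * q)) * log 2 c - w * q / ln 2 \<le> w * (p * (log_or_0 p - log_or_0 q))"
proof (cases "p \<le> c * q \<or> w = 0")
  case True
  have "0 \<le> w * p / ln 2" using assms by simp
  then show ?thesis using True divergence_term_ge[OF assms(1-4)] by (auto simp: diff_divide_distrib min_def)
next
  case False
  then have pos: "0 < q" "0 < p" "c * q < p" using assms by (auto simp: order.strict_iff_order)
  have "log 2 (c * q) \<le> log 2 p" using pos assms by simp
  then have "log 2 c \<le> log 2 p - log 2 q" using pos assms(5) by (simp add: log_mult)
  then have "w * (p * log 2 c) \<le> w * (p * (log_or_0 p - log_or_0 q))"
    using pos assms by (intro mult_left_mono) (auto simp: log_or_0_def)
  moreover have "0 \<le> w * (c * q) * log 2 c" "0 \<le> w * q / ln 2" using assms by auto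
  ultimately show ?thesis using pos by (simp add: min_def algebra_simps)
qed

text \<open>In terms of the joint distributions \<open>\<bar>W i j\<bar>\<^sup>2 p i\<close> and \<open>\<bar>W i j\<bar>\<^sup>2 q j\<close> of Nussbaum and
  Szkola, the quantum errors of a test are at least half the classical ones, so the classical
  likelihood-ratio bound replaces the data processing inequality.\<close>

theorem rel_entropy_ge_test:
  assumes rho: "is_state d \<rho>" and sig: "is_state d \<sigma>" and E: "effect d \<Theta>"
    and \<epsilon>: "1 - \<epsilon> \<le> Re (pairing d \<Theta> \<rho>)" and \<delta>: "Re (pairing d \<Theta> \<sigma>) \<le> \<delta>" and c: "1 \<le> c"
  shows "ereal ((1 - 2 * (\<epsilon> + c * \<delta>)) * log 2 c - 2) \<le> rel_entropy \<rho> \<sigma>"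
proof -
  obtain U p where D: "diagonalizes d U p \<rho>" and p: "\<And>i. i < d \<Longrightarrow> 0 \<le> p i" "(\<Sum>i<d. p i) = 1"
    using rho by (auto simp: is_state_iff)
  obtain V q where F: "diagonalizes d V q \<sigma>" and q: "\<And>i. i < d \<Longrightarrow> 0 \<le> q i" "(\<Sum>i<d. q i) = 1"
    using sig by (auto simp: is_state_iff)
  have U: "is_unitary d U" and V: "is_unitary d V" by (rule diagonalizes_unitary[OF D], rule diagonalizes_unitary[OF F])
  have Uc: "U \<in> carrier_mat d d" "V \<in> carrier_mat d d" using U V by (auto simp: is_unitary_def)
  define W where "W = mat_adjoint U * V"
  have W: "is_unitary d W" unfolding W_def by (rule unitary_change_of_basis[OF D F])
  define M where "M = effect_mat d \<Theta>"
  define u v where "u i = (\<lambda>a. U $$ (a, i))" and "v j = (\<lambda>a. V $$ (a, j))" for i j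
  define app where "app x = (\<lambda>a. \<Sum>b<d. M $$ (a, b) * x b)" for x
  \<comment> \<open>The overlap of \<open>u i\<close> with \<open>v j\<close> is split by inserting
    \<open>1 = (1 - M) + M\<close>; \<open>X\<close> is the rejected and \<open>Y\<close> the
    accepted part. Weighted with \<open>p\<close>, the squares of \<open>X\<close> are controlled by
    the error on \<open>\<rho>\<close>; weighted with \<open>q\<close>, those of \<open>Y\<close> by
    the error on \<open>\<sigma>\<close>.\<close>
  define X where "X i j = (\<Sum>a<d. cnj (V $$ (a, j)) * (u i a - app (u i) a))" for i j
  define Y where "Y i j = (\<Sum>a<d. cnj (V $$ (a, j)) * app (u i) a)" for i j
  define Z where "Z i j = (\<Sum>a<d. cnj (U $$ (a, i)) * app (v j) a)" for i j
  have herm: "cnj (M $$ (a, b)) = M $$ (b, a)" if "a < d" "b < d" for a b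
    using hermitian_index[OF effect_hermitian[OF E] that(2,1)] by (simp add: M_def)
  \<comment> \<open>Hermiticity moves \<open>M\<close> to the other eigenvector, so that the sum
    over \<open>i\<close> at fixed \<open>j\<close> becomes the squared norm of \<open>M\<close>
    applied to \<open>v j\<close>.\<close>
  have YZ: "Y i j = cnj (Z i j)" for i j
  proof -
    have "cnj (Z i j) = (\<Sum>a<d. \<Sum>b<d. U $$ (a, i) * (M $$ (b, a) * cnj (V $$ (b, j))))"
      unfolding Z_def app_def v_def using herm by (simp add: sum_distrib_left)
    also have "\<dots> = (\<Sum>b<d. \<Sum>a<d. U $$ (a, i) * (M $$ (b, a) * cnj (V $$ (b, j))))"
      by (rule sum.swap)
    also have "\<dots> = Y i j" unfolding Y_def app_def u_def by (simp add: sum_distrib_left mult_ac)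
    finally show ?thesis ..
  qed
  have XY: "cnj (W $$ (i, j)) = X i j + Y i j" if "i < d" "j < d" for i j
  proof -
    have "W $$ (i, j) = (\<Sum>a<d. mat_adjoint U $$ (i, a) * V $$ (a, j))"
      unfolding W_def by (rule index_mult[OF adjoint_carrier[OF Uc(1)] Uc(2) that])
    also have "\<dots> = (\<Sum>a<d. cnj (U $$ (a, i)) * V $$ (a, j))" using Uc that by (intro sum.cong) auto
    finally have "cnj (W $$ (i, j)) = (\<Sum>a<d. U $$ (a, i) * cnj (V $$ (a, j)))" by simp
    also have "\<dots> = X i j + Y i j" unfolding X_def Y_def u_def sum.distrib[symmetric]
      by (intro sum.cong refl) (simp add: algebra_simps)
    finally show ?thesis .
  qed
  have nu: "norm2 d (u i) = 1" "norm2 d (v i) = 1" if "i < d" for i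
    unfolding norm2_def u_def v_def using unitary_col_norm[OF U that] unitary_col_norm[OF V that] .
  have sX: "(\<Sum>j<d. (cmod (X i j))\<^sup>2) \<le> 1 - Re (pairing d \<Theta> (outer d (u i)))" if "i < d" for i
  proof -
    have "(\<Sum>j<d. (cmod (X i j))\<^sup>2) = norm2 d (\<lambda>a. u i a - app (u i) a)"
      unfolding X_def by (subst norm2_unitary[OF V, symmetric]) (simp add: norm2_def)
    also have "\<dots> \<le> 1 - Re (pairing d \<Theta> (outer d (u i)))"
      using effect_complement_square_le[OF E, of "u i"] nu[OF that] by (simp add: app_def M_def)
    finally show ?thesis .
  qed
  have sY: "(\<Sum>i<d. (cmod (Y i j))\<^sup>2) \<le> Re (pairing d \<Theta> (outer d (v j)))" for j
  proof -
    have "(\<Sum>i<d. (cmod (Y i j))\<^sup>2) = norm2 d (app (v j))"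
      unfolding YZ complex_mod_cnj unfolding Z_def by (subst norm2_unitary[OF U, symmetric]) (simp add: norm2_def)
    also have "\<dots> \<le> Re (pairing d \<Theta> (outer d (v j)))"
      using effect_square_le[OF E, of "v j"] by (simp add: app_def M_def)
    finally show ?thesis .
  qed
  have "(\<Sum>i<d. \<Sum>j<d. p i * (cmod (X i j))\<^sup>2) \<le> (\<Sum>i<d. p i * (1 - Re (pairing d \<Theta> (outer d (u i)))))"
    unfolding sum_distrib_left[symmetric] using p sX by (intro sum_mono mult_left_mono) auto
  also have "\<dots> = 1 - Re (pairing d \<Theta> \<rho>)"
    unfolding pairing_diagonalizes[OF D] by (simp add: right_diff_distrib sum_subtractf p(2) u_def)
  finally have pX: "(\<Sum>i<d. \<Sum>j<d. p i * (cmod (X i j))\<^sup>2) \<le> \<epsilon>" using \<epsilon> by simp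
  have "(\<Sum>i<d. \<Sum>j<d. q j * (cmod (Y i j))\<^sup>2) = (\<Sum>j<d. q j * (\<Sum>i<d. (cmod (Y i j))\<^sup>2))"
    by (subst sum.swap) (simp add: sum_distrib_left)
  also have "\<dots> \<le> (\<Sum>j<d. q j * Re (pairing d \<Theta> (outer d (v j))))"
    using q sY by (intro sum_mono mult_left_mono) auto
  also have "\<dots> = Re (pairing d \<Theta> \<sigma>)"
    unfolding pairing_diagonalizes[OF F] by (simp add: v_def)
  finally have qY: "(\<Sum>i<d. \<Sum>j<d. q j * (cmod (Y i j))\<^sup>2) \<le> \<delta>" using \<delta> by simp
  have "(cmod (W $$ (i, j)))\<^sup>2 * min (p i) (c * q j) \<le> 2 * (p i * (cmod (X i j))\<^sup>2) + 2 * c * (q j * (cmod (Y i j))\<^sup>2)"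
    if ij: "i < d" "j < d" for i j
  proof -
    have "cmod (W $$ (i, j)) \<le> cmod (X i j) + cmod (Y i j)"
      using XY[OF ij] norm_triangle_ineq[of "X i j" "Y i j"] by (metis complex_mod_cnj)
    then have "(cmod (W $$ (i, j)))\<^sup>2 \<le> (cmod (X i j) + cmod (Y i j))\<^sup>2" by (intro power_mono) auto
    \<comment> \<open>Squaring a sum of two terms costs the factor 2 that stands in front of the
      errors in the final bound.\<close>
    also have "\<dots> \<le> 2 * (cmod (X i j))\<^sup>2 + 2 * (cmod (Y i j))\<^sup>2"
      using zero_le_power2[of "cmod (X i j) - cmod (Y i j)"] by (simp add: power2_eq_square algebra_simps)
    finally have w: "(cmod (W $$ (i, j)))\<^sup>2 \<le> 2 * (cmod (X i j))\<^sup>2 + 2 * (cmod (Y i j))\<^sup>2" .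
    have m: "0 \<le> min (p i) (c * q j)" using p q c ij by auto
    have "(cmod (W $$ (i, j)))\<^sup>2 * min (p i) (c * q j) \<le>
      (2 * (cmod (X i j))\<^sup>2) * min (p i) (c * q j) + (2 * (cmod (Y i j))\<^sup>2) * min (p i) (c * q j)"
      using mult_right_mono[OF w m] by (simp add: distrib_right)
    also have "\<dots> \<le> (2 * (cmod (X i j))\<^sup>2) * p i + (2 * (cmod (Y i j))\<^sup>2) * (c * q j)"
      by (intro add_mono mult_left_mono) auto
    finally show ?thesis by (simp add: mult_ac)
  qed
  then have "(\<Sum>i<d. \<Sum>j<d. (cmod (W $$ (i, j)))\<^sup>2 * min (p i) (c * q j)) \<le>
    (\<Sum>i<d. \<Sum>j<d. 2 * (p i * (cmod (X i j))\<^sup>2) + 2 * c * (q j * (cmod (Y i j))\<^sup>2))"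
    by (intro sum_mono) auto
  also have "\<dots> = 2 * (\<Sum>i<d. \<Sum>j<d. p i * (cmod (X i j))\<^sup>2) + 2 * c * (\<Sum>i<d. \<Sum>j<d. q j * (cmod (Y i j))\<^sup>2)"
    by (simp add: sum.distrib sum_distrib_left)
  also have "\<dots> \<le> 2 * \<epsilon> + 2 * c * \<delta>"
    using pX qY c by (intro add_mono mult_left_mono) auto
  finally have overlap: "(\<Sum>i<d. \<Sum>j<d. (cmod (W $$ (i, j)))\<^sup>2 * min (p i) (c * q j)) \<le> 2 * (\<epsilon> + c * \<delta>)" by simp
  have "(1 - 2 * (\<epsilon> + c * \<delta>)) * log 2 c - 2 \<le> spectral_divergence d W p q" if s: "supported d W p q"
  proof -
    \<comment> \<open>Yields \<open>1 / ln 2 \<le> 2\<close>, the source of the additive constant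
      -2: the second joint distribution has total mass 1 and enters with the factor
      \<open>1 / ln 2\<close>.\<close>
    have "1 / 2 \<le> ln (2 :: real)"
    proof -
      have "exp (1 / 2 :: real) ^ 2 = exp 1" by (simp flip: exp_of_nat_mult)
      then have "exp (1 / 2 :: real) ^ 2 \<le> 2 ^ 2" using exp_le by simp
      then have "exp (1 / 2 :: real) \<le> 2" by (rule power2_le_imp_le) simp
      then show ?thesis by (subst ln_ge_iff) auto
    qed
    then have "1 / ln 2 \<le> (2 :: real)" by (simp add: field_simps)
    moreover have "(1 - 2 * (\<epsilon> + c * \<delta>)) * log 2 c \<le>
       (1 - (\<Sum>i<d. \<Sum>j<d. (cmod (W $$ (i, j)))\<^sup>2 * min (p i) (c * q j))) * log 2 c"
      using overlap c by (intro mult_right_mono) auto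
    moreover have "(1 - (\<Sum>i<d. \<Sum>j<d. (cmod (W $$ (i, j)))\<^sup>2 * min (p i) (c * q j))) * log 2 c - 1 / ln 2 =
      (\<Sum>i<d. \<Sum>j<d. ((cmod (W $$ (i, j)))\<^sup>2 * p i - (cmod (W $$ (i, j)))\<^sup>2 * min (p i) (c * q j)) * log 2 c -
        (cmod (W $$ (i, j)))\<^sup>2 * q j / ln 2)"
    proof -
      have "(1 - (\<Sum>i<d. \<Sum>j<d. (cmod (W $$ (i, j)))\<^sup>2 * min (p i) (c * q j))) * log 2 c - 1 / ln 2 =
        ((\<Sum>i<d. \<Sum>j<d. (cmod (W $$ (i, j)))\<^sup>2 * p i) - (\<Sum>i<d. \<Sum>j<d. (cmod (W $$ (i, j)))\<^sup>2 * min (p i) (c * q j))) * log 2 c -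
        (\<Sum>i<d. \<Sum>j<d. (cmod (W $$ (i, j)))\<^sup>2 * q j) / ln 2"
        by (simp only: sum_weighted_rows[OF W] sum_weighted_cols[OF W] p(2) q(2))
      then show ?thesis by (simp only: sum_subtractf[symmetric] sum_distrib_right sum_divide_distrib)
    qed
    moreover have "\<dots> \<le> spectral_divergence d W p q"
      unfolding spectral_divergence_def using p q c s
      by (intro sum_mono divergence_term_threshold) (auto simp: supported_def)
    ultimately show ?thesis by simp
  qed
  then show ?thesis unfolding rel_entropy_eq[OF D F] W_def[symmetric] by simp
qed

section \<open>Associativity and tensor powers\<close>

lemma bip_tensor_assoc:
  assumes X: "X \<in> carrier_mat (a1 * b1) (a1 * b1)" and Y: "Y \<in> carrier_mat (a2 * b2) (a2 * b2)"
    and Z: "Z \<in> carrier_mat (a3 * b3) (a3 * b3)"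
  shows "bip_tensor (a1 * a2) (b1 * b2) a3 b3 (bip_tensor a1 b1 a2 b2 X Y) Z =
    bip_tensor a1 b1 (a2 * a3) (b2 * b3) X (bip_tensor a2 b2 a3 b3 Y Z)"
proof (rule bip_tensor_eqI[OF bip_tensor_carrier])
  show "bip_tensor a1 b1 (a2 * a3) (b2 * b3) X (bip_tensor a2 b2 a3 b3 Y Z)
      \<in> carrier_mat (a1 * a2 * a3 * (b1 * b2 * b3)) (a1 * a2 * a3 * (b1 * b2 * b3))"
    using bip_tensor_carrier[of a1 b1 "a2 * a3" "b2 * b3"] by (simp add: mult.assoc)
  fix x x3 y y3 x' x3' y' y3'
  assume l: "x < a1 * a2" "x3 < a3" "y < b1 * b2" "y3 < b3" "x' < a1 * a2" "x3' < a3" "y' < b1 * b2" "y3' < b3"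
  obtain x1 x2 where x: "x1 < a1" "x2 < a2" "x = x1 * a2 + x2" using l(1) by (rule pair_index_cases)
  obtain y1 y2 where y: "y1 < b1" "y2 < b2" "y = y1 * b2 + y2" using l(3) by (rule pair_index_cases)
  obtain x1' x2' where x': "x1' < a1" "x2' < a2" "x' = x1' * a2 + x2'" using l(5) by (rule pair_index_cases)
  obtain y1' y2' where y': "y1' < b1" "y2' < b2" "y' = y1' * b2 + y2'" using l(7) by (rule pair_index_cases)
  have r: "((u1 * a2 + u2) * a3 + u3) * (b1 * b2 * b3) + ((w1 * b2 + w2) * b3 + w3) =
     (u1 * (a2 * a3) + (u2 * a3 + u3)) * (b1 * (b2 * b3)) + (w1 * (b2 * b3) + (w2 * b3 + w3))" for u1 u2 u3 w1 w2 w3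
    by (simp add: algebra_simps)
  have l2: "x2 * a3 + x3 < a2 * a3" "y2 * b3 + y3 < b2 * b3" "x2' * a3 + x3' < a2 * a3" "y2' * b3 + y3' < b2 * b3"
    using l x y x' y' by (auto intro: pair_index_less)
  show "bip_tensor (a1 * a2) (b1 * b2) a3 b3 (bip_tensor a1 b1 a2 b2 X Y) Z $$
      ((x * a3 + x3) * (b1 * b2 * b3) + (y * b3 + y3), (x' * a3 + x3') * (b1 * b2 * b3) + (y' * b3 + y3')) =
    bip_tensor a1 b1 (a2 * a3) (b2 * b3) X (bip_tensor a2 b2 a3 b3 Y Z) $$
      ((x * a3 + x3) * (b1 * b2 * b3) + (y * b3 + y3), (x' * a3 + x3') * (b1 * b2 * b3) + (y' * b3 + y3'))"
    unfolding bip_tensor_index[OF bip_tensor_carrier Z l]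
    unfolding x(3) y(3) x'(3) y'(3) r
      bip_tensor_index[OF X Y x(1,2) y(1,2) x'(1,2) y'(1,2)]
      bip_tensor_index[OF X bip_tensor_carrier x(1) l2(1) y(1) l2(2) x'(1) l2(3) y'(1) l2(4)]
      bip_tensor_index[OF Y Z x(2) l(2) y(2) l(4) x'(2) l(6) y'(2) l(8)]
    by simp
qed

lemma bip_tensor_one:
  assumes X: "X \<in> carrier_mat (a * b) (a * b)"
  shows "bip_tensor a b 1 1 X (1\<^sub>m 1) = X"
proof (rule bip_tensor_eqI[OF bip_tensor_carrier])
  show "X \<in> carrier_mat (a * 1 * (b * 1)) (a * 1 * (b * 1))" using X by simp
  fix x1 x2 y1 y2 x1' x2' y1' y2' :: nat
  assume l: "x1 < a" "x2 < 1" "y1 < b" "y2 < 1" "x1' < a" "x2' < 1" "y1' < b" "y2' < 1"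
  show "bip_tensor a b 1 1 X (1\<^sub>m 1) $$ ((x1 * 1 + x2) * (b * 1) + (y1 * 1 + y2), (x1' * 1 + x2') * (b * 1) + (y1' * 1 + y2')) =
    X $$ ((x1 * 1 + x2) * (b * 1) + (y1 * 1 + y2), (x1' * 1 + x2') * (b * 1) + (y1' * 1 + y2'))"
    using l by (subst bip_tensor_index[OF X _ l]) auto
qed

lemma is_state_one: "is_state 1 (1\<^sub>m 1)"
  unfolding is_state_iff
  by (intro exI[of _ "1\<^sub>m 1"] exI[of _ "\<lambda>_. 1"] conjI diagonalizesI is_unitaryI) auto

lemma is_state_bip_power:
  assumes "is_state (a * b) X"
  shows "is_state (a ^ n * b ^ n) (bip_power a b X n)"
proof (induction n)
  case 0
  then show ?case using is_state_one by simp
next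
  case (Suc n)
  then show ?case using is_state_bip_tensor[OF Suc assms] by (simp add: mult.commute)
qed

lemma bip_power_add:
  assumes "is_state (a * b) X"
  shows "bip_power a b X (m + n) = bip_tensor (a ^ m) (b ^ m) (a ^ n) (b ^ n) (bip_power a b X m) (bip_power a b X n)"
proof (induction n)
  case 0
  then show ?case using bip_tensor_one[OF is_state_carrier[OF is_state_bip_power[OF assms]]] by simp
next
  case (Suc n)
  have c: "bip_power a b X k \<in> carrier_mat (a ^ k * b ^ k) (a ^ k * b ^ k)" for k
    by (rule is_state_carrier[OF is_state_bip_power[OF assms]])
  show ?case
    using Suc bip_tensor_assoc[OF c c is_state_carrier[OF assms], of m n]
    by (simp add: power_add mult.commute)
qed

section \<open>Regularised relative entropy of entanglement\<close>

lemma rel_ent_entanglement_nonneg: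
  assumes "is_state (a * b) \<rho>"
  shows "0 \<le> rel_ent_entanglement a b \<rho>"
  unfolding rel_ent_entanglement_def
  by (intro INF_greatest rel_entropy_nonneg[OF assms]) (auto intro: is_separable_state)

lemma is_state_dim_pos: "is_state d \<rho> \<Longrightarrow> 0 < d"
  by (rule ccontr) (auto simp: is_state_iff)

lemma is_unitary_one: "is_unitary d (1\<^sub>m d)"
proof -
  have "mat_adjoint (1\<^sub>m d :: complex mat) = 1\<^sub>m d" by (rule eq_matI) auto
  then show ?thesis by (intro is_unitaryI) auto
qed

lemma maximally_mixed_diagonalizes:
  "diagonalizes d (1\<^sub>m d) (\<lambda>_. c) (complex_of_real c \<cdot>\<^sub>m 1\<^sub>m d)"
proof (rule diagonalizesI)
  fix i j assume ij: "i < d" "j < d"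
  have "(\<Sum>k<d. complex_of_real c * 1\<^sub>m d $$ (i, k) * cnj (1\<^sub>m d $$ (j, k))) = (\<Sum>k<d. if k = i then complex_of_real c * 1\<^sub>m d $$ (i, j) else 0)"
    using ij by (intro sum.cong) auto
  then show "(complex_of_real c \<cdot>\<^sub>m 1\<^sub>m d) $$ (i, j) = (\<Sum>k<d. complex_of_real c * 1\<^sub>m d $$ (i, k) * cnj (1\<^sub>m d $$ (j, k)))"
    using ij by simp
qed (auto simp: is_unitary_one)

lemma is_state_maximally_mixed: "0 < d \<Longrightarrow> is_state d (complex_of_real (1 / real d) \<cdot>\<^sub>m 1\<^sub>m d)"
  unfolding is_state_iff
  by (intro exI[of _ "1\<^sub>m d"] exI[of _ "\<lambda>_. 1 / real d"] conjI maximally_mixed_diagonalizes) auto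

text \<open>The maximally mixed state is separable and has full rank, so the relative entropy with
  respect to it is finite.\<close>

lemma rel_ent_entanglement_finite:
  assumes "is_state (a * b) \<rho>"
  shows "rel_ent_entanglement a b \<rho> < \<infinity>"
proof -
  have pos: "0 < a" "0 < b" using is_state_dim_pos[OF assms] by auto
  let ?A = "complex_of_real (1 / real a) \<cdot>\<^sub>m 1\<^sub>m a" and ?B = "complex_of_real (1 / real b) \<cdot>\<^sub>m 1\<^sub>m b"
  have eq: "kron ?A ?B = msum (a * b) {..<1::nat} (\<lambda>_. complex_of_real 1 \<cdot>\<^sub>m kron ?A ?B)"
    by (rule eq_matI) (auto simp: msum_def)
  have sep: "is_separable a b (kron ?A ?B)"
    unfolding is_separable_def
    by (rule exI[of _ 1], rule exI[of _ "\<lambda>_. 1"], rule exI[of _ "\<lambda>_. ?A"], rule exI[of _ "\<lambda>_. ?B"])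
      (use pos eq in \<open>auto intro!: is_state_maximally_mixed simp del: of_real_divide\<close>)
  obtain U p where D: "diagonalizes (a * b) U p \<rho>" using assms by (auto simp: is_state_iff)
  have "rel_entropy \<rho> (kron ?A ?B) < \<infinity>"
    unfolding rel_entropy_eq[OF D diagonalizes_kron[OF maximally_mixed_diagonalizes maximally_mixed_diagonalizes]]
    using pos by (simp add: supported_def)
  moreover have "rel_ent_entanglement a b \<rho> \<le> rel_entropy \<rho> (kron ?A ?B)"
    unfolding rel_ent_entanglement_def using sep by (intro INF_lower) simp
  ultimately show ?thesis by (rule le_less_trans[rotated])
qed

text \<open>Separable states that are optimal up to \<open>e / 2\<close> for the two factors combine
  to a separable state for the product, and their relative entropies add up.\<close>

lemma rel_ent_entanglement_bip_tensor_le: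
  assumes "is_state (a1 * b1) \<rho>" "is_state (a2 * b2) \<rho>'"
  shows "rel_ent_entanglement (a1 * a2) (b1 * b2) (bip_tensor a1 b1 a2 b2 \<rho> \<rho>') \<le>
    rel_ent_entanglement a1 b1 \<rho> + rel_ent_entanglement a2 b2 \<rho>'"
proof -
  let ?E = "rel_ent_entanglement (a1 * a2) (b1 * b2) (bip_tensor a1 b1 a2 b2 \<rho> \<rho>')"
  have le: "?E \<le> rel_entropy \<rho> \<sigma> + rel_entropy \<rho>' \<sigma>'" if "is_separable a1 b1 \<sigma>" "is_separable a2 b2 \<sigma>'" for \<sigma> \<sigma>'
  proof -
    have "?E \<le> rel_entropy (bip_tensor a1 b1 a2 b2 \<rho> \<rho>') (bip_tensor a1 b1 a2 b2 \<sigma> \<sigma>')"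
      unfolding rel_ent_entanglement_def using is_separable_bip_tensor[OF that] by (intro INF_lower) simp
    also have "\<dots> \<le> rel_entropy \<rho> \<sigma> + rel_entropy \<rho>' \<sigma>'"
      by (intro rel_entropy_bip_tensor_le assms is_separable_state[OF that(1)] is_separable_state[OF that(2)])
    finally show ?thesis .
  qed
  obtain x where x: "rel_ent_entanglement a1 b1 \<rho> = ereal x"
    using rel_ent_entanglement_nonneg[OF assms(1)] rel_ent_entanglement_finite[OF assms(1)]
    by (cases "rel_ent_entanglement a1 b1 \<rho>") auto
  obtain y where y: "rel_ent_entanglement a2 b2 \<rho>' = ereal y"
    using rel_ent_entanglement_nonneg[OF assms(2)] rel_ent_entanglement_finite[OF assms(2)]
    by (cases "rel_ent_entanglement a2 b2 \<rho>'") auto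
  show ?thesis unfolding x y
  proof (rule ereal_le_epsilon2)
    fix e :: real assume e: "0 < e"
    have "rel_ent_entanglement a1 b1 \<rho> < ereal (x + e / 2)" "rel_ent_entanglement a2 b2 \<rho>' < ereal (y + e / 2)"
      using e by (auto simp: x y)
    then obtain \<sigma> \<sigma>' where s: "is_separable a1 b1 \<sigma>" "rel_entropy \<rho> \<sigma> < ereal (x + e / 2)"
      "is_separable a2 b2 \<sigma>'" "rel_entropy \<rho>' \<sigma>' < ereal (y + e / 2)"
      unfolding rel_ent_entanglement_def INF_less_iff by auto
    have "?E \<le> ereal (x + e / 2) + ereal (y + e / 2)"
      using le[OF s(1,3)] add_mono[OF less_imp_le[OF s(2)] less_imp_le[OF s(4)]] by (rule order_trans)
    then show "?E \<le> ereal x + ereal y + ereal e" by (simp add: algebra_simps)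
  qed
qed

text \<open>The limit is the infimum of \<open>f n / n\<close> over positive \<open>n\<close>, which
  nonnegativity keeps finite. The value \<open>f 0\<close> may be positive and is carried along as
  an additive constant.\<close>

lemma fekete:
  fixes f :: "nat \<Rightarrow> real"
  assumes nonneg: "\<And>n. 0 \<le> f n" and sub: "\<And>m n. f (m + n) \<le> f m + f n"
  shows "\<exists>L\<ge>0. (\<lambda>n. f n / real n) \<longlonglongrightarrow> L"
proof -
  define S where "S = (\<lambda>n. f n / real n) ` {1..}"
  define L where "L = Inf S"
  have ne: "S \<noteq> {}" by (auto simp: S_def)
  have bdd: "bdd_below S" unfolding S_def by (rule bdd_belowI[of _ 0]) (auto simp: nonneg)
  have L0: "0 \<le> L" unfolding L_def by (rule cInf_greatest[OF ne]) (auto simp: S_def nonneg)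
  have low: "L \<le> f n / real n" if "n \<ge> 1" for n
    unfolding L_def using bdd that by (intro cInf_lower) (auto simp: S_def)
  have mult: "f (k * N) \<le> real k * f N + f 0" for k N
  proof (induction k)
    case (Suc k)
    then show ?case using sub[of N "k * N"] by (simp add: algebra_simps)
  qed simp
  have "(\<lambda>n. f n / real n) \<longlonglongrightarrow> L"
  proof (rule LIMSEQ_I)
    fix e :: real assume e: "0 < e"
    obtain N where N: "N \<ge> 1" "f N / real N < L + e / 2"
      using cInf_lessD[OF ne, of "L + e / 2"] e unfolding L_def[symmetric] by (auto simp: S_def)
    \<comment> \<open>Bounds \<open>f\<close> on all remainders modulo \<open>N\<close> and includes
      the \<open>f 0\<close> left over from the multiples of \<open>N\<close>; it does not depend on
      \<open>n\<close>.\<close>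
    define C where "C = f 0 + (\<Sum>r<N. f r)"
    have C0: "0 \<le> C" unfolding C_def by (intro add_nonneg_nonneg sum_nonneg nonneg)
    have up: "f n / real n \<le> f N / real N + C / real n" if n: "n \<ge> 1" for n
    proof -
      have "f (n mod N) \<le> (\<Sum>r<N. f r)" using N(1) by (intro member_le_sum nonneg) auto
      moreover have "f n \<le> f (n div N * N) + f (n mod N)" using sub[of "n div N * N" "n mod N"] by simp
      ultimately have "f n \<le> real (n div N) * f N + C" using mult[of "n div N" N] by (simp add: C_def)
      also have "\<dots> \<le> (real n / real N) * f N + C"
        using nonneg[of N] of_nat_div_le_of_nat[of n N, where 'a = real] by (intro add_right_mono mult_right_mono)
      finally have "f n / real n \<le> ((real n / real N) * f N + C) / real n" by (intro divide_right_mono) auto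
      also have "\<dots> = f N / real N + C / real n" using n N(1) by (simp add: field_simps)
      finally show ?thesis .
    qed
    obtain M where M: "real M > 2 * C / e" using reals_Archimedean2 by blast
    show "\<exists>no. \<forall>n\<ge>no. norm (f n / real n - L) < e"
    proof (intro exI[of _ "Suc M"] allI impI)
      fix n assume n: "Suc M \<le> n"
      then have "2 * C / e < real n" using M by linarith
      then have "C / real n < e / 2" using e n by (simp add: field_simps)
      moreover have "f n / real n \<le> f N / real N + C / real n" "L \<le> f n / real n" using up low n by auto
      ultimately have "f n / real n - L < e" "0 \<le> f n / real n - L" using N(2) by linarith+
      then show "norm (f n / real n - L) < e" by simp
    qed
  qed
  then show ?thesis using L0 by blast
qed

text \<open>Nonnegativity and finiteness make the sequence real-valued, and subadditivity along
  tensor powers is what Fekete's lemma asks for. At \<open>n = 0\<close> the quotient is a division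
  by 0, hence the detour through \<open>eventually\<close>.\<close>

theorem reg_rel_ent_entanglement_limit:
  assumes "is_state (a * b) \<tau>"
  obtains L e where "0 \<le> L" "reg_rel_ent_entanglement a b \<tau> = ereal L"
    "\<And>n. rel_ent_entanglement (a ^ n) (b ^ n) (bip_power a b \<tau> n) = ereal (e n)"
    "(\<lambda>n. e n / real n) \<longlonglongrightarrow> L"
proof -
  let ?E = "\<lambda>n. rel_ent_entanglement (a ^ n) (b ^ n) (bip_power a b \<tau> n)"
  define e where "e n = real_of_ereal (?E n)" for n
  have state: "is_state (a ^ n * b ^ n) (bip_power a b \<tau> n)" for n by (rule is_state_bip_power[OF assms])
  have E: "?E n = ereal (e n)" for n
    using rel_ent_entanglement_nonneg[OF state[of n]] rel_ent_entanglement_finite[OF state[of n]]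
    unfolding e_def by (cases "?E n") auto
  have "e (m + n) \<le> e m + e n" for m n
  proof -
    have "?E (m + n) \<le> ?E m + ?E n"
      using rel_ent_entanglement_bip_tensor_le[OF state[of m] state[of n]]
      by (simp add: bip_power_add[OF assms] power_add)
    then show ?thesis by (simp add: E)
  qed
  moreover have "0 \<le> e n" for n using rel_ent_entanglement_nonneg[OF state[of n]] by (simp add: E)
  ultimately obtain L where L: "0 \<le> L" "(\<lambda>n. e n / real n) \<longlonglongrightarrow> L" using fekete[of e] by blast
  have "(\<lambda>n. ereal (e n / real n)) \<longlonglongrightarrow> ereal L" using L(2) by simp
  moreover have "eventually (\<lambda>n. ereal (e n / real n) = ?E n / ereal (real n)) sequentially"
    using eventually_gt_at_top[of 0] by eventually_elim (simp add: E)
  ultimately have "(\<lambda>n. ?E n / ereal (real n)) \<longlonglongrightarrow> ereal L" by (rule Lim_transform_eventually)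
  then have "reg_rel_ent_entanglement a b \<tau> = ereal L"
    unfolding reg_rel_ent_entanglement_def by (rule limI)
  then show ?thesis using that L E by blast
qed

section \<open>Linear functionals and protocols\<close>

text \<open>Matrices of all dimensions share one type, which is not a vector space. Linearity in a
  fixed dimension is therefore expressed by the existence of coefficients.\<close>

definition linear_functional :: "nat \<Rightarrow> (complex mat \<Rightarrow> complex) \<Rightarrow> bool" where
  "linear_functional d t \<longleftrightarrow> (\<exists>\<Theta>. \<forall>X\<in>carrier_mat d d. t X = pairing d \<Theta> X)"

lemma linear_functional_cong:
  assumes "linear_functional d t" "\<And>X. X \<in> carrier_mat d d \<Longrightarrow> t' X = t X"
  shows "linear_functional d t'"
  using assms by (auto simp: linear_functional_def)

lemma linear_functional_lincomb:
  assumes "linear_functional d t" "finite S" "X \<in> carrier_mat d d" "\<And>k. k \<in> S \<Longrightarrow> F k \<in> carrier_mat d d"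
    "\<And>i j. i < d \<Longrightarrow> j < d \<Longrightarrow> X $$ (i, j) = (\<Sum>k\<in>S. c k * F k $$ (i, j))"
  shows "t X = (\<Sum>k\<in>S. c k * t (F k))"
proof -
  obtain \<Theta> where \<Theta>: "\<And>X. X \<in> carrier_mat d d \<Longrightarrow> t X = pairing d \<Theta> X" using assms(1) by (auto simp: linear_functional_def)
  have "pairing d \<Theta> X = (\<Sum>k\<in>S. c k * pairing d \<Theta> (F k))" by (rule pairing_lincomb[OF assms(2,5)])
  then show ?thesis using \<Theta> assms(3,4) by simp
qed

lemma linear_functional_msum:
  assumes "linear_functional d t" "finite S" "\<And>k. k \<in> S \<Longrightarrow> F k \<in> carrier_mat d d"
  shows "t (msum d S F) = (\<Sum>k\<in>S. t (F k))"
  by (subst linear_functional_lincomb[OF assms(1,2) msum_carrier, where F = F and c = "\<lambda>_. 1"]) (auto intro: assms(3))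

lemma linear_functional_sum:
  assumes "finite S" "\<And>k. k \<in> S \<Longrightarrow> linear_functional d (t k)"
  shows "linear_functional d (\<lambda>X. \<Sum>k\<in>S. t k X)"
proof -
  have "\<forall>k. \<exists>\<Theta>. k \<in> S \<longrightarrow> (\<forall>X\<in>carrier_mat d d. t k X = pairing d \<Theta> X)"
    using assms(2) by (auto simp: linear_functional_def)
  then obtain \<Theta> where \<Theta>: "\<And>k X. k \<in> S \<Longrightarrow> X \<in> carrier_mat d d \<Longrightarrow> t k X = pairing d (\<Theta> k) X" by metis
  have "(\<Sum>k\<in>S. t k X) = pairing d (\<lambda>i j. \<Sum>k\<in>S. \<Theta> k i j) X" if "X \<in> carrier_mat d d" for X
  proof -
    have "pairing d (\<lambda>i j. \<Sum>k\<in>S. \<Theta> k i j) X = (\<Sum>i<d. \<Sum>k\<in>S. \<Sum>j<d. \<Theta> k i j * X $$ (i, j))"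
      unfolding pairing_def sum_distrib_right by (intro sum.cong refl sum.swap)
    also have "\<dots> = (\<Sum>k\<in>S. pairing d (\<Theta> k) X)"
      unfolding pairing_def by (rule sum.swap)
    finally show ?thesis using \<Theta> that by simp
  qed
  then show ?thesis by (auto simp: linear_functional_def)
qed

lemma index_sandwich:
  assumes "A \<in> carrier_mat n d" "X \<in> carrier_mat d d" "B \<in> carrier_mat n' d" "i < n" "j < n'"
  shows "(A * X * mat_adjoint B) $$ (i, j) = (\<Sum>k<d. \<Sum>l<d. A $$ (i, k) * X $$ (k, l) * cnj (B $$ (j, l)))"
proof -
  have "(A * X * mat_adjoint B) $$ (i, j) = (\<Sum>l<d. (A * X) $$ (i, l) * mat_adjoint B $$ (l, j))"
    by (rule index_mult[OF mult_carrier_mat[OF assms(1,2)] adjoint_carrier[OF assms(3)] assms(4,5)])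
  also have "\<dots> = (\<Sum>l<d. (\<Sum>k<d. A $$ (i, k) * X $$ (k, l)) * cnj (B $$ (j, l)))"
    using assms index_mult[OF assms(1,2,4)] by (intro sum.cong refl) auto
  also have "\<dots> = (\<Sum>k<d. \<Sum>l<d. A $$ (i, k) * X $$ (k, l) * cnj (B $$ (j, l)))"
    unfolding sum_distrib_right by (rule sum.swap)
  finally show ?thesis .
qed

lemma conj_carrier: "E \<in> carrier_mat n d \<Longrightarrow> X \<in> carrier_mat d d \<Longrightarrow> E * X * mat_adjoint E \<in> carrier_mat n n"
  by (intro mult_carrier_mat[of _ n d] mult_carrier_mat[of _ n d]) auto

lemma sum_swap4:
  fixes f :: "'a \<Rightarrow> 'b \<Rightarrow> 'c \<Rightarrow> 'd \<Rightarrow> 'e::comm_monoid_add"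
  shows "(\<Sum>i\<in>A. \<Sum>j\<in>B. \<Sum>k\<in>C. \<Sum>l\<in>D. f i j k l) = (\<Sum>k\<in>C. \<Sum>l\<in>D. \<Sum>i\<in>A. \<Sum>j\<in>B. f i j k l)"
  unfolding sum.cartesian_product
  by (rule sum.reindex_bij_witness[where i = "\<lambda>(k, l, i, j). (i, j, k, l)" and j = "\<lambda>(i, j, k, l). (k, l, i, j)"]) auto

lemma linear_functional_conj:
  assumes "linear_functional n t" "E \<in> carrier_mat n d"
  shows "linear_functional d (\<lambda>X. t (E * X * mat_adjoint E))"
proof -
  obtain \<Theta> where \<Theta>: "\<And>X. X \<in> carrier_mat n n \<Longrightarrow> t X = pairing n \<Theta> X" using assms(1) by (auto simp: linear_functional_def)
  define \<Xi> where "\<Xi> k l = (\<Sum>i<n. \<Sum>j<n. \<Theta> i j * (E $$ (i, k) * cnj (E $$ (j, l))))" for k l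
  have "t (E * X * mat_adjoint E) = pairing d \<Xi> X" if X: "X \<in> carrier_mat d d" for X
  proof -
    have "t (E * X * mat_adjoint E) = (\<Sum>i<n. \<Sum>j<n. \<Sum>k<d. \<Sum>l<d. \<Theta> i j * (E $$ (i, k) * X $$ (k, l) * cnj (E $$ (j, l))))"
      unfolding \<Theta>[OF conj_carrier[OF assms(2) X]] pairing_def
      using index_sandwich[OF assms(2) X assms(2)] by (intro sum.cong refl) (simp add: sum_distrib_left)
    also have "\<dots> = (\<Sum>k<d. \<Sum>l<d. \<Sum>i<n. \<Sum>j<n. \<Theta> i j * (E $$ (i, k) * X $$ (k, l) * cnj (E $$ (j, l))))"
      by (rule sum_swap4)
    also have "\<dots> = pairing d \<Xi> X"
      unfolding pairing_def \<Xi>_def sum_distrib_right by (simp add: mult_ac)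
    finally show ?thesis .
  qed
  then show ?thesis by (auto simp: linear_functional_def)
qed

section \<open>Vectors as functions and tensor products of operators\<close>

definition mapply :: "complex mat \<Rightarrow> (nat \<Rightarrow> complex) \<Rightarrow> nat \<Rightarrow> complex" where
  "mapply E z i = (\<Sum>j<dim_col E. E $$ (i, j) * z j)"

lemma conj_outer:
  assumes "E \<in> carrier_mat n d"
  shows "E * outer d z * mat_adjoint E = outer n (mapply E z)"
proof (rule eq_matI)
  fix i j assume "i < dim_row (outer n (mapply E z))" "j < dim_col (outer n (mapply E z))"
  then have ij: "i < n" "j < n" by (auto simp: outer_def)
  show "(E * outer d z * mat_adjoint E) $$ (i, j) = outer n (mapply E z) $$ (i, j)"
    using ij assms unfolding index_sandwich[OF assms outer_carrier assms ij]
    by (simp add: mapply_def sum_product mult_ac)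
qed (use assms in \<open>auto simp: outer_def\<close>)

lemma norm2_cong: "(\<And>i. i < d \<Longrightarrow> x i = y i) \<Longrightarrow> norm2 d x = norm2 d y"
  by (simp add: norm2_def)

lemma outer_cong: "(\<And>i. i < d \<Longrightarrow> x i = y i) \<Longrightarrow> outer d x = outer d y"
  by (rule eq_matI) (auto simp: outer_def)

definition prodvec :: "nat \<Rightarrow> (nat \<Rightarrow> complex) \<Rightarrow> (nat \<Rightarrow> complex) \<Rightarrow> nat \<Rightarrow> complex" where
  "prodvec m u w i = u (i div m) * w (i mod m)"

lemma norm2_pair: "norm2 (n * m) z = (\<Sum>x<n. norm2 m (\<lambda>y. z (x * m + y)))"
  by (simp add: norm2_def sum_pair_index)

lemma norm2_prodvec: "norm2 (n * m) (prodvec m u w) = norm2 n u * norm2 m w"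
  by (simp add: norm2_def sum_pair_index prodvec_def sum_product norm_mult power_mult_distrib)

lemma kron_assoc:
  assumes "A \<in> carrier_mat n1 m1" "B \<in> carrier_mat n2 m2" "C \<in> carrier_mat n3 m3"
  shows "kron (kron A B) C = kron A (kron B C)"
proof (rule kron_eqI[OF kron_carrier[OF kron_carrier[OF assms(1,2)] assms(3)]])
  show "kron A (kron B C) \<in> carrier_mat (n1 * n2 * n3) (m1 * m2 * m3)"
    using kron_carrier[OF assms(1) kron_carrier[OF assms(2,3)]] by (simp add: mult.assoc)
  fix i i' j j' assume l: "i < n1 * n2" "i' < n3" "j < m1 * m2" "j' < m3"
  obtain x y where x: "x < n1" "y < n2" "i = x * n2 + y" using l(1) by (rule pair_index_cases)
  obtain x' y' where x': "x' < m1" "y' < m2" "j = x' * m2 + y'" using l(3) by (rule pair_index_cases)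
  have r: "i * n3 + i' = x * (n2 * n3) + (y * n3 + i')" "j * m3 + j' = x' * (m2 * m3) + (y' * m3 + j')"
    by (simp_all add: x x' algebra_simps)
  have "kron (kron A B) C $$ (i * n3 + i', j * m3 + j') = A $$ (x, x') * B $$ (y, y') * C $$ (i', j')"
    unfolding kron_index[OF kron_carrier[OF assms(1,2)] assms(3) l(1,3,2,4)] unfolding x(3) x'(3)
      kron_index[OF assms(1,2) x(1) x'(1) x(2) x'(2)] ..
  also have "\<dots> = kron A (kron B C) $$ (i * n3 + i', j * m3 + j')"
    unfolding r kron_index[OF assms(1) kron_carrier[OF assms(2,3)] x(1) x'(1) pair_index_less[OF x(2) l(2)] pair_index_less[OF x'(2) l(4)]]
      kron_index[OF assms(2,3) x(2) x'(2) l(2,4)] by (simp add: mult.assoc)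
  finally show "kron (kron A B) C $$ (i * n3 + i', j * m3 + j') = kron A (kron B C) $$ (i * n3 + i', j * m3 + j')" .
qed

lemma mapply_kron_index:
  assumes "A \<in> carrier_mat n k" "B \<in> carrier_mat n' k'" "i < n" "i' < n'"
  shows "mapply (kron A B) z (i * n' + i') = (\<Sum>l<k. A $$ (i, l) * mapply B (\<lambda>l'. z (l * k' + l')) i')"
  using assms by (simp add: mapply_def sum_pair_index kron_index[OF assms(1,2)] sum_distrib_left mult.assoc)

lemma mapply_kron_prodvec:
  assumes "A \<in> carrier_mat n k" "B \<in> carrier_mat n' k'" "i < n * n'"
  shows "mapply (kron A B) (prodvec k' u w) i = prodvec n' (mapply A u) (mapply B w) i"
proof -
  obtain x y where i: "x < n" "y < n'" "i = x * n' + y" using assms(3) by (rule pair_index_cases)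
  have "mapply (kron A B) (prodvec k' u w) i = (\<Sum>l<k. A $$ (x, l) * (\<Sum>l'<k'. B $$ (y, l') * (u l * w l')))"
    unfolding i(3) mapply_kron_index[OF assms(1,2) i(1,2)] using assms by (simp add: mapply_def prodvec_def)
  also have "\<dots> = (\<Sum>l<k. A $$ (x, l) * u l) * (\<Sum>l'<k'. B $$ (y, l') * w l')"
    unfolding sum_product unfolding sum_distrib_left by (simp add: mult_ac)
  finally show ?thesis using assms i by (simp add: prodvec_def mapply_def)
qed

definition kron3 :: "complex mat \<Rightarrow> complex mat \<Rightarrow> complex mat \<Rightarrow> complex mat" where
  "kron3 A C B = kron (kron A C) B"

lemma kron3_carrier:
  "A \<in> carrier_mat a' a \<Longrightarrow> C \<in> carrier_mat c' c \<Longrightarrow> B \<in> carrier_mat b' b \<Longrightarrow> kron3 A C B \<in> carrier_mat (a' * c' * b') (a * c * b)"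
  unfolding kron3_def by (intro kron_carrier)

lemma kron3_index:
  assumes "A \<in> carrier_mat a' a" "C \<in> carrier_mat c' c" "B \<in> carrier_mat b' b"
    "x < a'" "y < c'" "w < b'" "p < a" "q < c" "r < b"
  shows "kron3 A C B $$ ((x * c' + y) * b' + w, (p * c + q) * b + r) = A $$ (x, p) * C $$ (y, q) * B $$ (w, r)"
  unfolding kron3_def
    kron_index[OF kron_carrier[OF assms(1,2)] assms(3) pair_index_less[OF assms(4,5)] pair_index_less[OF assms(7,8)] assms(6,9)]
    kron_index[OF assms(1,2,4,7,5,8)] ..

section \<open>Partial transposition of the middle system\<close>

definition mid_transpose :: "nat \<Rightarrow> nat \<Rightarrow> nat \<Rightarrow> complex mat \<Rightarrow> complex mat" where
  "mid_transpose a c b X = mat (a * c * b) (a * c * b)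
     (\<lambda>(i, j). X $$ ((i div b div c * c + j div b mod c) * b + i mod b, (j div b div c * c + i div b mod c) * b + j mod b))"

lemma mid_transpose_carrier [simp]: "mid_transpose a c b X \<in> carrier_mat (a * c * b) (a * c * b)"
  by (simp add: mid_transpose_def)

lemma mid_transpose_index:
  assumes "x < a" "y < c" "w < b" "x' < a" "y' < c" "w' < b"
  shows "mid_transpose a c b X $$ ((x * c + y) * b + w, (x' * c + y') * b + w') =
    X $$ ((x * c + y') * b + w, (x' * c + y) * b + w')"
  using assms by (simp add: mid_transpose_def pair_index_less)

lemma tri_eqI:
  assumes "X \<in> carrier_mat (a * c * b) (a * c * b)" "Y \<in> carrier_mat (a * c * b) (a * c * b)"
    "\<And>x y w x' y' w'. x < a \<Longrightarrow> y < c \<Longrightarrow> w < b \<Longrightarrow> x' < a \<Longrightarrow> y' < c \<Longrightarrow> w' < b \<Longrightarrow>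
      X $$ ((x * c + y) * b + w, (x' * c + y') * b + w') = Y $$ ((x * c + y) * b + w, (x' * c + y') * b + w')"
  shows "X = Y"
proof (rule kron_eqI[OF assms(1,2)])
  fix i i' j j' assume "i < a * c" "i' < b" "j < a * c" "j' < b"
  then show "X $$ (i * b + i', j * b + j') = Y $$ (i * b + i', j * b + j')"
    by (elim pair_index_cases) (simp add: assms(3))
qed

lemma mid_transpose_involution:
  assumes "X \<in> carrier_mat (a * c * b) (a * c * b)"
  shows "mid_transpose a c b (mid_transpose a c b X) = X"
  by (rule tri_eqI[OF mid_transpose_carrier assms]) (simp add: mid_transpose_index)

text \<open>After a partial transposition the two factors carry \<open>q\<close> and
  \<open>q'\<close> crosswise; renaming the summation indices restores a product of independent
  sums.\<close>

lemma sum_swap_middle: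
  fixes F G :: "nat \<Rightarrow> nat \<Rightarrow> nat \<Rightarrow> complex"
  shows "(\<Sum>p<a. \<Sum>q<c. \<Sum>r<b. \<Sum>p'<a. \<Sum>q'<c. \<Sum>r'<b. F p q' r * G p' q r') =
    (\<Sum>p<a. \<Sum>q<c. \<Sum>r<b. F p q r) * (\<Sum>p<a. \<Sum>q<c. \<Sum>r<b. G p q r)"
proof -
  have "(\<Sum>p<a. \<Sum>q<c. \<Sum>r<b. \<Sum>p'<a. \<Sum>q'<c. \<Sum>r'<b. F p q' r * G p' q r') =
    (\<Sum>p<a. \<Sum>q<c. \<Sum>r<b. \<Sum>p'<a. \<Sum>q'<c. \<Sum>r'<b. F p q r * G p' q' r')"
    unfolding sum.cartesian_product
    by (rule sum.reindex_bij_witness[where i = "\<lambda>(p, q, r, p', q', r'). (p, q', r, p', q, r')"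
      and j = "\<lambda>(p, q, r, p', q', r'). (p, q', r, p', q, r')"]) auto
  then show ?thesis unfolding sum_distrib_right unfolding sum_distrib_left .
qed

definition conj_mat :: "complex mat \<Rightarrow> complex mat" where
  "conj_mat A = map_mat cnj A"

lemma conj_mat_carrier [simp]: "A \<in> carrier_mat n m \<Longrightarrow> conj_mat A \<in> carrier_mat n m"
  by (simp add: conj_mat_def)

lemma conj_mat_index [simp]: "i < dim_row A \<Longrightarrow> j < dim_col A \<Longrightarrow> conj_mat A $$ (i, j) = cnj (A $$ (i, j))"
  by (simp add: conj_mat_def)

text \<open>Partial transposition moves the middle index of the conjugated vector to the left, where
  \<open>C\<close> acts on it. Applying \<open>C\<close> to conjugated entries is the same as
  conjugating after an application of the entrywise conjugate of \<open>C\<close>, so the result is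
  again a partially transposed outer product. This is how a protocol on transposed inputs becomes
  another protocol.\<close>

lemma conj_mid_transpose_outer:
  assumes A: "A \<in> carrier_mat a' a" and C: "C \<in> carrier_mat c' c" and B: "B \<in> carrier_mat b' b"
  shows "kron3 A C B * mid_transpose a c b (outer (a * c * b) z) * mat_adjoint (kron3 A C B) =
    mid_transpose a' c' b' (outer (a' * c' * b') (mapply (kron3 A (conj_mat C) B) z))"
proof (rule tri_eqI[OF conj_carrier[OF kron3_carrier[OF A C B] mid_transpose_carrier] mid_transpose_carrier])
  fix x y w x' y' w' assume l: "x < a'" "y < c'" "w < b'" "x' < a'" "y' < c'" "w' < b'"
  have C': "conj_mat C \<in> carrier_mat c' c" using C by simp
  have m: "mapply (kron3 A (conj_mat C) B) z ((u * c' + v) * b' + s) =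
      (\<Sum>p<a. \<Sum>q<c. \<Sum>r<b. A $$ (u, p) * cnj (C $$ (v, q)) * B $$ (s, r) * z ((p * c + q) * b + r))"
    if "u < a'" "v < c'" "s < b'" for u v s
    unfolding mapply_def using kron3_carrier[OF A C' B] C that
    by (simp add: sum_pair_index kron3_index[OF A C' B])
  have i: "(x * c' + y) * b' + w < a' * c' * b'" "(x' * c' + y') * b' + w' < a' * c' * b'"
    "(x * c' + y') * b' + w < a' * c' * b'" "(x' * c' + y) * b' + w' < a' * c' * b'"
    using l by (auto intro!: pair_index_less)
  have "(kron3 A C B * mid_transpose a c b (outer (a * c * b) z) * mat_adjoint (kron3 A C B)) $$
      ((x * c' + y) * b' + w, (x' * c' + y') * b' + w') =
    (\<Sum>p<a. \<Sum>q<c. \<Sum>r<b. \<Sum>p'<a. \<Sum>q'<c. \<Sum>r'<b.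
      (A $$ (x, p) * cnj (C $$ (y', q')) * B $$ (w, r) * z ((p * c + q') * b + r)) *
      cnj (A $$ (x', p') * cnj (C $$ (y, q)) * B $$ (w', r') * z ((p' * c + q) * b + r')))"
    unfolding index_sandwich[OF kron3_carrier[OF A C B] mid_transpose_carrier kron3_carrier[OF A C B] i(1,2)] sum_pair_index using l
    by (intro sum.cong refl) (simp add: kron3_index[OF A C B] mid_transpose_index pair_index_less; simp add: mult_ac)
  also have "\<dots> = mapply (kron3 A (conj_mat C) B) z ((x * c' + y') * b' + w) * cnj (mapply (kron3 A (conj_mat C) B) z ((x' * c' + y) * b' + w'))"
    unfolding m[OF l(1,5,3)] m[OF l(4,2,6)] cnj_sum by (rule sum_swap_middle)
  finally show "(kron3 A C B * mid_transpose a c b (outer (a * c * b) z) * mat_adjoint (kron3 A C B)) $$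
      ((x * c' + y) * b' + w, (x' * c' + y') * b' + w') =
    mid_transpose a' c' b' (outer (a' * c' * b') (mapply (kron3 A (conj_mat C) B) z)) $$
      ((x * c' + y) * b' + w, (x' * c' + y') * b' + w')"
    using l i by (simp add: mid_transpose_index)
qed

text \<open>A functional on operators of three systems that, after partial transposition of the middle one,
  is an effect that product vectors for the cut between the first and the other two systems pass with
  probability at most \<open>\<delta>\<close>.\<close>

fun test_functional :: "real \<Rightarrow> dims \<Rightarrow> (complex mat \<Rightarrow> complex) \<Rightarrow> bool" where
  "test_functional \<delta> (a, c, b) t \<longleftrightarrow> linear_functional (a * c * b) t \<and>
     (\<forall>z. Im (t (mid_transpose a c b (outer (a * c * b) z))) = 0 \<and>
        0 \<le> Re (t (mid_transpose a c b (outer (a * c * b) z))) \<and>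
        Re (t (mid_transpose a c b (outer (a * c * b) z))) \<le> norm2 (a * c * b) z) \<and>
     (\<forall>u w. Re (t (mid_transpose a c b (outer (a * c * b) (prodvec (c * b) u w)))) \<le> \<delta> * (norm2 a u * norm2 (c * b) w))"

text \<open>The completeness relation of the Kraus operators, read as an identity of quadratic forms
  at \<open>y\<close>.\<close>

lemma instrument_norm2:
  assumes "is_instrument d r s e K"
  shows "(\<Sum>x<r. \<Sum>l<s. norm2 (e x) (mapply (K x l) y)) = norm2 d y"
proof -
  have c: "K x l \<in> carrier_mat (e x) d" if "x < r" "l < s" for x l using assms that by (auto simp: is_instrument_def)
  have one: "(\<Sum>x<r. \<Sum>l<s. \<Sum>k<e x. cnj (K x l $$ (k, i)) * K x l $$ (k, j)) = (if i = j then 1 else 0)"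
    if ij: "i < d" "j < d" for i j
  proof -
    have "(if i = j then 1 else 0) = msum d ({..<r} \<times> {..<s}) (\<lambda>(x, l). mat_adjoint (K x l) * K x l) $$ (i, j)"
      using assms ij by (simp add: is_instrument_def)
    also have "\<dots> = (\<Sum>x<r. \<Sum>l<s. (mat_adjoint (K x l) * K x l) $$ (i, j))"
      using ij by (simp add: sum.cartesian_product split_def)
    also have "\<dots> = (\<Sum>x<r. \<Sum>l<s. \<Sum>k<e x. cnj (K x l $$ (k, i)) * K x l $$ (k, j))"
    proof (intro sum.cong refl)
      fix x l assume "x \<in> {..<r}" "l \<in> {..<s}"
      then have k: "K x l \<in> carrier_mat (e x) d" using c by auto
      show "(mat_adjoint (K x l) * K x l) $$ (i, j) = (\<Sum>k<e x. cnj (K x l $$ (k, i)) * K x l $$ (k, j))"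
        unfolding index_mult[OF adjoint_carrier[OF k] k ij] using k ij by (intro sum.cong) auto
    qed
    finally show ?thesis ..
  qed
  have "complex_of_real (norm2 (e x) (mapply (K x l) y)) =
      (\<Sum>i<d. \<Sum>j<d. (cnj (y i) * y j) * (\<Sum>k<e x. cnj (K x l $$ (k, i)) * K x l $$ (k, j)))"
    if "x < r" "l < s" for x l
  proof -
    have "complex_of_real (norm2 (e x) (mapply (K x l) y)) =
      (\<Sum>k<e x. \<Sum>i<d. \<Sum>j<d. (cnj (y i) * y j) * (cnj (K x l $$ (k, i)) * K x l $$ (k, j)))"
      unfolding norm2_def of_real_sum complex_norm_square using c[OF that]
      by (simp add: mapply_def sum_product mult_ac) (rule sum.cong[OF refl], rule sum.swap)
    also have "\<dots> = (\<Sum>i<d. \<Sum>k<e x. \<Sum>j<d. (cnj (y i) * y j) * (cnj (K x l $$ (k, i)) * K x l $$ (k, j)))"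
      by (rule sum.swap)
    also have "\<dots> = (\<Sum>i<d. \<Sum>j<d. \<Sum>k<e x. (cnj (y i) * y j) * (cnj (K x l $$ (k, i)) * K x l $$ (k, j)))"
      by (intro sum.cong refl sum.swap)
    finally show ?thesis by (simp add: sum_distrib_left)
  qed
  then have "complex_of_real (\<Sum>x<r. \<Sum>l<s. norm2 (e x) (mapply (K x l) y)) =
    (\<Sum>x<r. \<Sum>l<s. \<Sum>i<d. \<Sum>j<d. (cnj (y i) * y j) * (\<Sum>k<e x. cnj (K x l $$ (k, i)) * K x l $$ (k, j)))"
    unfolding of_real_sum by (intro sum.cong refl) simp
  also have "\<dots> = (\<Sum>i<d. \<Sum>j<d. \<Sum>x<r. \<Sum>l<s. (cnj (y i) * y j) * (\<Sum>k<e x. cnj (K x l $$ (k, i)) * K x l $$ (k, j)))"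
    by (rule sum_swap4)
  also have "\<dots> = (\<Sum>i<d. \<Sum>j<d. (cnj (y i) * y j) * (\<Sum>x<r. \<Sum>l<s. \<Sum>k<e x. cnj (K x l $$ (k, i)) * K x l $$ (k, j)))"
    by (simp only: sum_distrib_left)
  also have "\<dots> = (\<Sum>i<d. \<Sum>j<d. if j = i then cnj (y i) * y i else 0)"
    using one by (intro sum.cong refl) auto
  also have "\<dots> = (\<Sum>i<d. y i * cnj (y i))" by (intro sum.cong refl) simp
  also have "\<dots> = complex_of_real (norm2 d y)" unfolding norm2_def of_real_sum complex_norm_square ..
  finally show ?thesis by (simp only: of_real_eq_iff)
qed

text \<open>Conjugation can be moved from the operator to the vector without changing the norm;
  hence an instrument with conjugated Kraus operators still preserves the total squared
  norm.\<close>

lemma norm2_mapply_conj_mat: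
  assumes "K \<in> carrier_mat n d"
  shows "norm2 n (mapply (conj_mat K) y) = norm2 n (mapply K (\<lambda>j. cnj (y j)))"
proof -
  have "mapply (conj_mat K) y i = cnj (mapply K (\<lambda>j. cnj (y j)) i)" if "i < n" for i
    using assms that by (simp add: mapply_def conj_mat_def)
  then show ?thesis unfolding norm2_def by (intro sum.cong refl) (simp add: complex_mod_cnj)
qed

lemma mapply_kron3_index:
  assumes "A \<in> carrier_mat a' a" "C \<in> carrier_mat c' c" "B \<in> carrier_mat b' b" "x < a'" "y < c'" "w < b'"
  shows "mapply (kron3 A C B) z ((x * c' + y) * b' + w) =
    (\<Sum>p<a. A $$ (x, p) * (\<Sum>q<c. C $$ (y, q) * (\<Sum>r<b. B $$ (w, r) * z ((p * c + q) * b + r))))"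
proof -
  have "mapply (kron3 A C B) z ((x * c' + y) * b' + w) =
    (\<Sum>p<a. \<Sum>q<c. \<Sum>r<b. kron3 A C B $$ ((x * c' + y) * b' + w, (p * c + q) * b + r) * z ((p * c + q) * b + r))"
    unfolding mapply_def using kron3_carrier[OF assms(1-3)] by (simp add: sum_pair_index)
  also have "\<dots> = (\<Sum>p<a. \<Sum>q<c. \<Sum>r<b. A $$ (x, p) * C $$ (y, q) * B $$ (w, r) * z ((p * c + q) * b + r))"
    using assms by (intro sum.cong refl) (simp add: kron3_index[OF assms(1-3)])
  finally show ?thesis by (simp only: sum_distrib_left mult.assoc)
qed

lemma sum_one_mat: "y < d \<Longrightarrow> (\<Sum>q<d. 1\<^sub>m d $$ (y, q) * f q) = (f y :: complex)"
proof -
  assume y: "y < d"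
  have "(\<Sum>q<d. 1\<^sub>m d $$ (y, q) * f q) = (\<Sum>q<d. if q = y then f q else 0)"
    using y by (intro sum.cong) auto
  then show ?thesis using y by simp
qed

lemma norm2_tri: "norm2 (a * c * b) z = (\<Sum>x<a. \<Sum>y<c. \<Sum>w<b. (cmod (z ((x * c + y) * b + w)))\<^sup>2)"
  by (simp add: norm2_def sum_pair_index)

lemma embed_local_kron3:
  "embed_local p (a, c, b) L = kron3 (if p = Alice then L else 1\<^sub>m a) (if p = Charlie then L else 1\<^sub>m c) (if p = Bob then L else 1\<^sub>m b)"
  by (cases p) (auto simp: kron3_def)

text \<open>For fixed digits of the two idle parties the acting party sees an ordinary vector. The
  squared norm is the sum over these digits, and the single-party identity applies to each
  summand.\<close>

lemma norm2_embed_local: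
  assumes L: "\<And>x l. x < r \<Longrightarrow> l < s \<Longrightarrow> L x l \<in> carrier_mat (e x) (local_dim p (a, c, b))"
    and iso: "\<And>y. (\<Sum>x<(r::nat). \<Sum>l<(s::nat). norm2 (e x) (mapply (L x l) y)) = norm2 (local_dim p (a, c, b)) y"
  shows "(\<Sum>x<r. \<Sum>l<s. norm2 (total_dim (set_local_dim p (e x) (a, c, b))) (mapply (embed_local p (a, c, b) (L x l)) z)) = norm2 (a * c * b) z"
proof (cases p)
  case Alice
  have "norm2 (e x * c * b) (mapply (kron3 (L x l) (1\<^sub>m c) (1\<^sub>m b)) z) =
    (\<Sum>y<c. \<Sum>w<b. norm2 (e x) (mapply (L x l) (\<lambda>i. z ((i * c + y) * b + w))))" if "x < r" "l < s" for x l
  proof -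
    have K: "L x l \<in> carrier_mat (e x) a" using L[OF that] Alice by simp
    have "norm2 (e x * c * b) (mapply (kron3 (L x l) (1\<^sub>m c) (1\<^sub>m b)) z) =
      (\<Sum>i<e x. \<Sum>y<c. \<Sum>w<b. (cmod (mapply (L x l) (\<lambda>i. z ((i * c + y) * b + w)) i))\<^sup>2)"
      unfolding norm2_tri using K
      by (intro sum.cong refl) (simp add: mapply_kron3_index[OF K one_carrier_mat one_carrier_mat] sum_one_mat del: index_one_mat(1); simp add: mapply_def)
    also have "\<dots> = (\<Sum>y<c. \<Sum>i<e x. \<Sum>w<b. (cmod (mapply (L x l) (\<lambda>i. z ((i * c + y) * b + w)) i))\<^sup>2)"
      by (rule sum.swap)
    also have "\<dots> = (\<Sum>y<c. \<Sum>w<b. norm2 (e x) (mapply (L x l) (\<lambda>i. z ((i * c + y) * b + w))))"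
      unfolding norm2_def by (intro sum.cong refl sum.swap)
    finally show ?thesis .
  qed
  then have "(\<Sum>x<r. \<Sum>l<s. norm2 (e x * c * b) (mapply (kron3 (L x l) (1\<^sub>m c) (1\<^sub>m b)) z)) =
     (\<Sum>y<c. \<Sum>w<b. \<Sum>x<r. \<Sum>l<s. norm2 (e x) (mapply (L x l) (\<lambda>i. z ((i * c + y) * b + w))))"
    by (subst sum_swap4) (intro sum.cong refl, simp)
  also have "\<dots> = (\<Sum>y<c. \<Sum>w<b. \<Sum>i<a. (cmod (z ((i * c + y) * b + w)))\<^sup>2)"
    using iso Alice by (simp add: norm2_def)
  also have "\<dots> = (\<Sum>y<c. \<Sum>i<a. \<Sum>w<b. (cmod (z ((i * c + y) * b + w)))\<^sup>2)"
    by (intro sum.cong refl sum.swap)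
  also have "\<dots> = norm2 (a * c * b) z" unfolding norm2_tri by (rule sum.swap)
  finally show ?thesis using Alice by (simp add: kron3_def)
next
  case Charlie
  have "norm2 (a * e x * b) (mapply (kron3 (1\<^sub>m a) (L x l) (1\<^sub>m b)) z) =
    (\<Sum>i<a. \<Sum>w<b. norm2 (e x) (mapply (L x l) (\<lambda>y. z ((i * c + y) * b + w))))" if "x < r" "l < s" for x l
  proof -
    have K: "L x l \<in> carrier_mat (e x) c" using L[OF that] Charlie by simp
    have "norm2 (a * e x * b) (mapply (kron3 (1\<^sub>m a) (L x l) (1\<^sub>m b)) z) =
      (\<Sum>i<a. \<Sum>y<e x. \<Sum>w<b. (cmod (mapply (L x l) (\<lambda>y. z ((i * c + y) * b + w)) y))\<^sup>2)"
      unfolding norm2_tri using K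
      by (intro sum.cong refl) (simp add: mapply_kron3_index[OF one_carrier_mat K one_carrier_mat] sum_one_mat del: index_one_mat(1); simp add: mapply_def)
    also have "\<dots> = (\<Sum>i<a. \<Sum>w<b. norm2 (e x) (mapply (L x l) (\<lambda>y. z ((i * c + y) * b + w))))"
      unfolding norm2_def by (intro sum.cong refl sum.swap)
    finally show ?thesis .
  qed
  then have "(\<Sum>x<r. \<Sum>l<s. norm2 (a * e x * b) (mapply (kron3 (1\<^sub>m a) (L x l) (1\<^sub>m b)) z)) =
     (\<Sum>i<a. \<Sum>w<b. \<Sum>x<r. \<Sum>l<s. norm2 (e x) (mapply (L x l) (\<lambda>y. z ((i * c + y) * b + w))))"
    by (subst sum_swap4) (intro sum.cong refl, simp)
  also have "\<dots> = (\<Sum>i<a. \<Sum>w<b. \<Sum>y<c. (cmod (z ((i * c + y) * b + w)))\<^sup>2)"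
    using iso Charlie by (simp add: norm2_def)
  also have "\<dots> = norm2 (a * c * b) z" unfolding norm2_tri by (intro sum.cong refl sum.swap)
  finally show ?thesis using Charlie by (simp add: kron3_def)
next
  case Bob
  have "norm2 (a * c * e x) (mapply (kron3 (1\<^sub>m a) (1\<^sub>m c) (L x l)) z) =
    (\<Sum>i<a. \<Sum>y<c. norm2 (e x) (mapply (L x l) (\<lambda>w. z ((i * c + y) * b + w))))" if "x < r" "l < s" for x l
  proof -
    have K: "L x l \<in> carrier_mat (e x) b" using L[OF that] Bob by simp
    show ?thesis
      unfolding norm2_tri using K
      by (simp add: mapply_kron3_index[OF one_carrier_mat one_carrier_mat K] sum_one_mat norm2_def del: index_one_mat(1); simp add: mapply_def)
  qed
  then have "(\<Sum>x<r. \<Sum>l<s. norm2 (a * c * e x) (mapply (kron3 (1\<^sub>m a) (1\<^sub>m c) (L x l)) z)) =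
     (\<Sum>i<a. \<Sum>y<c. \<Sum>x<r. \<Sum>l<s. norm2 (e x) (mapply (L x l) (\<lambda>w. z ((i * c + y) * b + w))))"
    by (subst sum_swap4) (intro sum.cong refl, simp)
  also have "\<dots> = norm2 (a * c * b) z"
    unfolding norm2_tri using iso Bob by (simp add: norm2_def)
  finally show ?thesis using Bob by (simp add: kron3_def)
qed

text \<open>What becomes of a party's Kraus operator when it is moved past Charlie's partial
  transposition.\<close>

definition twist :: "party \<Rightarrow> complex mat \<Rightarrow> complex mat" where
  "twist p L = (if p = Charlie then conj_mat L else L)"

lemma twist_carrier [simp]: "L \<in> carrier_mat n m \<Longrightarrow> twist p L \<in> carrier_mat n m"
  by (simp add: twist_def)

lemma conj_mat_one: "conj_mat (1\<^sub>m c) = 1\<^sub>m c"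
  by (rule eq_matI) (auto simp: conj_mat_def)

lemma embed_local_carrier:
  assumes "L \<in> carrier_mat d (local_dim p (a, c, b))" "set_local_dim p d (a, c, b) = (a', c', b')"
  shows "embed_local p (a, c, b) L \<in> carrier_mat (a' * c' * b') (a * c * b)"
  using assms by (cases p) (auto intro!: kron_carrier)

lemma conj_mid_transpose_embed_local:
  assumes L: "L \<in> carrier_mat d (local_dim p (a, c, b))" and s: "set_local_dim p d (a, c, b) = (a', c', b')"
  shows "embed_local p (a, c, b) L * mid_transpose a c b (outer (a * c * b) z) * mat_adjoint (embed_local p (a, c, b) L) =
    mid_transpose a' c' b' (outer (a' * c' * b') (mapply (embed_local p (a, c, b) (twist p L)) z))"
proof -
  let ?A = "if p = Alice then L else 1\<^sub>m a" and ?C = "if p = Charlie then L else 1\<^sub>m c" and ?B = "if p = Bob then L else 1\<^sub>m b"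
  have c: "?A \<in> carrier_mat a' a" "?C \<in> carrier_mat c' c" "?B \<in> carrier_mat b' b"
    using assms by (cases p; auto)+
  have "embed_local p (a, c, b) (twist p L) = kron3 ?A (conj_mat ?C) ?B"
    unfolding embed_local_kron3 by (cases p) (auto simp: twist_def conj_mat_one)
  then show ?thesis using conj_mid_transpose_outer[OF c, of z] by (simp only: embed_local_kron3)
qed

text \<open>A local operator of any of the three parties is a tensor product for the cut between
  Alice and the other two, so it keeps product vectors for that cut.\<close>

lemma embed_local_prodvec:
  assumes L: "L \<in> carrier_mat d (local_dim p (a, c, b))" and s: "set_local_dim p d (a, c, b) = (a', c', b')"
  shows "\<exists>u' w'. \<forall>i<a' * c' * b'. mapply (embed_local p (a, c, b) L) (prodvec (c * b) u w) i = prodvec (c' * b') u' w' i"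
proof -
  let ?A = "if p = Alice then L else 1\<^sub>m a" and ?C = "if p = Charlie then L else 1\<^sub>m c" and ?B = "if p = Bob then L else 1\<^sub>m b"
  have c: "?A \<in> carrier_mat a' a" "?C \<in> carrier_mat c' c" "?B \<in> carrier_mat b' b"
    using assms by (cases p; auto)+
  have "embed_local p (a, c, b) L = kron ?A (kron ?C ?B)"
    unfolding embed_local_kron3 kron3_def by (rule kron_assoc[OF c])
  then show ?thesis
    using mapply_kron_prodvec[OF c(1) kron_carrier[OF c(2,3)]] by (metis mult.assoc)
qed

lemma locc_carrier:
  "locc ds ds' \<Lambda> \<Longrightarrow> X \<in> carrier_mat (total_dim ds) (total_dim ds) \<Longrightarrow> \<Lambda> X \<in> carrier_mat (total_dim ds') (total_dim ds')"
  by (induction arbitrary: X rule: locc.induct) auto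

text \<open>The values of the pulled-back functional are sums, over outcomes and Kraus operators, of
  values of the later test at transformed vectors whose squared norms add up to that of the input.
  Bounds proportional to the squared norm therefore survive a round with the same
  \<open>\<delta>\<close>, and product vectors remain product vectors.\<close>

theorem test_functional_locc:
  "locc ds ds' \<Lambda> \<Longrightarrow> test_functional \<delta> ds' t \<Longrightarrow> test_functional \<delta> ds (\<lambda>X. t (\<Lambda> X))"
proof (induction rule: locc.induct)
  case (locc_stop ds)
  then show ?case by simp
next
  case (locc_round p ds r s e K ds' \<Lambda>)
  obtain a c b where ds: "ds = (a, c, b)" by (cases ds)
  define D where "D = a * c * b"
  let ?E = "\<lambda>x l. embed_local p ds (K x l)" and ?E' = "\<lambda>x l. embed_local p ds (twist p (K x l))"
  define n where "n x = total_dim (set_local_dim p (e x) ds)" for x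
  have K: "K x l \<in> carrier_mat (e x) (local_dim p (a, c, b))" if "x < r" "l < s" for x l
    using locc_round.hyps(1) that by (auto simp: is_instrument_def ds)
  have lin_t: "linear_functional (total_dim ds') t"
    using locc_round.prems by (cases ds') auto
  have E: "?E x l \<in> carrier_mat (n x) D" if "x < r" "l < s" for x l
    using embed_local_carrier[OF K[OF that] prod_cases3[THEN iffD2]] unfolding D_def n_def ds
    by (cases "set_local_dim p (e x) (a, c, b)") (auto intro: embed_local_carrier[OF K[OF that]])
  have IH: "test_functional \<delta> (set_local_dim p (e x) ds) (\<lambda>X. t (\<Lambda> x X))" if "x < r" for x
    using locc_round.IH[OF that] locc_round.prems by simp
  have lin: "linear_functional (n x) (\<lambda>X. t (\<Lambda> x X))" if "x < r" for x
    using IH[OF that] unfolding n_def by (cases "set_local_dim p (e x) ds") auto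
  define T where "T X = t (msum (total_dim ds') {..<r} (\<lambda>x. \<Lambda> x (local_cp p ds (e x) s (K x) X)))" for X
  have T: "T X = (\<Sum>x<r. \<Sum>l<s. t (\<Lambda> x (?E x l * X * mat_adjoint (?E x l))))" if X: "X \<in> carrier_mat D D" for X
  proof -
    have "local_cp p ds (e x) s (K x) X \<in> carrier_mat (n x) (n x)" for x by (simp add: local_cp_def n_def)
    then have "T X = (\<Sum>x<r. t (\<Lambda> x (local_cp p ds (e x) s (K x) X)))"
      unfolding T_def by (intro linear_functional_msum[OF lin_t] locc_carrier[OF locc_round.hyps(2)]) (auto simp: n_def)
    also have "\<dots> = (\<Sum>x<r. \<Sum>l<s. t (\<Lambda> x (?E x l * X * mat_adjoint (?E x l))))"
      unfolding local_cp_def n_def[symmetric]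
    proof (intro sum.cong refl)
      fix x assume "x \<in> {..<r}"
      then have x: "x < r" by simp
      show "t (\<Lambda> x (msum (n x) {..<s} (\<lambda>l. ?E x l * X * mat_adjoint (?E x l)))) = (\<Sum>l<s. t (\<Lambda> x (?E x l * X * mat_adjoint (?E x l))))"
        by (rule linear_functional_msum[OF lin[OF x]]) (auto intro!: conj_carrier[OF E[OF x] X])
    qed
    finally show ?thesis .
  qed
  have linT: "linear_functional D T"
    by (rule linear_functional_cong[OF _ T])
      (intro linear_functional_sum finite_lessThan linear_functional_conj[OF lin E], auto)
  define \<tau> where "\<tau> x y = t (\<Lambda> x (case set_local_dim p (e x) ds of (a', c', b') \<Rightarrow> mid_transpose a' c' b' (outer (n x) y)))" for x y
  have \<tau>: "Im (\<tau> x y) = 0 \<and> 0 \<le> Re (\<tau> x y) \<and> Re (\<tau> x y) \<le> norm2 (n x) y" if "x < r" for x y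
    using IH[OF that] unfolding \<tau>_def n_def by (cases "set_local_dim p (e x) ds") auto
  \<comment> \<open>Here the transposition passes through the round: the Kraus operators reappear
    twisted inside partially transposed outer products, to which the induction hypothesis
    applies.\<close>
  have T\<tau>: "T (mid_transpose a c b (outer D z)) = (\<Sum>x<r. \<Sum>l<s. \<tau> x (mapply (?E' x l) z))" for z
  proof -
    have "t (\<Lambda> x (?E x l * mid_transpose a c b (outer D z) * mat_adjoint (?E x l))) = \<tau> x (mapply (?E' x l) z)"
      if "x < r" "l < s" for x l
      using conj_mid_transpose_embed_local[OF K[OF that], of _ _ _ z] unfolding \<tau>_def n_def D_def ds
      by (cases "set_local_dim p (e x) (a, c, b)") auto
    then show ?thesis by (subst T) (auto simp: D_def intro!: sum.cong)
  qed
  \<comment> \<open>Twisted instruments still preserve the total squared norm; this turns the bounds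
    for single outcomes into bounds for the whole round.\<close>
  have iso: "(\<Sum>x<r. \<Sum>l<s. norm2 (n x) (mapply (?E' x l) z)) = norm2 D z" for z
    unfolding n_def ds D_def
  proof (rule norm2_embed_local)
    fix y
    show "(\<Sum>x<r. \<Sum>l<s. norm2 (e x) (mapply (twist p (K x l)) y)) = norm2 (local_dim p (a, c, b)) y"
    proof (cases "p = Charlie")
      case True
      have "(\<Sum>x<r. \<Sum>l<s. norm2 (e x) (mapply (twist p (K x l)) y)) = (\<Sum>x<r. \<Sum>l<s. norm2 (e x) (mapply (K x l) (\<lambda>j. cnj (y j))))"
        using K True by (intro sum.cong refl) (auto simp: twist_def intro!: norm2_mapply_conj_mat)
      also have "\<dots> = norm2 (local_dim p (a, c, b)) y"
        unfolding instrument_norm2[OF locc_round.hyps(1)[unfolded ds]] by (simp add: norm2_def)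
      finally show ?thesis .
    next
      case False
      then show ?thesis using instrument_norm2[OF locc_round.hyps(1)[unfolded ds]] by (simp add: twist_def)
    qed
  qed (use K in auto)
  have prod: "Re (\<tau> x (mapply (?E' x l) (prodvec (c * b) u w))) \<le> \<delta> * norm2 (n x) (mapply (?E' x l) (prodvec (c * b) u w))"
    if "x < r" "l < s" for x l u w
  proof -
    note xl = that
    obtain a' c' b' where s: "set_local_dim p (e x) (a, c, b) = (a', c', b')" by (cases "set_local_dim p (e x) (a, c, b)")
    have nx: "n x = a' * c' * b'" by (simp add: n_def ds s)
    obtain u' w' where uw: "\<And>i. i < n x \<Longrightarrow> mapply (?E' x l) (prodvec (c * b) u w) i = prodvec (c' * b') u' w' i"
      using embed_local_prodvec[OF twist_carrier[OF K[OF xl]] s, of p u w] unfolding nx ds by blast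
    have "Re (\<tau> x (mapply (?E' x l) (prodvec (c * b) u w))) = Re (\<tau> x (prodvec (c' * b') u' w'))"
      unfolding \<tau>_def by (simp add: outer_cong[OF uw])
    also have "\<dots> \<le> \<delta> * (norm2 a' u' * norm2 (c' * b') w')"
      using IH[OF that(1)] unfolding \<tau>_def nx ds s by simp
    also have "\<dots> = \<delta> * norm2 (n x) (mapply (?E' x l) (prodvec (c * b) u w))"
    proof -
      have "norm2 (n x) (mapply (?E' x l) (prodvec (c * b) u w)) = norm2 (n x) (prodvec (c' * b') u' w')"
        by (rule norm2_cong[OF uw])
      then show ?thesis using norm2_prodvec[of a' "c' * b'" u' w'] by (simp add: nx mult.assoc)
    qed
    finally show ?thesis .
  qed
  have "test_functional \<delta> (a, c, b) T"
    unfolding test_functional.simps D_def[symmetric] T\<tau>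
  proof (intro conjI allI linT)
    fix z
    show "Im (\<Sum>x<r. \<Sum>l<s. \<tau> x (mapply (?E' x l) z)) = 0" using \<tau> by (simp add: sum.neutral)
    show "0 \<le> Re (\<Sum>x<r. \<Sum>l<s. \<tau> x (mapply (?E' x l) z))" using \<tau> by (auto intro!: sum_nonneg)
    show "Re (\<Sum>x<r. \<Sum>l<s. \<tau> x (mapply (?E' x l) z)) \<le> norm2 D z"
      unfolding iso[of z, symmetric] Re_sum using \<tau> by (intro sum_mono) auto
  next
    fix u w
    have "Re (\<Sum>x<r. \<Sum>l<s. \<tau> x (mapply (?E' x l) (prodvec (c * b) u w))) \<le>
      (\<Sum>x<r. \<Sum>l<s. \<delta> * norm2 (n x) (mapply (?E' x l) (prodvec (c * b) u w)))"
      unfolding Re_sum using prod by (intro sum_mono) auto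
    also have "\<dots> = \<delta> * (norm2 a u * norm2 (c * b) w)"
      unfolding sum_distrib_left[symmetric] iso unfolding D_def using norm2_prodvec[of a "c * b" u w] by (simp add: mult.assoc)
    finally show "Re (\<Sum>x<r. \<Sum>l<s. \<tau> x (mapply (?E' x l) (prodvec (c * b) u w))) \<le> \<delta> * (norm2 a u * norm2 (c * b) w)" .
  qed
  then show ?case unfolding T_def ds .
qed

section \<open>Testing for private states\<close>

lemma sqrt_norm2: "sqrt (norm2 d z) = L2_set (\<lambda>i. cmod (z i)) {..<d}"
  by (simp add: norm2_def L2_set_def)

lemma sqrt_norm2_sum_le: "sqrt (norm2 d (\<lambda>s. \<Sum>i<(n::nat). f i s)) \<le> (\<Sum>i<n. sqrt (norm2 d (f i)))"
proof (induction n)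
  case 0
  then show ?case by (simp add: norm2_def)
next
  case (Suc n)
  have "sqrt (norm2 d (\<lambda>s. \<Sum>i<Suc n. f i s)) \<le> L2_set (\<lambda>s. cmod (\<Sum>i<n. f i s) + cmod (f n s)) {..<d}"
    unfolding sqrt_norm2 by (intro L2_set_mono) (auto simp: norm_triangle_ineq)
  also have "\<dots> \<le> sqrt (norm2 d (\<lambda>s. \<Sum>i<n. f i s)) + sqrt (norm2 d (f n))"
    unfolding sqrt_norm2 by (rule L2_set_triangle_ineq)
  finally show ?case using Suc.IH by simp
qed

lemma cauchy_schwarz_sum:
  fixes f g :: "nat \<Rightarrow> real"
  assumes "\<And>i. i < n \<Longrightarrow> 0 \<le> f i" "\<And>i. i < n \<Longrightarrow> 0 \<le> g i"
  shows "(\<Sum>i<n. sqrt (f i) * sqrt (g i))\<^sup>2 \<le> (\<Sum>i<n. f i) * (\<Sum>i<n. g i)"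
proof -
  have "(\<Sum>i<n. sqrt (f i) * sqrt (g i)) = (\<Sum>i<n. \<bar>sqrt (f i)\<bar> * \<bar>sqrt (g i)\<bar>)"
    using assms by (intro sum.cong) auto
  also have "\<dots> \<le> L2_set (\<lambda>i. sqrt (f i)) {..<n} * L2_set (\<lambda>i. sqrt (g i)) {..<n}"
    by (rule L2_set_mult_ineq)
  also have "\<dots> = sqrt ((\<Sum>i<n. f i) * (\<Sum>i<n. g i))"
    using assms by (simp add: L2_set_def real_sqrt_mult)
  finally have "(\<Sum>i<n. sqrt (f i) * sqrt (g i))\<^sup>2 \<le> (sqrt ((\<Sum>i<n. f i) * (\<Sum>i<n. g i)))\<^sup>2"
    using assms by (intro power_mono) (auto intro!: sum_nonneg)
  also have "\<dots> = (\<Sum>i<n. f i) * (\<Sum>i<n. g i)"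
    using assms by (intro real_sqrt_pow2 mult_nonneg_nonneg sum_nonneg) auto
  finally show ?thesis .
qed

text \<open>Triangle inequality for the sum, then Cauchy-Schwarz over \<open>i\<close>. The factors
  \<open>g\<close> and \<open>h\<close> are kept apart because the bound is applied with
  \<open>h = 1\<close> as well as with the two sides of a product vector.\<close>

lemma norm2_sum_product_le:
  assumes "\<And>i. i < n \<Longrightarrow> norm2 d (f i) = g i * h i" "\<And>i. i < n \<Longrightarrow> 0 \<le> g i" "\<And>i. i < n \<Longrightarrow> 0 \<le> h i"
  shows "norm2 d (\<lambda>s. \<Sum>i<(n::nat). f i s) \<le> (\<Sum>i<n. g i) * (\<Sum>i<n. h i)"
proof -
  have "norm2 d (\<lambda>s. \<Sum>i<n. f i s) = (sqrt (norm2 d (\<lambda>s. \<Sum>i<n. f i s)))\<^sup>2" by simp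
  also have "\<dots> \<le> (\<Sum>i<n. sqrt (norm2 d (f i)))\<^sup>2"
    by (intro power_mono sqrt_norm2_sum_le) simp
  also have "(\<Sum>i<n. sqrt (norm2 d (f i))) = (\<Sum>i<n. sqrt (g i) * sqrt (h i))"
    using assms by (intro sum.cong) (auto simp: real_sqrt_mult)
  also have "\<dots>\<^sup>2 \<le> (\<Sum>i<n. g i) * (\<Sum>i<n. h i)" using assms by (intro cauchy_schwarz_sum) auto
  finally show ?thesis .
qed

lemma cmod_inner_le: "cmod (\<Sum>s<d. p s * cnj (q s)) \<le> sqrt (norm2 d p) * sqrt (norm2 d q)"
proof -
  have "cmod (\<Sum>s<d. p s * cnj (q s)) \<le> (\<Sum>s<d. \<bar>cmod (p s)\<bar> * \<bar>cmod (q s)\<bar>)"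
    by (rule order_trans[OF norm_sum]) (simp add: norm_mult)
  also have "\<dots> \<le> sqrt (norm2 d p) * sqrt (norm2 d q)"
    unfolding sqrt_norm2 by (rule L2_set_mult_ineq)
  finally show ?thesis .
qed

section \<open>Contractions and the trace norm\<close>

definition contraction :: "nat \<Rightarrow> nat \<Rightarrow> complex mat \<Rightarrow> bool" where
  "contraction s n T \<longleftrightarrow> T \<in> carrier_mat s n \<and> (\<forall>y. norm2 s (mapply T y) \<le> norm2 n y)"

lemma mapply_col:
  assumes "A \<in> carrier_mat n k" "B \<in> carrier_mat k m" "i < n" "j < m"
  shows "(A * B) $$ (i, j) = mapply A (\<lambda>l. B $$ (l, j)) i"
  using assms index_mult[OF assms] by (simp add: mapply_def)

text \<open>In an eigenbasis \<open>v i\<close> of \<open>mat_adjoint X * X\<close> the trace is the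
  sum of the inner products of \<open>T X v i\<close> with \<open>T v i\<close>. Cauchy-Schwarz and
  contractivity bound each of them by the norm of \<open>X v i\<close>, and these norms are the
  singular values that add up to the trace norm.\<close>

theorem trace_norm_ge:
  assumes X: "X \<in> carrier_mat n n" and T: "contraction s n T"
  shows "cmod (mtrace (T * X * mat_adjoint T)) \<le> trace_norm X"
proof -
  have Tc: "T \<in> carrier_mat s n" using T by (simp add: contraction_def)
  have "is_hermitian n (1\<^sub>m n)" by (rule is_hermitianI) auto
  from hermitian_conj[OF this X] have "is_hermitian n (mat_adjoint X * X)"
    using X by (simp add: right_mult_one_mat[of _ n n])
  then obtain V d where D: "diagonalizes n V d (mat_adjoint X * X)" using hermitian_diagonalizable by blast
  have V: "is_unitary n V" by (rule diagonalizes_unitary[OF D])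
  have Vc: "V \<in> carrier_mat n n" "V * mat_adjoint V = 1\<^sub>m n" using V by (auto simp: is_unitary_def)
  define v where "v i = (\<lambda>k. V $$ (k, i))" for i
  have XVc: "X * V \<in> carrier_mat n n" using X Vc by simp
  have di: "norm2 n (mapply X (v i)) = d i" if i: "i < n" for i
  proof -
    have "mat_adjoint (X * V) * (X * V) = mat_adjoint V * ((mat_adjoint X * X) * V)"
      using X Vc(1) by (simp add: adjoint_mult[of _ n n _ n] assoc_mult_mat[of _ n n _ n _ n] mult_carrier_mat[of _ n n _ n])
    also have "\<dots> = real_diag n d"
      unfolding diagonalizes_mult_unitary[OF D] using V Vc(1)
      by (simp add: is_unitary_def assoc_mult_mat[of _ n n _ n _ n, symmetric] left_mult_one_mat[of _ n n])
    finally have "(mat_adjoint (X * V) * (X * V)) $$ (i, i) = complex_of_real (d i)" using i by (simp add: mat_diag_def)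
    moreover have "(mat_adjoint (X * V) * (X * V)) $$ (i, i) = (\<Sum>k<n. cnj ((X * V) $$ (k, i)) * (X * V) $$ (k, i))"
      unfolding index_mult[OF adjoint_carrier[OF XVc] XVc i i] using X Vc i by (intro sum.cong refl) (simp del: index_mult_mat(1))
    moreover have "\<dots> = complex_of_real (norm2 n (mapply X (v i)))"
      unfolding norm2_def of_real_sum complex_norm_square v_def using i
      by (intro sum.cong refl) (simp add: mapply_col[OF X Vc(1)] mult.commute del: index_mult_mat(1))
    ultimately show ?thesis by (simp only: of_real_eq_iff)
  qed
  have tn: "trace_norm X = (\<Sum>i<n. sqrt (d i))"
  proof -
    have "diagonalizes n V (\<lambda>i. sqrt (d i)) (spectral_fun sqrt (mat_adjoint X * X))"
      unfolding diagonalizes_def using V spectral_fun_eq[OF D, of sqrt] by simp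
    then show ?thesis unfolding trace_norm_def by (simp add: mtrace_diagonalizes)
  qed
  have TXV: "T * (X * V) \<in> carrier_mat s n" and TV: "T * V \<in> carrier_mat s n" using Tc XVc Vc by auto
  have "T * X * mat_adjoint T = (T * (X * V)) * mat_adjoint (T * V)"
  proof -
    have "(T * (X * V)) * mat_adjoint (T * V) = T * X * (V * mat_adjoint V) * mat_adjoint T"
      using Tc X Vc(1) by (simp add: adjoint_mult[of T s n V n] assoc_mult_mat[of _ s n _ n _ n] assoc_mult_mat[of _ s n _ n _ s]
        assoc_mult_mat[of _ n n _ n _ s] assoc_mult_mat[of _ n n _ n _ n] mult_carrier_mat[of _ n n _ n] mult_carrier_mat[of _ s n _ n] mult_carrier_mat[of _ n n _ s])
    then show ?thesis using Tc X by (simp add: Vc(2) right_mult_one_mat[of _ s n] mult_carrier_mat[of _ s n _ n])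
  qed
  then have "mtrace (T * X * mat_adjoint T) = (\<Sum>a<s. \<Sum>i<n. (T * (X * V)) $$ (a, i) * cnj ((T * V) $$ (a, i)))"
    unfolding mtrace_def using TXV TV Tc Vc(1)
    by (auto intro!: sum.cong simp: index_mult[OF TXV adjoint_carrier[OF TV]] simp del: index_mult_mat(1))
  also have "\<dots> = (\<Sum>i<n. \<Sum>a<s. mapply T (mapply X (v i)) a * cnj (mapply T (v i) a))"
  proof (subst sum.swap, intro sum.cong refl)
    fix i a assume "i \<in> {..<n}" "a \<in> {..<s}"
    then have ia: "i < n" "a < s" by auto
    have "mapply T (\<lambda>k. (X * V) $$ (k, i)) a = mapply T (mapply X (v i)) a"
      unfolding mapply_def[of T] using Tc ia by (intro sum.cong refl) (simp add: mapply_col[OF X Vc(1)] v_def del: index_mult_mat(1))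
    then show "(T * (X * V)) $$ (a, i) * cnj ((T * V) $$ (a, i)) = mapply T (mapply X (v i)) a * cnj (mapply T (v i) a)"
      unfolding mapply_col[OF Tc XVc ia(2,1)] mapply_col[OF Tc Vc(1) ia(2,1)] by (simp add: v_def)
  qed
  finally have "cmod (mtrace (T * X * mat_adjoint T)) \<le>
      (\<Sum>i<n. sqrt (norm2 s (mapply T (mapply X (v i)))) * sqrt (norm2 s (mapply T (v i))))"
    by (simp only:) (intro order_trans[OF norm_sum] sum_mono cmod_inner_le)
  also have "\<dots> \<le> (\<Sum>i<n. sqrt (d i) * 1)"
  proof (intro sum_mono mult_mono)
    fix i assume "i \<in> {..<n}"
    then have i: "i < n" by simp
    have "norm2 n (v i) = 1" unfolding norm2_def v_def by (rule unitary_col_norm[OF V i])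
    then show "sqrt (norm2 s (mapply T (v i))) \<le> 1" using T by (metis contraction_def real_sqrt_le_1_iff)
    show "sqrt (norm2 s (mapply T (mapply X (v i)))) \<le> sqrt (d i)"
      using T di[OF i] by (metis contraction_def real_sqrt_le_iff)
    show "0 \<le> sqrt (d i)" using di[OF i] norm2_nonneg[of n "mapply X (v i)"] by simp
  qed simp
  finally show ?thesis by (simp add: tn)
qed

section \<open>Untwisting private states\<close>

context
  fixes M sA sB :: nat and U :: "nat \<Rightarrow> complex mat"
  assumes U: "\<And>i. i < M \<Longrightarrow> is_unitary (sA * sB) (U i)" and M: "0 < M"
begin

text \<open>The coisometry that undoes the twisting and projects the key onto the maximally entangled state;
  it maps the private state back to its shield.\<close>

definition untwist :: "complex mat" where
  "untwist = mat (sA * sB) (M * sA * (M * sB)) (\<lambda>(s, v).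
     if v div (M * sB) div sA = v mod (M * sB) div sB
     then cnj (U (v div (M * sB) div sA) $$ (v div (M * sB) mod sA * sB + v mod (M * sB) mod sB, s)) / complex_of_real (sqrt (real M))
     else 0)"

lemma untwist_carrier: "untwist \<in> carrier_mat (sA * sB) (M * sA * (M * sB))"
  by (simp add: untwist_def)

lemma untwist_index:
  assumes "s < sA * sB" "i < M" "x < sA" "j < M" "y < sB"
  shows "untwist $$ (s, (i * sA + x) * (M * sB) + (j * sB + y)) =
    (if i = j then cnj (U i $$ (x * sB + y, s)) / complex_of_real (sqrt (real M)) else 0)"
  using assms by (simp add: untwist_def pair_index_less)

lemma sum_key_shield:
  fixes f :: "nat \<Rightarrow> 'a::comm_monoid_add"
  shows "(\<Sum>v<M * sA * (M * sB). f v) = (\<Sum>i<M. \<Sum>x<sA. \<Sum>j<M. \<Sum>y<sB. f ((i * sA + x) * (M * sB) + (j * sB + y)))"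
  by (simp add: sum_pair_index)

lemma sum_diagonal:
  fixes f :: "nat \<Rightarrow> nat \<Rightarrow> nat \<Rightarrow> nat \<Rightarrow> 'a::comm_monoid_add"
  shows "(\<Sum>i<M. \<Sum>x<sA. \<Sum>j<M. \<Sum>y<sB. if i = j then f i x j y else 0) = (\<Sum>i<M. \<Sum>x<sA. \<Sum>y<sB. f i x i y)"
proof -
  have "(\<Sum>j<M. \<Sum>y<sB. if i = j then f i x j y else 0) = (\<Sum>y<sB. f i x i y)" if "i < M" for i x
  proof -
    have "(\<Sum>j<M. \<Sum>y<sB. if i = j then f i x j y else 0) = (\<Sum>j<M. if i = j then \<Sum>y<sB. f i x j y else 0)"
      by (intro sum.cong) auto
    then show ?thesis using that by simp
  qed
  then show ?thesis by simp
qed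

lemma mapply_untwist:
  assumes "s < sA * sB"
  shows "mapply untwist y s = (\<Sum>i<M. \<Sum>v<sA * sB. cnj (U i $$ (v, s)) * y ((i * sA + v div sB) * (M * sB) + (i * sB + v mod sB))) / complex_of_real (sqrt (real M))"
proof -
  have "mapply untwist y s = (\<Sum>i<M. \<Sum>x<sA. \<Sum>j<M. \<Sum>z<sB. if i = j then
      cnj (U i $$ (x * sB + z, s)) * y ((i * sA + x) * (M * sB) + (j * sB + z)) / complex_of_real (sqrt (real M)) else 0)"
    unfolding mapply_def using untwist_carrier assms
    by (simp add: sum_key_shield untwist_index if_distrib[of "\<lambda>x. x * _"] cong: if_cong)
  then show ?thesis unfolding sum_diagonal by (simp add: sum_pair_index sum_divide_distrib)
qed

text \<open>Only the \<open>M\<close> blocks with equal key values contribute, and each is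
  transformed by a unitary that preserves its norm. The normalisation \<open>1 / sqrt M\<close>,
  squared, gives the divisor.\<close>

lemma norm2_untwist_le:
  assumes g: "\<And>i. i < M \<Longrightarrow> norm2 (sA * sB) (\<lambda>v. y ((i * sA + v div sB) * (M * sB) + (i * sB + v mod sB))) = g i * h i"
    and nonneg: "\<And>i. i < M \<Longrightarrow> 0 \<le> g i" "\<And>i. i < M \<Longrightarrow> 0 \<le> h i"
  shows "norm2 (sA * sB) (mapply untwist y) \<le> (\<Sum>i<M. g i) * (\<Sum>i<M. h i) / real M"
proof -
  let ?f = "\<lambda>i s. \<Sum>v<sA * sB. cnj (U i $$ (v, s)) * y ((i * sA + v div sB) * (M * sB) + (i * sB + v mod sB))"
  have "norm2 (sA * sB) (mapply untwist y) = norm2 (sA * sB) (\<lambda>s. (\<Sum>i<M. ?f i s) / complex_of_real (sqrt (real M)))"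
    by (rule norm2_cong) (rule mapply_untwist)
  also have "\<dots> = norm2 (sA * sB) (\<lambda>s. \<Sum>i<M. ?f i s) / real M"
    unfolding norm2_def norm_divide power_divide sum_divide_distrib[symmetric] by simp
  also have "\<dots> \<le> (\<Sum>i<M. g i) * (\<Sum>i<M. h i) / real M"
    using g nonneg norm2_unitary[OF U] by (intro divide_right_mono norm2_sum_product_le) auto
  finally show ?thesis .
qed

lemma untwist_contraction: "contraction (sA * sB) (M * sA * (M * sB)) untwist"
  unfolding contraction_def
proof (intro conjI allI untwist_carrier)
  fix y
  let ?n = "\<lambda>i. norm2 (sA * sB) (\<lambda>v. y ((i * sA + v div sB) * (M * sB) + (i * sB + v mod sB)))"
  \<comment> \<open>With \<open>h = 1\<close> the second sum is \<open>M\<close> and cancels the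
    divisor.\<close>
  have "norm2 (sA * sB) (mapply untwist y) \<le> (\<Sum>i<M. ?n i) * (\<Sum>i<M. 1) / real M"
    by (rule norm2_untwist_le) auto
  also have "\<dots> = (\<Sum>i<M. ?n i)" using M by simp
  also have "\<dots> = (\<Sum>i<M. \<Sum>x<sA. \<Sum>z<sB. (cmod (y ((i * sA + x) * (M * sB) + (i * sB + z))))\<^sup>2)"
    by (simp add: norm2_def sum_pair_index)
  also have "\<dots> = (\<Sum>i<M. \<Sum>x<sA. \<Sum>j<M. \<Sum>z<sB. if i = j then (cmod (y ((i * sA + x) * (M * sB) + (j * sB + z))))\<^sup>2 else 0)"
    by (rule sum_diagonal[symmetric])
  also have "\<dots> \<le> norm2 (M * sA * (M * sB)) y"
    unfolding norm2_def sum_key_shield by (intro sum_mono) auto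
  finally show "norm2 (sA * sB) (mapply untwist y) \<le> norm2 (M * sA * (M * sB)) y" .
qed

text \<open>The overlap of a product vector with a maximally entangled key of dimension
  \<open>M\<close> is at most \<open>1 / M\<close>, whatever the twisting: each block of equal key
  values factorises, and Cauchy-Schwarz over the key value leaves the full norms of \<open>u\<close>
  and \<open>w\<close>.\<close>

lemma norm2_untwist_prodvec_le:
  "norm2 (sA * sB) (mapply untwist (prodvec (M * sB) u w)) \<le> norm2 (M * sA) u * norm2 (M * sB) w / real M"
proof -
  have "norm2 (sA * sB) (mapply untwist (prodvec (M * sB) u w)) \<le>
    (\<Sum>i<M. norm2 sA (\<lambda>x. u (i * sA + x))) * (\<Sum>i<M. norm2 sB (\<lambda>y. w (i * sB + y))) / real M"
  proof (rule norm2_untwist_le)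
    fix i assume i: "i < M"
    have "norm2 (sA * sB) (\<lambda>v. prodvec (M * sB) u w ((i * sA + v div sB) * (M * sB) + (i * sB + v mod sB))) =
      norm2 (sA * sB) (prodvec sB (\<lambda>x. u (i * sA + x)) (\<lambda>y. w (i * sB + y)))"
      using i by (intro norm2_cong) (auto simp: prodvec_def pair_index_less mod_index_less)
    then show "norm2 (sA * sB) (\<lambda>v. prodvec (M * sB) u w ((i * sA + v div sB) * (M * sB) + (i * sB + v mod sB))) =
      norm2 sA (\<lambda>x. u (i * sA + x)) * norm2 sB (\<lambda>y. w (i * sB + y))"
      by (simp only: norm2_prodvec)
  qed auto
  then show ?thesis by (simp only: norm2_pair)
qed

lemma untwist_coisometry: "untwist * mat_adjoint untwist = 1\<^sub>m (sA * sB)"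
proof (rule eq_matI)
  fix s s' assume "s < dim_row (1\<^sub>m (sA * sB) :: complex mat)" "s' < dim_col (1\<^sub>m (sA * sB) :: complex mat)"
  then have s: "s < sA * sB" "s' < sA * sB" by auto
  have r: "complex_of_real (sqrt (real M)) * complex_of_real (sqrt (real M)) = of_nat M"
    by (simp flip: of_real_mult)
  have "(untwist * mat_adjoint untwist) $$ (s, s') = (\<Sum>v<M * sA * (M * sB). untwist $$ (s, v) * cnj (untwist $$ (s', v)))"
    unfolding index_mult[OF untwist_carrier adjoint_carrier[OF untwist_carrier] s]
    using untwist_carrier s by (intro sum.cong refl) simp
  also have "\<dots> = (\<Sum>i<M. \<Sum>x<sA. \<Sum>j<M. \<Sum>y<sB. if i = j then
      cnj (U i $$ (x * sB + y, s)) * U i $$ (x * sB + y, s') / of_nat M else 0)"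
    unfolding sum_key_shield r[symmetric] using s by (intro sum.cong refl) (simp add: untwist_index)
  also have "\<dots> = (\<Sum>i<M. (\<Sum>v<sA * sB. cnj (U i $$ (v, s)) * U i $$ (v, s')) / of_nat M)"
    unfolding sum_diagonal by (simp add: sum_pair_index sum_divide_distrib)
  also have "\<dots> = (\<Sum>i<M. (if s = s' then 1 else 0) / of_nat M)"
    using is_unitary_cols[OF U s] by (intro sum.cong refl) simp
  also have "\<dots> = 1\<^sub>m (sA * sB) $$ (s, s')" using s M by simp
  finally show "(untwist * mat_adjoint untwist) $$ (s, s') = 1\<^sub>m (sA * sB) $$ (s, s')" .
qed (use untwist_carrier in auto)

text \<open>Both sides vanish unless Alice's and Bob's key values agree in the row and in the
  column. There the two factors \<open>1 / sqrt M\<close> combine to \<open>1 / M\<close> and the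
  rest is the twisted shield.\<close>

lemma private_state_untwist:
  assumes \<sigma>: "\<sigma> \<in> carrier_mat (sA * sB) (sA * sB)"
  shows "swap_middle M M sA sB ((1 / of_nat M) \<cdot>\<^sub>m msum (M * M * (sA * sB)) ({..<M} \<times> {..<M})
     (\<lambda>(i, j). kron (ketbra (M * M) (i * M + i) (j * M + j)) (U i * \<sigma> * mat_adjoint (U j)))) =
    mat_adjoint untwist * \<sigma> * untwist" (is "?L = ?R")
proof (rule kron_eqI[of _ "M * sA" "M * sB" "M * sA" "M * sB"])
  have d: "M * M * sA * sB = M * sA * (M * sB)" by simp
  show "?L \<in> carrier_mat (M * sA * (M * sB)) (M * sA * (M * sB))"
    unfolding swap_middle_permute d by simp
  show "?R \<in> carrier_mat (M * sA * (M * sB)) (M * sA * (M * sB))"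
    by (intro mult_carrier_mat[of _ _ "sA * sB"] adjoint_carrier untwist_carrier \<sigma>)
  fix v w v' w' assume l: "v < M * sA" "w < M * sB" "v' < M * sA" "w' < M * sB"
  obtain i x where v: "i < M" "x < sA" "v = i * sA + x" using l(1) by (rule pair_index_cases)
  obtain j y where w: "j < M" "y < sB" "w = j * sB + y" using l(2) by (rule pair_index_cases)
  obtain i' x' where v': "i' < M" "x' < sA" "v' = i' * sA + x'" using l(3) by (rule pair_index_cases)
  obtain j' y' where w': "j' < M" "y' < sB" "w' = j' * sB + y'" using l(4) by (rule pair_index_cases)
  have Uc: "U k \<in> carrier_mat (sA * sB) (sA * sB)" if "k < M" for k using U[OF that] by (simp add: is_unitary_def)
  have kc: "U k * \<sigma> * mat_adjoint (U l) \<in> carrier_mat (sA * sB) (sA * sB)" if "k < M" "l < M" for k l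
    using Uc that \<sigma> by (intro mult_carrier_mat[of _ _ "sA * sB"] adjoint_carrier) auto
  have xy: "x * sB + y < sA * sB" "x' * sB + y' < sA * sB" using v w v' w' by (auto intro: pair_index_less)
  have ij: "i * M + j < M * M" "i' * M + j' < M * M" using v w v' w' by (auto intro: pair_index_less)
  have ii: "k * M + k < M * M" if "k < M" for k using that by (rule pair_index_less) (use that in auto)
  have eq: "p * M + q = k * M + k \<longleftrightarrow> p = k \<and> q = k" if "q < M" "k < M" for p q k
    using that by (metis pair_index)
  let ?I = "(i * M + j) * (sA * sB) + (x * sB + y)" and ?J = "(i' * M + j') * (sA * sB) + (x' * sB + y')"
  have IJ: "?I < M * M * (sA * sB)" "?J < M * M * (sA * sB)" using ij xy by (auto intro: pair_index_less)
  have idx: "v * (M * sB) + w = ((i * sA + x) * M + j) * sB + y" "v' * (M * sB) + w' = ((i' * sA + x') * M + j') * sB + y'"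
    by (simp_all add: v w v' w' algebra_simps)
  have idx2: "((i * M + j) * sA + x) * sB + y = ?I" "((i' * M + j') * sA + x') * sB + y' = ?J" by (simp_all add: algebra_simps)
  have t: "kron (ketbra (M * M) (k * M + k) (l * M + l)) (U k * \<sigma> * mat_adjoint (U l)) $$ (?I, ?J) =
    (if k = i then if l = i' then if i = j \<and> i' = j' then (U i * \<sigma> * mat_adjoint (U i')) $$ (x * sB + y, x' * sB + y') else 0 else 0 else 0)"
    if kl: "k < M" "l < M" for k l
  proof -
    have kb: "ketbra (M * M) (k * M + k) (l * M + l) \<in> carrier_mat (M * M) (M * M)" by (simp add: ketbra_def)
    show ?thesis
      unfolding kron_index[OF kb kc[OF kl] ij xy] using ij eq[OF w(1) kl(1)] eq[OF w'(1) kl(2)]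
      by (auto simp: ketbra_def simp del: index_mult_mat(1))
  qed
  have "?L $$ (v * (M * sB) + w, v' * (M * sB) + w') =
    (1 / of_nat M) * (\<Sum>k<M. \<Sum>l<M. kron (ketbra (M * M) (k * M + k) (l * M + l)) (U k * \<sigma> * mat_adjoint (U l)) $$ (?I, ?J))"
    unfolding idx swap_middle_index_eq[OF v(1) w(1) v(2) w(2) v'(1) w'(1) v'(2) w'(2)] unfolding idx2
    using IJ by (simp add: sum.cartesian_product split_def carrier_matD[OF msum_carrier])
  also have "(\<Sum>k<M. \<Sum>l<M. kron (ketbra (M * M) (k * M + k) (l * M + l)) (U k * \<sigma> * mat_adjoint (U l)) $$ (?I, ?J)) =
     (\<Sum>k<M. \<Sum>l<M. if k = i then if l = i' then if i = j \<and> i' = j' then (U i * \<sigma> * mat_adjoint (U i')) $$ (x * sB + y, x' * sB + y') else 0 else 0 else 0)"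
    by (intro sum.cong refl) (simp add: t del: index_mult_mat(1))
  also have "\<dots> = (\<Sum>k<M. if k = i then \<Sum>l<M. if l = i' then if i = j \<and> i' = j' then (U i * \<sigma> * mat_adjoint (U i')) $$ (x * sB + y, x' * sB + y') else 0 else 0 else 0)"
    by (intro sum.cong refl) auto
  also have "\<dots> = (if i = j \<and> i' = j' then (U i * \<sigma> * mat_adjoint (U i')) $$ (x * sB + y, x' * sB + y') else 0)"
    using v(1) v'(1) by (simp del: index_mult_mat(1))
  finally have L: "?L $$ (v * (M * sB) + w, v' * (M * sB) + w') =
    (1 / of_nat M) * (if i = j \<and> i' = j' then (U i * \<sigma> * mat_adjoint (U i')) $$ (x * sB + y, x' * sB + y') else 0)" .
  have vw: "v * (M * sB) + w < M * sA * (M * sB)" "v' * (M * sB) + w' < M * sA * (M * sB)" using l by (auto intro: pair_index_less)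
  have r: "complex_of_real (sqrt (real M)) * complex_of_real (sqrt (real M)) = of_nat M"
    by (simp flip: of_real_mult)
  have "?R = mat_adjoint untwist * \<sigma> * mat_adjoint (mat_adjoint untwist)" by simp
  then have "?R $$ (v * (M * sB) + w, v' * (M * sB) + w') =
    (\<Sum>k<sA * sB. \<Sum>l<sA * sB. mat_adjoint untwist $$ (v * (M * sB) + w, k) * \<sigma> $$ (k, l) * cnj (mat_adjoint untwist $$ (v' * (M * sB) + w', l)))"
    using index_sandwich[OF adjoint_carrier[OF untwist_carrier] \<sigma> adjoint_carrier[OF untwist_carrier] vw] by simp
  also have "\<dots> = (\<Sum>k<sA * sB. \<Sum>l<sA * sB. (1 / of_nat M) * (if i = j \<and> i' = j' then
     U i $$ (x * sB + y, k) * \<sigma> $$ (k, l) * cnj (U i' $$ (x' * sB + y', l)) else 0))"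
    unfolding r[symmetric] using vw untwist_carrier v w v' w'
    by (intro sum.cong refl) (auto simp: untwist_index)
  also have "\<dots> = (1 / of_nat M) * (if i = j \<and> i' = j' then (U i * \<sigma> * mat_adjoint (U i')) $$ (x * sB + y, x' * sB + y') else 0)"
    unfolding index_sandwich[OF Uc[OF v(1)] \<sigma> Uc[OF v'(1)] xy]
    by (cases "i = j \<and> i' = j'") (auto simp: sum_divide_distrib)
  finally show "?L $$ (v * (M * sB) + w, v' * (M * sB) + w') = ?R $$ (v * (M * sB) + w, v' * (M * sB) + w')" using L by simp
qed

end

section \<open>Tests that trace out Charlie\<close>

lemma ptrace_middle_carrier [simp]: "ptrace_middle a c b X \<in> carrier_mat (a * b) (a * b)"
  by (simp add: ptrace_middle_def)

text \<open>The operator \<open>1 \<otimes> <k| \<otimes> 1\<close>. These are Kraus operators of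
  the partial trace, which thereby becomes a sum of conjugations.\<close>

definition middle_bra :: "nat \<Rightarrow> nat \<Rightarrow> nat \<Rightarrow> nat \<Rightarrow> complex mat" where
  "middle_bra a c b k = mat (a * b) (a * c * b) (\<lambda>(v, w). if w = ((v div b) * c + k) * b + v mod b then 1 else 0)"

lemma middle_bra_carrier: "middle_bra a c b k \<in> carrier_mat (a * b) (a * c * b)"
  by (simp add: middle_bra_def)

lemma middle_bra_index_less:
  fixes v a b c k :: nat
  assumes "v < a * b" "k < c"
  shows "((v div b) * c + k) * b + v mod b < a * c * b"
  by (rule pair_index_less[OF pair_index_less[OF div_index_less[OF assms(1)] assms(2)] mod_index_less[OF assms(1)]])

lemma mapply_middle_bra:
  assumes "v < a * b" "k < c"
  shows "mapply (middle_bra a c b k) z v = z (((v div b) * c + k) * b + v mod b)"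
proof -
  have "mapply (middle_bra a c b k) z v = (\<Sum>w<a * c * b. if w = ((v div b) * c + k) * b + v mod b then z w else 0)"
    unfolding mapply_def using assms by (intro sum.cong) (auto simp: middle_bra_def)
  then show ?thesis using middle_bra_index_less[OF assms] by simp
qed

lemma middle_bra_conj_index:
  assumes X: "X \<in> carrier_mat (a * c * b) (a * c * b)" and "i < a * b" "j < a * b" "k < c"
  shows "(middle_bra a c b k * X * mat_adjoint (middle_bra a c b k)) $$ (i, j) =
    X $$ (((i div b) * c + k) * b + i mod b, ((j div b) * c + k) * b + j mod b)"
proof -
  let ?f = "\<lambda>v. ((v div b) * c + k) * b + v mod b"
  have "(middle_bra a c b k * X * mat_adjoint (middle_bra a c b k)) $$ (i, j) =
    (\<Sum>u<a * c * b. \<Sum>w<a * c * b. if u = ?f i then if w = ?f j then X $$ (u, w) else 0 else 0)"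
    unfolding index_sandwich[OF middle_bra_carrier X middle_bra_carrier assms(2,3)] using assms
    by (intro sum.cong refl) (auto simp: middle_bra_def)
  also have "\<dots> = (\<Sum>u<a * c * b. if u = ?f i then \<Sum>w<a * c * b. if w = ?f j then X $$ (u, w) else 0 else 0)"
    by (intro sum.cong refl) auto
  also have "\<dots> = X $$ (?f i, ?f j)"
    using middle_bra_index_less[OF assms(2,4)] middle_bra_index_less[OF assms(3,4)] by simp
  finally show ?thesis .
qed

lemma linear_functional_mtrace: "linear_functional d mtrace"
proof -
  have "mtrace X = pairing d (\<lambda>i j. if j = i then 1 else 0) X" if "X \<in> carrier_mat d d" for X
  proof -
    have "pairing d (\<lambda>i j. if j = i then 1 else 0) X = (\<Sum>i<d. \<Sum>j<d. if j = i then X $$ (i, i) else 0)"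
      unfolding pairing_def by (intro sum.cong refl) auto
    then show ?thesis using that by (simp add: mtrace_def)
  qed
  then show ?thesis by (auto simp: linear_functional_def)
qed

lemma mtrace_outer: "mtrace (outer d z) = complex_of_real (norm2 d z)"
  unfolding mtrace_def norm2_def of_real_sum complex_norm_square by (simp add: outer_def)

text \<open>A diagonal block in Charlie's basis is unchanged when Charlie's system is transposed, so
  after the partial trace the transposed outer product looks like the original one. For a product
  vector each block is again a product, and the squared norms of Bob's parts add up to that of
  \<open>w\<close>.\<close>

lemma ptrace_middle_test_functional:
  assumes T: "contraction s (a * b) T" and \<delta>: "\<And>u w. norm2 s (mapply T (prodvec b u w)) \<le> \<delta> * (norm2 a u * norm2 b w)"
  shows "test_functional \<delta> (a, c, b) (\<lambda>X. mtrace (T * ptrace_middle a c b X * mat_adjoint T))"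
proof -
  let ?R = "middle_bra a c b" and ?D = "a * c * b"
  let ?t = "\<lambda>X. mtrace (T * ptrace_middle a c b X * mat_adjoint T)"
  have Tc: "T \<in> carrier_mat s (a * b)" using T by (simp add: contraction_def)
  have lin0: "linear_functional (a * b) (\<lambda>Y. mtrace (T * Y * mat_adjoint T))"
    by (rule linear_functional_conj[OF linear_functional_mtrace Tc])
  have t_eq: "?t X = (\<Sum>k<c. mtrace (T * (?R k * X * mat_adjoint (?R k)) * mat_adjoint T))"
    if X: "X \<in> carrier_mat ?D ?D" for X
  proof -
    have "?t X = (\<Sum>k<c. 1 * mtrace (T * (?R k * X * mat_adjoint (?R k)) * mat_adjoint T))"
    proof (rule linear_functional_lincomb[OF lin0])
      fix i j assume ij: "i < a * b" "j < a * b"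
      show "ptrace_middle a c b X $$ (i, j) = (\<Sum>k<c. 1 * (?R k * X * mat_adjoint (?R k)) $$ (i, j))"
        using ij middle_bra_conj_index[OF X ij] by (simp add: ptrace_middle_def del: index_mult_mat(1))
    qed (auto intro: conj_carrier[OF middle_bra_carrier X])
    then show ?thesis by simp
  qed
  have lin: "linear_functional ?D ?t"
    by (rule linear_functional_cong[OF _ t_eq])
      (intro linear_functional_sum finite_lessThan linear_functional_conj[OF lin0 middle_bra_carrier])
  have outer: "?t (mid_transpose a c b (outer ?D z)) = complex_of_real (\<Sum>k<c. norm2 s (mapply T (mapply (?R k) z)))" for z
  proof -
    have "?R k * mid_transpose a c b (outer ?D z) * mat_adjoint (?R k) = outer (a * b) (mapply (?R k) z)" if k: "k < c" for k
    proof (rule eq_matI)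
      fix i j assume "i < dim_row (outer (a * b) (mapply (?R k) z))" "j < dim_col (outer (a * b) (mapply (?R k) z))"
      then have ij: "i < a * b" "j < a * b" by (auto simp: outer_def)
      then have l: "i div b < a" "j div b < a" "i mod b < b" "j mod b < b" by (auto simp: div_index_less mod_index_less)
      show "(?R k * mid_transpose a c b (outer ?D z) * mat_adjoint (?R k)) $$ (i, j) = outer (a * b) (mapply (?R k) z) $$ (i, j)"
        unfolding middle_bra_conj_index[OF mid_transpose_carrier ij k] mid_transpose_index[OF l(1) k l(3) l(2) k l(4)]
        using ij k by (simp add: mapply_middle_bra middle_bra_index_less)
    qed (auto simp: outer_def middle_bra_def)
    then show ?thesis
      by (subst t_eq) (simp_all add: conj_outer[OF Tc] mtrace_outer)
  qed
  have total: "(\<Sum>k<c. norm2 (a * b) (mapply (?R k) z)) = norm2 ?D z" for z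
  proof -
    have "(\<Sum>k<c. norm2 (a * b) (mapply (?R k) z)) = (\<Sum>k<c. norm2 (a * b) (\<lambda>v. z (((v div b) * c + k) * b + v mod b)))"
      by (intro sum.cong refl norm2_cong mapply_middle_bra) auto
    also have "\<dots> = (\<Sum>k<c. \<Sum>x<a. \<Sum>w<b. (cmod (z ((x * c + k) * b + w)))\<^sup>2)"
      by (simp add: norm2_def sum_pair_index)
    also have "\<dots> = norm2 ?D z" unfolding norm2_tri by (rule sum.swap)
    finally show ?thesis .
  qed
  show ?thesis unfolding test_functional.simps outer
  proof (intro conjI allI lin)
    fix z
    show "Im (complex_of_real (\<Sum>k<c. norm2 s (mapply T (mapply (?R k) z)))) = 0" by simp
    show "0 \<le> Re (complex_of_real (\<Sum>k<c. norm2 s (mapply T (mapply (?R k) z))))" by (simp add: sum_nonneg)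
    show "Re (complex_of_real (\<Sum>k<c. norm2 s (mapply T (mapply (?R k) z)))) \<le> norm2 ?D z"
      unfolding total[symmetric] Re_complex_of_real using T by (intro sum_mono) (auto simp: contraction_def)
  next
    fix u w
    have "norm2 s (mapply T (mapply (?R k) (prodvec (c * b) u w))) \<le> \<delta> * (norm2 a u * norm2 b (\<lambda>y. w (k * b + y)))"
      if k: "k < c" for k
    proof -
      have "mapply (?R k) (prodvec (c * b) u w) v = prodvec b u (\<lambda>y. w (k * b + y)) v" if v: "v < a * b" for v
      proof -
        have l: "k * b + v mod b < c * b" by (rule pair_index_less[OF k mod_index_less[OF v]])
        have e: "((v div b) * c + k) * b + v mod b = (v div b) * (c * b) + (k * b + v mod b)" by (simp add: algebra_simps)
        show ?thesis unfolding mapply_middle_bra[OF v k] prodvec_def e pair_index[OF l] ..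
      qed
      then have "mapply T (mapply (?R k) (prodvec (c * b) u w)) = mapply T (prodvec b u (\<lambda>y. w (k * b + y)))"
        using Tc by (intro ext) (auto simp: mapply_def[of T] intro!: sum.cong)
      then show ?thesis using \<delta> by simp
    qed
    then have "(\<Sum>k<c. norm2 s (mapply T (mapply (?R k) (prodvec (c * b) u w)))) \<le> (\<Sum>k<c. \<delta> * (norm2 a u * norm2 b (\<lambda>y. w (k * b + y))))"
      by (intro sum_mono) auto
    also have "\<dots> = \<delta> * (norm2 a u * norm2 (c * b) w)" by (simp add: norm2_pair sum_distrib_left)
    finally show "Re (complex_of_real (\<Sum>k<c. norm2 s (mapply T (mapply (?R k) (prodvec (c * b) u w))))) \<le> \<delta> * (norm2 a u * norm2 (c * b) w)"
      by simp
  qed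
qed

lemma conj_conj_adjoint:
  assumes T: "T \<in> carrier_mat s n" and \<sigma>: "\<sigma> \<in> carrier_mat s s"
  shows "T * (mat_adjoint T * \<sigma> * T) * mat_adjoint T = (T * mat_adjoint T) * \<sigma> * (T * mat_adjoint T)"
proof -
  define R where "R = mat_adjoint T"
  have R: "R \<in> carrier_mat n s" using T by (simp add: R_def)
  have "T * (R * \<sigma> * T) * R = (T * (R * \<sigma>)) * T * R"
    using assoc_mult_mat[OF T mult_carrier_mat[OF R \<sigma>] T] by simp
  also have "T * (R * \<sigma>) = (T * R) * \<sigma>"
    using assoc_mult_mat[OF T R \<sigma>] by simp
  also have "(T * R) * \<sigma> * T * R = (T * R) * \<sigma> * (T * R)"
    using assoc_mult_mat[OF mult_carrier_mat[OF mult_carrier_mat[OF T R] \<sigma>] T R] by simp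
  finally show ?thesis by (simp add: R_def)
qed

text \<open>The untwisting coisometry maps the private state to its shield, which has trace 1, so
  the private state passes with certainty. An output at trace norm distance at most \<epsilon> loses
  at most \<epsilon>, because the test comes from a contraction.\<close>

lemma key_repeater_achievable_test:
  assumes "key_repeater_achievable dA dC dB \<tau> \<epsilon> n m"
  obtains t where "test_functional (1 / 2 ^ m) (dA ^ n, dC ^ n, dB ^ n) t" "1 - \<epsilon> \<le> Re (t (tri_power dA dC dB \<tau> n))"
proof -
  obtain \<Lambda> c sA sB \<gamma> where locc: "locc (dA ^ n, dC ^ n, dB ^ n) (2 ^ m * sA, c, 2 ^ m * sB) \<Lambda>"
    and "is_private_state m sA sB \<gamma>"
    and close: "trace_norm (ptrace_middle (2 ^ m * sA) c (2 ^ m * sB) (\<Lambda> (tri_power dA dC dB \<tau> n)) - \<gamma>) \<le> \<epsilon>"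
    using assms unfolding key_repeater_achievable_def by blast
  then obtain \<sigma> U where \<sigma>: "is_state (sA * sB) \<sigma>" and U: "\<And>i. i < 2 ^ m \<Longrightarrow> is_unitary (sA * sB) (U i)"
    and \<gamma>: "\<gamma> = swap_middle (2^m) (2^m) sA sB
          ((1 / 2^m) \<cdot>\<^sub>m msum (2^m * 2^m * (sA * sB)) ({..<2^m} \<times> {..<2^m})
             (\<lambda>(i, j). kron (ketbra (2^m * 2^m) (i * 2^m + i) (j * 2^m + j)) (U i * \<sigma> * mat_adjoint (U j))))"
    unfolding is_private_state_def by blast
  define M :: nat where "M = 2 ^ m"
  have M: "0 < M" by (simp add: M_def)
  have UM: "\<And>i. i < M \<Longrightarrow> is_unitary (sA * sB) (U i)" using U by (simp add: M_def)
  note \<sigma>c = is_state_carrier[OF \<sigma>]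
  define T where "T = untwist M sA sB U"
  have Tc: "T \<in> carrier_mat (sA * sB) (M * sA * (M * sB))" unfolding T_def by (rule untwist_carrier[OF UM M])
  have T: "contraction (sA * sB) (M * sA * (M * sB)) T" unfolding T_def by (rule untwist_contraction[OF UM M])
  have TT: "T * mat_adjoint T = 1\<^sub>m (sA * sB)" unfolding T_def by (rule untwist_coisometry[OF UM M])
  have \<gamma>T: "\<gamma> = mat_adjoint T * \<sigma> * T"
    using private_state_untwist[OF UM M \<sigma>c] unfolding \<gamma> T_def M_def by simp
  have \<gamma>c: "\<gamma> \<in> carrier_mat (M * sA * (M * sB)) (M * sA * (M * sB))"
    unfolding \<gamma>T by (intro mult_carrier_mat[of _ _ "sA * sB"] adjoint_carrier Tc \<sigma>c)
  have "T * \<gamma> * mat_adjoint T = (T * mat_adjoint T) * \<sigma> * (T * mat_adjoint T)"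
    unfolding \<gamma>T using conj_conj_adjoint[OF Tc \<sigma>c] .
  then have one: "mtrace (T * \<gamma> * mat_adjoint T) = 1"
    unfolding TT using \<sigma> \<sigma>c by (simp add: is_state_def)
  let ?t0 = "\<lambda>X. mtrace (T * ptrace_middle (M * sA) c (M * sB) X * mat_adjoint T)"
  have t0: "test_functional (1 / 2 ^ m) (M * sA, c, M * sB) ?t0"
  proof (rule ptrace_middle_test_functional[OF T])
    fix u w
    show "norm2 (sA * sB) (mapply T (prodvec (M * sB) u w)) \<le> 1 / 2 ^ m * (norm2 (M * sA) u * norm2 (M * sB) w)"
      using norm2_untwist_prodvec_le[OF UM M, where u = u and w = w] by (simp add: T_def M_def)
  qed
  define \<gamma>' where "\<gamma>' = ptrace_middle (M * sA) c (M * sB) (\<Lambda> (tri_power dA dC dB \<tau> n))"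
  have \<gamma>'c: "\<gamma>' \<in> carrier_mat (M * sA * (M * sB)) (M * sA * (M * sB))" by (simp add: \<gamma>'_def)
  have "cmod (mtrace (T * (\<gamma>' - \<gamma>) * mat_adjoint T)) \<le> \<epsilon>"
    using trace_norm_ge[OF minus_carrier_mat[OF \<gamma>c] T] close[folded M_def, folded \<gamma>'_def] by (rule order_trans)
  moreover have "mtrace (T * (\<gamma>' - \<gamma>) * mat_adjoint T) = mtrace (T * \<gamma>' * mat_adjoint T) - 1"
  proof -
    obtain \<Theta> where "\<And>Y. Y \<in> carrier_mat (M * sA * (M * sB)) (M * sA * (M * sB)) \<Longrightarrow>
        mtrace (T * Y * mat_adjoint T) = pairing (M * sA * (M * sB)) \<Theta> Y"
      using linear_functional_conj[OF linear_functional_mtrace Tc] by (auto simp: linear_functional_def)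
    moreover have "pairing (M * sA * (M * sB)) \<Theta> (\<gamma>' - \<gamma>) = pairing (M * sA * (M * sB)) \<Theta> \<gamma>' - pairing (M * sA * (M * sB)) \<Theta> \<gamma>"
      unfolding pairing_def sum_subtractf[symmetric] using \<gamma>c \<gamma>'c by (intro sum.cong refl) (auto simp: algebra_simps)
    ultimately show ?thesis using \<gamma>c \<gamma>'c one by (simp add: minus_carrier_mat)
  qed
  ultimately have "1 - \<epsilon> \<le> Re (mtrace (T * \<gamma>' * mat_adjoint T))"
    using abs_Re_le_cmod[of "mtrace (T * \<gamma>' * mat_adjoint T) - 1"] by simp
  moreover have "test_functional (1 / 2 ^ m) (dA ^ n, dC ^ n, dB ^ n) (\<lambda>X. ?t0 (\<Lambda> X))"
    using test_functional_locc[OF locc[folded M_def] t0] .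
  ultimately show ?thesis using that unfolding \<gamma>'_def by blast
qed

section \<open>Partial transposition of the repeater input\<close>

text \<open>\<open>r1\<close>, \<open>r2\<close> and \<open>r3\<close> bring the index into the
  forms expected by the outer exchange, the inner exchange and the Kronecker product.\<close>

lemma tri_tensor_index:
  assumes X: "X \<in> carrier_mat (a1 * c1 * b1) (a1 * c1 * b1)" and Y: "Y \<in> carrier_mat (a2 * c2 * b2) (a2 * c2 * b2)"
    and x: "x1 < a1" "x2 < a2" "y1 < c1" "y2 < c2" "w1 < b1" "w2 < b2"
    and x': "x1' < a1" "x2' < a2" "y1' < c1" "y2' < c2" "w1' < b1" "w2' < b2"
  shows "tri_tensor a1 c1 b1 a2 c2 b2 X Y $$
    (((x1 * a2 + x2) * (c1 * c2) + (y1 * c2 + y2)) * (b1 * b2) + (w1 * b2 + w2),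
     ((x1' * a2 + x2') * (c1 * c2) + (y1' * c2 + y2')) * (b1 * b2) + (w1' * b2 + w2')) =
    X $$ ((x1 * c1 + y1) * b1 + w1, (x1' * c1 + y1') * b1 + w1') * Y $$ ((x2 * c2 + y2) * b2 + w2, (x2' * c2 + y2') * b2 + w2')"
proof -
  have r1: "((u1 * a2 + u2) * (c1 * c2) + (v1 * c2 + v2)) * (b1 * b2) + (z1 * b2 + z2) =
      ((((u1 * a2 + u2) * c1 + v1) * c2 + v2) * b1 + z1) * b2 + z2" for u1 u2 v1 v2 z1 z2
    by (simp add: algebra_simps)
  have r2: "((((u1 * a2 + u2) * c1 + v1) * b1 + z1) * c2 + v2) * b2 + z2 =
      ((u1 * a2 + u2) * (c1 * b1) + (v1 * b1 + z1)) * (c2 * b2) + (v2 * b2 + z2)" for u1 u2 v1 v2 z1 z2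
    by (simp add: algebra_simps)
  have r3: "((u1 * (c1 * b1) + (v1 * b1 + z1)) * a2 + u2) * (c2 * b2) + (v2 * b2 + z2) =
      ((u1 * c1 + v1) * b1 + z1) * (a2 * c2 * b2) + ((u2 * c2 + v2) * b2 + z2)" for u1 u2 v1 v2 z1 z2
    by (simp add: algebra_simps)
  have l: "(x1 * a2 + x2) * c1 + y1 < a1 * a2 * c1" "(x1' * a2 + x2') * c1 + y1' < a1 * a2 * c1"
    "y1 * b1 + w1 < c1 * b1" "y1' * b1 + w1' < c1 * b1" "y2 * b2 + w2 < c2 * b2" "y2' * b2 + w2' < c2 * b2"
    "(x1 * c1 + y1) * b1 + w1 < a1 * c1 * b1" "(x1' * c1 + y1') * b1 + w1' < a1 * c1 * b1"
    "(x2 * c2 + y2) * b2 + w2 < a2 * c2 * b2" "(x2' * c2 + y2') * b2 + w2' < a2 * c2 * b2"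
    using x x' by (simp_all add: pair_index_less)
  show ?thesis unfolding tri_tensor_def r1
    unfolding swap_middle_index_eq[OF l(1) x(5) x(4) x(6) l(2) x'(5) x'(4) x'(6)] r2
    unfolding swap_middle_index_eq[OF x(1) l(3) x(2) l(5) x'(1) l(4) x'(2) l(6)] r3
    by (rule kron_index[OF X Y l(7,8,9,10)])
qed

lemma tri_tensor_carrier:
  "tri_tensor a1 c1 b1 a2 c2 b2 X Y \<in> carrier_mat (a1 * a2 * (c1 * c2) * (b1 * b2)) (a1 * a2 * (c1 * c2) * (b1 * b2))"
proof -
  have "a1 * a2 * (c1 * c2) * (b1 * b2) = a1 * a2 * c1 * b1 * c2 * b2" by simp
  then show ?thesis unfolding tri_tensor_def swap_middle_permute[of "a1 * a2 * c1"] by (metis permute_mat_carrier)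
qed

lemma tri_power_carrier:
  "tri_power a c b X n \<in> carrier_mat (a ^ n * c ^ n * b ^ n) (a ^ n * c ^ n * b ^ n)"
proof (cases n)
  case (Suc k)
  have "a ^ Suc k * c ^ Suc k * b ^ Suc k = a ^ k * a * (c ^ k * c) * (b ^ k * b)" by simp
  then show ?thesis unfolding Suc by (simp only: tri_power.simps tri_tensor_carrier)
qed simp

text \<open>The number of a basis vector of \<open>n\<close> pairs \<open>C\<^sub>A C\<^sub>B\<close> is split into the numbers of the basis
  vectors of the \<open>n\<close> systems \<open>C\<^sub>A\<close> and of the \<open>n\<close> systems \<open>C\<^sub>B\<close>.\<close>

primrec left_digits :: "nat \<Rightarrow> nat \<Rightarrow> nat \<Rightarrow> nat \<Rightarrow> nat" where
  "left_digits c d 0 q = 0"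
| "left_digits c d (Suc n) q = left_digits c d n (q div (c * d)) * c + q mod (c * d) div d"

primrec right_digits :: "nat \<Rightarrow> nat \<Rightarrow> nat \<Rightarrow> nat \<Rightarrow> nat" where
  "right_digits c d 0 q = 0"
| "right_digits c d (Suc n) q = right_digits c d n (q div (c * d)) * d + q mod (c * d) mod d"

text \<open>Injectivity follows digit by digit; surjectivity follows because both sides have
  \<open>(c * d) ^ n\<close> elements.\<close>

lemma digits_bij:
  "bij_betw (\<lambda>q. (left_digits c d n q, right_digits c d n q)) {..<(c * d) ^ n} ({..<c ^ n} \<times> {..<d ^ n})"
proof (induction n)
  case 0
  show ?case by (auto simp: bij_betw_def inj_on_def)
next
  case (Suc n)
  let ?f = "\<lambda>q. (left_digits c d n q, right_digits c d n q)"
  let ?g = "\<lambda>q. (left_digits c d (Suc n) q, right_digits c d (Suc n) q)"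
  have inj: "q = q'" if "q < (c * d) ^ n" "q' < (c * d) ^ n" "?f q = ?f q'" for q q'
    using Suc that by (auto simp: bij_betw_def inj_on_def)
  have fl: "left_digits c d n q < c ^ n" "right_digits c d n q < d ^ n" if "q < (c * d) ^ n" for q
  proof -
    have "?f q \<in> {..<c ^ n} \<times> {..<d ^ n}" using Suc that unfolding bij_betw_def by blast
    then show "left_digits c d n q < c ^ n" "right_digits c d n q < d ^ n" by auto
  qed
  have split: "q div (c * d) < (c * d) ^ n \<and> q mod (c * d) < c * d \<and> q mod (c * d) div d < c \<and> q mod (c * d) mod d < d"
    if "q < (c * d) ^ Suc n" for q
  proof -
    have q: "q < (c * d) ^ n * (c * d)" using that by (simp add: mult_ac)
    show ?thesis using div_index_less[OF q] mod_index_less[OF q] div_index_less[OF mod_index_less[OF q]] mod_index_less[OF mod_index_less[OF q]]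
      by blast
  qed
  have gl: "left_digits c d (Suc n) q < c ^ Suc n \<and> right_digits c d (Suc n) q < d ^ Suc n" if "q < (c * d) ^ Suc n" for q
    using pair_index_less[OF fl(1)] pair_index_less[OF fl(2)] split[OF that] by (simp add: mult.commute)
  have ginj: "q = q'" if q: "q < (c * d) ^ Suc n" "q' < (c * d) ^ Suc n" "?g q = ?g q'" for q q'
  proof -
    note s = split[OF q(1)] split[OF q(2)]
    have "left_digits c d n (q div (c * d)) = left_digits c d n (q' div (c * d))" "q mod (c * d) div d = q' mod (c * d) div d"
      "right_digits c d n (q div (c * d)) = right_digits c d n (q' div (c * d))" "q mod (c * d) mod d = q' mod (c * d) mod d"
      using q(3) s by (simp, metis pair_index)+
    then have "q div (c * d) = q' div (c * d)" "q mod (c * d) = q' mod (c * d)"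
      using inj s by (auto, metis div_mult_mod_eq)
    then show ?thesis by (metis div_mult_mod_eq)
  qed
  have inj_g: "inj_on ?g {..<(c * d) ^ Suc n}"
  proof (rule inj_onI)
    fix q q' assume a: "q \<in> {..<(c * d) ^ Suc n}" "q' \<in> {..<(c * d) ^ Suc n}" "?g q = ?g q'"
    show "q = q'" by (rule ginj[OF _ _ a(3)]) (use a(1,2) in \<open>simp_all only: lessThan_iff\<close>)
  qed
  have "?g ` {..<(c * d) ^ Suc n} = {..<c ^ Suc n} \<times> {..<d ^ Suc n}"
  proof (rule card_subset_eq)
    show "?g ` {..<(c * d) ^ Suc n} \<subseteq> {..<c ^ Suc n} \<times> {..<d ^ Suc n}"
      using gl by (simp only: image_subset_iff mem_Sigma_iff lessThan_iff) blast
    from inj_g show "card (?g ` {..<(c * d) ^ Suc n}) = card ({..<c ^ Suc n} \<times> {..<d ^ Suc n})"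
      by (simp add: card_image power_mult_distrib del: left_digits.simps right_digits.simps)
  qed simp
  with inj_g show ?case by (simp only: bij_betw_def)
qed

lemma digits_less:
  assumes "q < (c * d) ^ n"
  shows "left_digits c d n q < c ^ n" "right_digits c d n q < d ^ n"
proof -
  have "(left_digits c d n q, right_digits c d n q) \<in> {..<c ^ n} \<times> {..<d ^ n}"
    using digits_bij[of c d n] assms unfolding bij_betw_def by blast
  then show "left_digits c d n q < c ^ n" "right_digits c d n q < d ^ n" by auto
qed

lemma ptranspose_snd_index:
  assumes "x < d1" "y < d2" "x' < d1" "y' < d2"
  shows "ptranspose_snd d1 d2 X $$ (x * d2 + y, x' * d2 + y') = X $$ (x * d2 + y', x' * d2 + y)"
  using assms by (simp add: ptranspose_snd_def pair_index_less)

lemma ptranspose_fst_index: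
  assumes "x < d1" "y < d2" "x' < d1" "y' < d2"
  shows "ptranspose_fst d1 d2 X $$ (x * d2 + y, x' * d2 + y') = X $$ (x' * d2 + y, x * d2 + y')"
  using assms by (simp add: ptranspose_fst_def pair_index_less)

text \<open>Having \<open>q'\<close> in the row and \<open>q\<close> in the column on the right is
  Charlie's partial transposition. Up to the splitting of his digits, the transposed input is thus
  the product of the tensor powers of the two transposed states.\<close>

lemma tri_power_kron_index:
  assumes \<rho>: "\<rho> \<in> carrier_mat (a * c) (a * c)" and \<rho>': "\<rho>' \<in> carrier_mat (d * b) (d * b)"
    and s: "is_state (a * c) (ptranspose_snd a c \<rho>)" and s': "is_state (d * b) (ptranspose_fst d b \<rho>')"
  shows "p < a ^ n \<Longrightarrow> q < (c * d) ^ n \<Longrightarrow> r < b ^ n \<Longrightarrow> p' < a ^ n \<Longrightarrow> q' < (c * d) ^ n \<Longrightarrow> r' < b ^ n \<Longrightarrow>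
    tri_power a (c * d) b (kron \<rho> \<rho>') n $$ ((p * (c * d) ^ n + q) * b ^ n + r, (p' * (c * d) ^ n + q') * b ^ n + r') =
    bip_power a c (ptranspose_snd a c \<rho>) n $$ (p * c ^ n + left_digits c d n q', p' * c ^ n + left_digits c d n q) *
    bip_power d b (ptranspose_fst d b \<rho>') n $$ (right_digits c d n q' * b ^ n + r, right_digits c d n q * b ^ n + r')"
proof (induction n arbitrary: p q r p' q' r')
  case 0
  then show ?case by simp
next
  case (Suc n)
  define P where "P = bip_power a c (ptranspose_snd a c \<rho>) n"
  define P' where "P' = bip_power d b (ptranspose_fst d b \<rho>') n"
  have Pc: "P \<in> carrier_mat (a ^ n * c ^ n) (a ^ n * c ^ n)" "P' \<in> carrier_mat (d ^ n * b ^ n) (d ^ n * b ^ n)"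
    unfolding P_def P'_def by (rule is_state_carrier[OF is_state_bip_power[OF s]], rule is_state_carrier[OF is_state_bip_power[OF s']])
  have kc: "kron \<rho> \<rho>' \<in> carrier_mat (a * (c * d) * b) (a * (c * d) * b)"
    using kron_carrier[OF \<rho> \<rho>'] by (simp add: mult.assoc)
  have "p < a ^ n * a" using Suc.prems by (simp add: mult.commute)
  then obtain p1 p2 where p: "p1 < a ^ n" "p2 < a" "p = p1 * a + p2" by (rule pair_index_cases)
  have "p' < a ^ n * a" using Suc.prems by (simp add: mult.commute)
  then obtain p1' p2' where p': "p1' < a ^ n" "p2' < a" "p' = p1' * a + p2'" by (rule pair_index_cases)
  have "r < b ^ n * b" using Suc.prems by (simp add: mult.commute)
  then obtain r1 r2 where r: "r1 < b ^ n" "r2 < b" "r = r1 * b + r2" by (rule pair_index_cases)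
  have "r' < b ^ n * b" using Suc.prems by (simp add: mult.commute)
  then obtain r1' r2' where r': "r1' < b ^ n" "r2' < b" "r' = r1' * b + r2'" by (rule pair_index_cases)
  have "q < (c * d) ^ n * (c * d)" using Suc.prems by (simp add: mult_ac)
  then obtain q1 q2 where q: "q1 < (c * d) ^ n" "q2 < c * d" "q = q1 * (c * d) + q2" by (rule pair_index_cases)
  have "q' < (c * d) ^ n * (c * d)" using Suc.prems by (simp add: mult_ac)
  then obtain q1' q2' where q': "q1' < (c * d) ^ n" "q2' < c * d" "q' = q1' * (c * d) + q2'" by (rule pair_index_cases)
  obtain u v where uv: "u < c" "v < d" "q2 = u * d + v" using q(2) by (rule pair_index_cases)
  obtain u' v' where uv': "u' < c" "v' < d" "q2' = u' * d + v'" using q'(2) by (rule pair_index_cases)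
  let ?L = "left_digits c d" and ?R = "right_digits c d"
  have dig: "?L (Suc n) q = ?L n q1 * c + u" "?R (Suc n) q = ?R n q1 * d + v"
    "?L (Suc n) q' = ?L n q1' * c + u'" "?R (Suc n) q' = ?R n q1' * d + v'"
    using q q' uv uv' pair_index[OF q(2), of q1] pair_index[OF q'(2), of q1'] by simp_all
  have k: "(x * (c * d) + (y * d + z)) * b + w = (x * c + y) * (d * b) + (z * b + w)" for x y z w
    by (simp add: algebra_simps)
  have sw: "a ^ Suc n = a ^ n * a" "b ^ Suc n = b ^ n * b" "c ^ Suc n = c ^ n * c" "(c * d) ^ Suc n = (c * d) ^ n * (c * d)"
    by simp_all
  have "tri_power a (c * d) b (kron \<rho> \<rho>') (Suc n) $$ ((p * (c * d) ^ Suc n + q) * b ^ Suc n + r, (p' * (c * d) ^ Suc n + q') * b ^ Suc n + r') =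
     (P $$ (p1 * c ^ n + ?L n q1', p1' * c ^ n + ?L n q1) * P' $$ (?R n q1' * b ^ n + r1, ?R n q1 * b ^ n + r1')) *
     kron \<rho> \<rho>' $$ ((p2 * (c * d) + q2) * b + r2, (p2' * (c * d) + q2') * b + r2')"
    unfolding tri_power.simps sw p(3) p'(3) q(3) q'(3) r(3) r'(3)
      tri_tensor_index[OF tri_power_carrier kc p(1,2) q(1,2) r(1,2) p'(1,2) q'(1,2) r'(1,2)]
      Suc.IH[OF p(1) q(1) r(1) p'(1) q'(1) r'(1)] P_def P'_def ..
  also have "kron \<rho> \<rho>' $$ ((p2 * (c * d) + q2) * b + r2, (p2' * (c * d) + q2') * b + r2') =
     \<rho> $$ (p2 * c + u, p2' * c + u') * \<rho>' $$ (v * b + r2, v' * b + r2')"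
    unfolding uv(3) uv'(3) k
    by (rule kron_index[OF \<rho> \<rho>']) (intro pair_index_less p p' uv uv' r r')+
  also have "\<dots> = ptranspose_snd a c \<rho> $$ (p2 * c + u', p2' * c + u) * ptranspose_fst d b \<rho>' $$ (v' * b + r2, v * b + r2')"
    using p p' uv uv' r r' by (simp add: ptranspose_snd_index ptranspose_fst_index)
  finally have 1: "tri_power a (c * d) b (kron \<rho> \<rho>') (Suc n) $$ ((p * (c * d) ^ Suc n + q) * b ^ Suc n + r, (p' * (c * d) ^ Suc n + q') * b ^ Suc n + r') =
     (P $$ (p1 * c ^ n + ?L n q1', p1' * c ^ n + ?L n q1) * P' $$ (?R n q1' * b ^ n + r1, ?R n q1 * b ^ n + r1')) *
     (ptranspose_snd a c \<rho> $$ (p2 * c + u', p2' * c + u) * ptranspose_fst d b \<rho>' $$ (v' * b + r2, v * b + r2'))" .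
  have 2: "bip_power a c (ptranspose_snd a c \<rho>) (Suc n) $$ (p * c ^ Suc n + ?L (Suc n) q', p' * c ^ Suc n + ?L (Suc n) q) =
     P $$ (p1 * c ^ n + ?L n q1', p1' * c ^ n + ?L n q1) * ptranspose_snd a c \<rho> $$ (p2 * c + u', p2' * c + u)"
    unfolding bip_power.simps P_def[symmetric] sw dig p(3) p'(3)
    by (rule bip_tensor_index[OF Pc(1) is_state_carrier[OF s] p(1,2) digits_less(1)[OF q'(1)] uv'(1) p'(1,2) digits_less(1)[OF q(1)] uv(1)])
  have 3: "bip_power d b (ptranspose_fst d b \<rho>') (Suc n) $$ (?R (Suc n) q' * b ^ Suc n + r, ?R (Suc n) q * b ^ Suc n + r') =
     P' $$ (?R n q1' * b ^ n + r1, ?R n q1 * b ^ n + r1') * ptranspose_fst d b \<rho>' $$ (v' * b + r2, v * b + r2')"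
    unfolding bip_power.simps P'_def[symmetric] sw dig r(3) r'(3)
    by (rule bip_tensor_index[OF Pc(2) is_state_carrier[OF s'] digits_less(2)[OF q'(1)] uv'(2) r(1,2) digits_less(2)[OF q(1)] uv(2) r'(1,2)])
  show ?case unfolding 1 2 3 by simp
qed

section \<open>Reduction to Alice's bipartite state\<close>

lemma linear_functional_scale:
  assumes "linear_functional d t"
  shows "linear_functional d (\<lambda>X. s * t X)"
proof -
  obtain \<Theta> where "\<And>X. X \<in> carrier_mat d d \<Longrightarrow> t X = pairing d \<Theta> X" using assms by (auto simp: linear_functional_def)
  moreover have "s * pairing d \<Theta> X = pairing d (\<lambda>i j. s * \<Theta> i j) X" for X
    by (simp add: pairing_def sum_distrib_left mult.assoc)
  ultimately show ?thesis by (auto simp: linear_functional_def)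
qed

text \<open>The transposition permutes pairs of row and column indices by the involution
  \<open>(i, j)\<close> to \<open>(f i j, f j i)\<close>, so the coefficients are only
  relabelled.\<close>

lemma linear_functional_mid_transpose:
  assumes "linear_functional (a * c * b) t"
  shows "linear_functional (a * c * b) (\<lambda>X. t (mid_transpose a c b X))"
proof -
  let ?D = "a * c * b"
  obtain \<Theta> where \<Theta>: "\<And>X. X \<in> carrier_mat ?D ?D \<Longrightarrow> t X = pairing ?D \<Theta> X" using assms by (auto simp: linear_functional_def)
  define f :: "nat \<Rightarrow> nat \<Rightarrow> nat" where "f i j = (i div b div c * c + j div b mod c) * b + i mod b" for i j
  have f: "f i j < ?D \<and> f (f i j) (f j i) = i" if ij: "i < ?D" "j < ?D" for i j
  proof -
    obtain u w where u: "u < a * c" "w < b" "i = u * b + w" using ij(1) by (rule pair_index_cases)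
    obtain x y where x: "x < a" "y < c" "u = x * c + y" using u(1) by (rule pair_index_cases)
    obtain u' w' where u': "u' < a * c" "w' < b" "j = u' * b + w'" using ij(2) by (rule pair_index_cases)
    obtain x' y' where x': "x' < a" "y' < c" "u' = x' * c + y'" using u'(1) by (rule pair_index_cases)
    show ?thesis using u x u' x' by (simp add: f_def pair_index_less)
  qed
  have "t (mid_transpose a c b X) = pairing ?D (\<lambda>i j. \<Theta> (f i j) (f j i)) X" if X: "X \<in> carrier_mat ?D ?D" for X
  proof -
    have "t (mid_transpose a c b X) = (\<Sum>i<?D. \<Sum>j<?D. \<Theta> i j * X $$ (f i j, f j i))"
      unfolding \<Theta>[OF mid_transpose_carrier] pairing_def
      by (intro sum.cong refl) (simp add: mid_transpose_def f_def)
    also have "\<dots> = pairing ?D (\<lambda>i j. \<Theta> (f i j) (f j i)) X"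
      unfolding pairing_def sum.cartesian_product
      by (rule sum.reindex_bij_witness[where i = "\<lambda>(i, j). (f i j, f j i)" and j = "\<lambda>(i, j). (f i j, f j i)"])
        (use f in auto)
    finally show ?thesis .
  qed
  then show ?thesis by (auto simp: linear_functional_def)
qed

text \<open>Fixing Bob's input state turns a test functional into an effect on the systems of Alice and
  the matching half of Charlie.\<close>

lemma test_functional_partial:
  assumes t: "test_functional \<delta> (a, c, b) t" and P': "is_state (cb * b) P'"
    and bij: "bij_betw (\<lambda>q. (\<alpha> q, \<beta> q)) {..<c} ({..<ca} \<times> {..<cb})"
  obtains \<Theta> where "effect (a * ca) \<Theta>"
    "\<And>u w. Re (pairing (a * ca) \<Theta> (outer (a * ca) (prodvec ca u w))) \<le> \<delta> * (norm2 a u * norm2 ca w)"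
    "\<And>P X. P \<in> carrier_mat (a * ca) (a * ca) \<Longrightarrow> X \<in> carrier_mat (a * c * b) (a * c * b) \<Longrightarrow>
      (\<And>p q r p' q' r'. p < a \<Longrightarrow> q < c \<Longrightarrow> r < b \<Longrightarrow> p' < a \<Longrightarrow> q' < c \<Longrightarrow> r' < b \<Longrightarrow>
         X $$ ((p * c + q) * b + r, (p' * c + q') * b + r') =
         P $$ (p * ca + \<alpha> q', p' * ca + \<alpha> q) * P' $$ (\<beta> q' * b + r, \<beta> q * b + r')) \<Longrightarrow>
      t X = pairing (a * ca) \<Theta> P"
proof -
  let ?D = "a * c * b" and ?d = "a * ca"
  obtain G g where G: "diagonalizes (cb * b) G g P'" and g: "\<And>k. k < cb * b \<Longrightarrow> 0 \<le> g k" "(\<Sum>k<cb * b. g k) = 1"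
    using P' by (auto simp: is_state_iff)
  have Gu: "is_unitary (cb * b) G" by (rule diagonalizes_unitary[OF G])
  have ab: "\<alpha> q < ca" "\<beta> q < cb" if "q < c" for q
  proof -
    have "(\<alpha> q, \<beta> q) \<in> {..<ca} \<times> {..<cb}" using bij that unfolding bij_betw_def by blast
    then show "\<alpha> q < ca" "\<beta> q < cb" by auto
  qed
  \<comment> \<open>\<open>R k\<close> appends the \<open>k\<close>-th eigenvector of
    \<open>P'\<close> to a vector of Alice and her half of Charlie, with Charlie's two indices
    merged into one. Averaging the conjugations over \<open>k\<close> with the weights
    \<open>g k\<close> appends the state \<open>P'\<close>.\<close>
  define R where "R k = mat ?D ?d (\<lambda>(i, v). if v = (i div b div c) * ca + \<alpha> (i div b mod c)
    then G $$ (\<beta> (i div b mod c) * b + i mod b, k) else 0)" for k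
  have Rc: "R k \<in> carrier_mat ?D ?d" for k by (simp add: R_def)
  have R_index: "R k $$ ((p * c + q) * b + r, v) = (if v = p * ca + \<alpha> q then G $$ (\<beta> q * b + r, k) else 0)"
    if "p < a" "q < c" "r < b" "v < ?d" for p q r v k
    using that by (simp add: R_def pair_index_less)
  have mR: "mapply (R k) z ((p * c + q) * b + r) = z (p * ca + \<alpha> q) * G $$ (\<beta> q * b + r, k)"
    if "p < a" "q < c" "r < b" for z p q r k
  proof -
    have "mapply (R k) z ((p * c + q) * b + r) = (\<Sum>v<?d. if v = p * ca + \<alpha> q then z v * G $$ (\<beta> q * b + r, k) else 0)"
      unfolding mapply_def using that Rc by (intro sum.cong) (auto simp: R_index)
    then show ?thesis using pair_index_less[OF that(1) ab(1)[OF that(2)]] by simp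
  qed
  have R_conj: "(R k * P * mat_adjoint (R k)) $$ ((p * c + q) * b + r, (p' * c + q') * b + r') =
      P $$ (p * ca + \<alpha> q, p' * ca + \<alpha> q') * (G $$ (\<beta> q * b + r, k) * cnj (G $$ (\<beta> q' * b + r', k)))"
    if l: "p < a" "q < c" "r < b" "p' < a" "q' < c" "r' < b" and P: "P \<in> carrier_mat ?d ?d" for P p q r p' q' r' k
  proof -
    have i: "(p * c + q) * b + r < ?D" "(p' * c + q') * b + r' < ?D" using l by (simp_all add: pair_index_less)
    have v: "p * ca + \<alpha> q < ?d" "p' * ca + \<alpha> q' < ?d" using l ab by (simp_all add: pair_index_less)
    have "(R k * P * mat_adjoint (R k)) $$ ((p * c + q) * b + r, (p' * c + q') * b + r') =
      (\<Sum>u<?d. \<Sum>w<?d. if u = p * ca + \<alpha> q then if w = p' * ca + \<alpha> q' then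
        P $$ (u, w) * (G $$ (\<beta> q * b + r, k) * cnj (G $$ (\<beta> q' * b + r', k))) else 0 else 0)"
      unfolding index_sandwich[OF Rc P Rc i] using l by (intro sum.cong refl) (simp add: R_index)
    also have "\<dots> = (\<Sum>u<?d. if u = p * ca + \<alpha> q then \<Sum>w<?d. if w = p' * ca + \<alpha> q' then
        P $$ (u, w) * (G $$ (\<beta> q * b + r, k) * cnj (G $$ (\<beta> q' * b + r', k))) else 0 else 0)"
      by (intro sum.cong refl) auto
    finally show ?thesis using v by simp
  qed
  \<comment> \<open>An isometry: Charlie's index runs through each pair of digits exactly once, and
    the appended eigenvector has norm 1.\<close>
  have nR: "norm2 ?D (mapply (R k) z) = norm2 ?d z" if k: "k < cb * b" for z k
  proof -
    have "norm2 ?D (mapply (R k) z) = (\<Sum>p<a. \<Sum>q<c. (cmod (z (p * ca + \<alpha> q)))\<^sup>2 * (\<Sum>r<b. (cmod (G $$ (\<beta> q * b + r, k)))\<^sup>2))"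
      unfolding norm2_tri by (intro sum.cong refl) (simp add: mR norm_mult power_mult_distrib sum_distrib_left)
    also have "\<dots> = (\<Sum>p<a. \<Sum>(q1, q2)\<in>{..<ca} \<times> {..<cb}. (cmod (z (p * ca + q1)))\<^sup>2 * (\<Sum>r<b. (cmod (G $$ (q2 * b + r, k)))\<^sup>2))"
    proof (rule sum.cong[OF refl])
      fix p
      show "(\<Sum>q<c. (cmod (z (p * ca + \<alpha> q)))\<^sup>2 * (\<Sum>r<b. (cmod (G $$ (\<beta> q * b + r, k)))\<^sup>2)) =
        (\<Sum>(q1, q2)\<in>{..<ca} \<times> {..<cb}. (cmod (z (p * ca + q1)))\<^sup>2 * (\<Sum>r<b. (cmod (G $$ (q2 * b + r, k)))\<^sup>2))"
        using sum.reindex_bij_betw[OF bij, of "\<lambda>(q1, q2). (cmod (z (p * ca + q1)))\<^sup>2 * (\<Sum>r<b. (cmod (G $$ (q2 * b + r, k)))\<^sup>2)"]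
        by simp
    qed
    also have "\<dots> = (\<Sum>p<a. (\<Sum>q1<ca. (cmod (z (p * ca + q1)))\<^sup>2) * (\<Sum>q2<cb. \<Sum>r<b. (cmod (G $$ (q2 * b + r, k)))\<^sup>2))"
      by (simp add: sum_product sum.cartesian_product[symmetric])
    also have "(\<Sum>q2<cb. \<Sum>r<b. (cmod (G $$ (q2 * b + r, k)))\<^sup>2) = 1"
      using unitary_col_norm[OF Gu k] by (simp add: sum_pair_index)
    finally show ?thesis by (simp add: norm2_def sum_pair_index)
  qed
  define F where "F Y = (\<Sum>k<cb * b. complex_of_real (g k) * t (mid_transpose a c b (R k * Y * mat_adjoint (R k))))" for Y
  have lin_t: "linear_functional ?D t" using t by simp
  note lin_tm = linear_functional_mid_transpose[OF lin_t]
  have "linear_functional ?d F"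
    unfolding F_def[abs_def]
    by (intro linear_functional_sum finite_lessThan linear_functional_scale linear_functional_conj[OF lin_tm Rc])
  then obtain \<Theta> where \<Theta>: "\<And>Y. Y \<in> carrier_mat ?d ?d \<Longrightarrow> F Y = pairing ?d \<Theta> Y" by (auto simp: linear_functional_def)
  have Fo: "pairing ?d \<Theta> (outer ?d z) = (\<Sum>k<cb * b. complex_of_real (g k) * t (mid_transpose a c b (outer ?D (mapply (R k) z))))" for z
    unfolding \<Theta>[OF outer_carrier, symmetric] F_def conj_outer[OF Rc] ..
  show thesis
  proof (rule that[of \<Theta>])
    show "effect ?d \<Theta>" unfolding effect_def
    proof (intro allI conjI)
      fix z
      show "Im (pairing ?d \<Theta> (outer ?d z)) = 0" unfolding Fo using t by (simp add: sum.neutral)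
      show "0 \<le> Re (pairing ?d \<Theta> (outer ?d z))" unfolding Fo using t g by (auto intro!: sum_nonneg mult_nonneg_nonneg)
      have "Re (pairing ?d \<Theta> (outer ?d z)) = (\<Sum>k<cb * b. g k * Re (t (mid_transpose a c b (outer ?D (mapply (R k) z)))))"
        unfolding Fo by simp
      also have "\<dots> \<le> (\<Sum>k<cb * b. g k * norm2 ?d z)"
      proof (intro sum_mono mult_left_mono)
        fix k assume "k \<in> {..<cb * b}"
        then have k: "k < cb * b" by simp
        show "0 \<le> g k" by (rule g(1)[OF k])
        show "Re (t (mid_transpose a c b (outer ?D (mapply (R k) z)))) \<le> norm2 ?d z"
          unfolding nR[OF k, symmetric] using t by simp
      qed
      also have "\<dots> = norm2 ?d z" using g(2) by (simp flip: sum_distrib_right)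
      finally show "Re (pairing ?d \<Theta> (outer ?d z)) \<le> norm2 ?d z" .
    qed
  next
    fix u w
    have "Re (pairing ?d \<Theta> (outer ?d (prodvec ca u w))) =
        (\<Sum>k<cb * b. g k * Re (t (mid_transpose a c b (outer ?D (mapply (R k) (prodvec ca u w))))))"
      unfolding Fo by simp
    also have "\<dots> \<le> (\<Sum>k<cb * b. g k * (\<delta> * (norm2 a u * norm2 ca w)))"
    proof (intro sum_mono mult_left_mono)
      fix k assume "k \<in> {..<cb * b}"
      then have k: "k < cb * b" by simp
      show "0 \<le> g k" by (rule g(1)[OF k])
      \<comment> \<open>The joint vector of Charlie and Bob: Charlie's first digit selects the entry
        of \<open>w\<close>, his second digit and Bob's index that of the eigenvector of
        \<open>P'\<close>.\<close>
      define w' where "w' i = w (\<alpha> (i div b)) * G $$ (\<beta> (i div b) * b + i mod b, k)" for i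
      have eq: "mapply (R k) (prodvec ca u w) i = prodvec (c * b) u w' i" if i: "i < ?D" for i
      proof -
        obtain v r where v: "v < a * c" "r < b" "i = v * b + r" using i by (rule pair_index_cases)
        obtain p q where p: "p < a" "q < c" "v = p * c + q" using v(1) by (rule pair_index_cases)
        have e: "(p * c + q) * b + r = p * (c * b) + (q * b + r)" by (simp add: algebra_simps)
        have l: "q * b + r < c * b" using p v by (simp add: pair_index_less)
        have "prodvec (c * b) u w' i = u p * w' (q * b + r)"
          unfolding v(3) p(3) e prodvec_def pair_index[OF l] ..
        also have "\<dots> = mapply (R k) (prodvec ca u w) i"
          unfolding v(3) p(3) mR[OF p(1,2) v(2)] using v ab(1)[OF p(2)] by (simp add: w'_def prodvec_def mult.assoc)
        finally show ?thesis ..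
      qed
      have "norm2 a u * norm2 (c * b) w' = norm2 ?D (prodvec (c * b) u w')"
        using norm2_prodvec[of a "c * b" u w'] by (simp add: mult.assoc)
      also have "\<dots> = norm2 ?D (mapply (R k) (prodvec ca u w))"
        by (rule norm2_cong[OF eq, symmetric])
      also have "\<dots> = norm2 a u * norm2 ca w"
        unfolding nR[OF k] by (rule norm2_prodvec)
      finally have n: "norm2 a u * norm2 (c * b) w' = norm2 a u * norm2 ca w" .
      have "t (mid_transpose a c b (outer ?D (mapply (R k) (prodvec ca u w)))) = t (mid_transpose a c b (outer ?D (prodvec (c * b) u w')))"
        by (simp only: outer_cong[OF eq])
      then show "Re (t (mid_transpose a c b (outer ?D (mapply (R k) (prodvec ca u w))))) \<le> \<delta> * (norm2 a u * norm2 ca w)"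
        unfolding n[symmetric] using t by simp
    qed
    also have "\<dots> = \<delta> * (norm2 a u * norm2 ca w)" using g(2) by (simp flip: sum_distrib_right)
    finally show "Re (pairing ?d \<Theta> (outer ?d (prodvec ca u w))) \<le> \<delta> * (norm2 a u * norm2 ca w)" .
  next
    fix P X
    assume P: "P \<in> carrier_mat ?d ?d" and X: "X \<in> carrier_mat ?D ?D"
      and idx: "\<And>p q r p' q' r'. p < a \<Longrightarrow> q < c \<Longrightarrow> r < b \<Longrightarrow> p' < a \<Longrightarrow> q' < c \<Longrightarrow> r' < b \<Longrightarrow>
         X $$ ((p * c + q) * b + r, (p' * c + q') * b + r') =
         P $$ (p * ca + \<alpha> q', p' * ca + \<alpha> q) * P' $$ (\<beta> q' * b + r, \<beta> q * b + r')"
    \<comment> \<open>The hypothesis on the entries of \<open>X\<close> says that its partial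
      transpose is a product with \<open>P'\<close>, hence the transposition is inserted
      twice.\<close>
    have "t X = t (mid_transpose a c b (mid_transpose a c b X))" by (simp add: mid_transpose_involution[OF X])
    also have "\<dots> = F P"
      unfolding F_def
    proof (rule linear_functional_lincomb[OF lin_tm finite_lessThan mid_transpose_carrier conj_carrier[OF Rc P]])
      fix i j assume ij: "i < ?D" "j < ?D"
      obtain v r where v: "v < a * c" "r < b" "i = v * b + r" using ij(1) by (rule pair_index_cases)
      obtain p q where p: "p < a" "q < c" "v = p * c + q" using v(1) by (rule pair_index_cases)
      obtain v' r' where v': "v' < a * c" "r' < b" "j = v' * b + r'" using ij(2) by (rule pair_index_cases)
      obtain p' q' where p': "p' < a" "q' < c" "v' = p' * c + q'" using v'(1) by (rule pair_index_cases)
      have l: "\<beta> q * b + r < cb * b" "\<beta> q' * b + r' < cb * b" using ab(2) p v p' v' by (simp_all add: pair_index_less)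
      have "mid_transpose a c b X $$ (i, j) = P $$ (p * ca + \<alpha> q, p' * ca + \<alpha> q') * P' $$ (\<beta> q * b + r, \<beta> q' * b + r')"
        unfolding v(3) p(3) v'(3) p'(3) mid_transpose_index[OF p(1,2) v(2) p'(1,2) v'(2)]
        by (rule idx[OF p(1) p'(2) v(2) p'(1) p(2) v'(2)])
      also have "\<dots> = (\<Sum>k<cb * b. complex_of_real (g k) * (R k * P * mat_adjoint (R k)) $$ (i, j))"
        unfolding v(3) p(3) v'(3) p'(3) R_conj[OF p(1,2) v(2) p'(1,2) v'(2) P] diagonalizes_index[OF G l] sum_distrib_left
        by (intro sum.cong refl) (simp add: mult_ac)
      finally show "mid_transpose a c b X $$ (i, j) = (\<Sum>k<cb * b. complex_of_real (g k) * (R k * P * mat_adjoint (R k)) $$ (i, j))" .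
    qed
    also have "\<dots> = pairing ?d \<Theta> P" by (rule \<Theta>[OF P])
    finally show "t X = pairing ?d \<Theta> P" .
  qed
qed

text \<open>Linearity reduces to product states, and diagonalising both factors reduces these to
  products of eigenvectors, which have norm 1.\<close>

lemma pairing_separable_le:
  assumes prod: "\<And>u w. Re (pairing (a * c) \<Theta> (outer (a * c) (prodvec c u w))) \<le> \<delta> * (norm2 a u * norm2 c w)"
    and "is_separable a c \<sigma>"
  shows "Re (pairing (a * c) \<Theta> \<sigma>) \<le> \<delta>"
proof -
  obtain r :: nat and p \<alpha> \<beta> where k: "\<forall>k<r. 0 \<le> p k \<and> is_state a (\<alpha> k) \<and> is_state c (\<beta> k)" and p1: "(\<Sum>k<r. p k) = 1"
    and \<sigma>: "\<sigma> = msum (a * c) {..<r} (\<lambda>k. complex_of_real (p k) \<cdot>\<^sub>m kron (\<alpha> k) (\<beta> k))"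
    using assms(2) by (rule is_separableE)
  have state: "Re (pairing (a * c) \<Theta> (kron A B)) \<le> \<delta>" if A: "is_state a A" and B: "is_state c B" for A B
  proof -
    obtain U f where D: "diagonalizes a U f A" "\<forall>i<a. 0 \<le> f i" "(\<Sum>i<a. f i) = 1" using A by (auto simp: is_state_iff)
    obtain V h where E: "diagonalizes c V h B" "\<forall>i<c. 0 \<le> h i" "(\<Sum>i<c. h i) = 1" using B by (auto simp: is_state_iff)
    note U = diagonalizes_unitary[OF D(1)] note V = diagonalizes_unitary[OF E(1)]
    have c: "U \<in> carrier_mat a a" "V \<in> carrier_mat c c" using U V by (auto simp: is_unitary_def)
    have le: "Re (pairing (a * c) \<Theta> (outer (a * c) (\<lambda>i. kron U V $$ (i, l)))) \<le> \<delta>" if l: "l < a * c" for l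
    proof -
      let ?u = "\<lambda>i. U $$ (i, l div c)" and ?w = "\<lambda>i. V $$ (i, l mod c)"
      have "outer (a * c) (\<lambda>i. kron U V $$ (i, l)) = outer (a * c) (prodvec c ?u ?w)"
        using c l by (intro outer_cong) (simp add: kron_def prodvec_def)
      moreover have "norm2 a ?u = 1" "norm2 c ?w = 1"
        unfolding norm2_def by (rule unitary_col_norm[OF U div_index_less[OF l]], rule unitary_col_norm[OF V mod_index_less[OF l]])
      ultimately show ?thesis using prod[of ?u ?w] by simp
    qed
    have "Re (pairing (a * c) \<Theta> (kron A B)) =
      (\<Sum>l<a * c. f (l div c) * h (l mod c) * Re (pairing (a * c) \<Theta> (outer (a * c) (\<lambda>i. kron U V $$ (i, l)))))"
      unfolding pairing_diagonalizes[OF diagonalizes_kron[OF D(1) E(1)]] by simp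
    also have "\<dots> \<le> (\<Sum>l<a * c. f (l div c) * h (l mod c) * \<delta>)"
      using le D(2) E(2) by (intro sum_mono mult_left_mono) (auto simp: div_index_less mod_index_less)
    also have "\<dots> = \<delta>"
      unfolding sum_distrib_right[symmetric] sum_product_eigenvalues using D(3) E(3) by simp
    finally show ?thesis .
  qed
  have "pairing (a * c) \<Theta> \<sigma> = (\<Sum>k<r. complex_of_real (p k) * pairing (a * c) \<Theta> (kron (\<alpha> k) (\<beta> k)))"
  proof (rule pairing_lincomb[OF finite_lessThan])
    fix i j assume ij: "i < a * c" "j < a * c"
    have "(complex_of_real (p l) \<cdot>\<^sub>m kron (\<alpha> l) (\<beta> l)) $$ (i, j) = complex_of_real (p l) * kron (\<alpha> l) (\<beta> l) $$ (i, j)" if "l < r" for l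
    proof -
      have kc: "kron (\<alpha> l) (\<beta> l) \<in> carrier_mat (a * c) (a * c)"
        using k that by (intro kron_carrier is_state_carrier) auto
      show ?thesis using ij by (simp add: carrier_matD[OF kc] del: kron_dims)
    qed
    then show "\<sigma> $$ (i, j) = (\<Sum>k<r. complex_of_real (p k) * kron (\<alpha> k) (\<beta> k) $$ (i, j))"
      unfolding \<sigma> msum_index[OF ij] by (intro sum.cong) auto
  qed
  then have "Re (pairing (a * c) \<Theta> \<sigma>) = (\<Sum>k<r. p k * Re (pairing (a * c) \<Theta> (kron (\<alpha> k) (\<beta> k))))" by simp
  also have "\<dots> \<le> (\<Sum>k<r. p k * \<delta>)" using k state by (intro sum_mono mult_left_mono) auto
  also have "\<dots> = \<delta>" using p1 by (simp flip: sum_distrib_right)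
  finally show ?thesis .
qed

lemma is_state_ptranspose_snd:
  assumes "is_state (a * c) \<rho>" "is_psd (a * c) (ptranspose_snd a c \<rho>)"
  shows "is_state (a * c) (ptranspose_snd a c \<rho>)"
proof -
  have "mtrace (ptranspose_snd a c \<rho>) = mtrace \<rho>"
    unfolding mtrace_def using is_state_carrier[OF assms(1)] by (intro sum.cong) (auto simp: ptranspose_snd_def)
  then show ?thesis using assms by (simp add: is_state_def)
qed

lemma is_state_ptranspose_fst:
  assumes "is_state (c * b) \<rho>" "is_psd (c * b) (ptranspose_fst c b \<rho>)"
  shows "is_state (c * b) (ptranspose_fst c b \<rho>)"
proof -
  have "mtrace (ptranspose_fst c b \<rho>) = mtrace \<rho>"
    unfolding mtrace_def using is_state_carrier[OF assms(1)] by (intro sum.cong) (auto simp: ptranspose_fst_def)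
  then show ?thesis using assms by (simp add: is_state_def)
qed

text \<open>The protocol yields a single effect that works against all separable states at once, so
  the lower bound on the relative entropy survives the infimum. The threshold \<open>c\<close> is
  still free here.\<close>

lemma key_repeater_achievable_bound:
  assumes \<rho>: "is_state (dA * dCA) \<rho>" "is_psd (dA * dCA) (ptranspose_snd dA dCA \<rho>)"
    and \<rho>': "is_state (dCB * dB) \<rho>'" "is_psd (dCB * dB) (ptranspose_fst dCB dB \<rho>')"
    and ach: "key_repeater_achievable dA (dCA * dCB) dB (kron \<rho> \<rho>') \<epsilon> n m" and c: "1 \<le> c"
  shows "ereal ((1 - 2 * (\<epsilon> + c / 2 ^ m)) * log 2 c - 2) \<le>
    rel_ent_entanglement (dA ^ n) (dCA ^ n) (bip_power dA dCA (ptranspose_snd dA dCA \<rho>) n)"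
proof -
  note s = is_state_ptranspose_snd[OF \<rho>] and s' = is_state_ptranspose_fst[OF \<rho>']
  let ?X = "tri_power dA (dCA * dCB) dB (kron \<rho> \<rho>') n" and ?P = "bip_power dA dCA (ptranspose_snd dA dCA \<rho>) n"
  let ?d = "dA ^ n * dCA ^ n"
  obtain t where t: "test_functional (1 / 2 ^ m) (dA ^ n, (dCA * dCB) ^ n, dB ^ n) t" "1 - \<epsilon> \<le> Re (t ?X)"
    using key_repeater_achievable_test[OF ach] by blast
  obtain \<Theta> where E: "effect ?d \<Theta>"
    and prod: "\<And>u w. Re (pairing ?d \<Theta> (outer ?d (prodvec (dCA ^ n) u w))) \<le> 1 / 2 ^ m * (norm2 (dA ^ n) u * norm2 (dCA ^ n) w)"
    and eq: "t ?X = pairing ?d \<Theta> ?P"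
    using test_functional_partial[OF t(1) is_state_bip_power[OF s'] digits_bij]
      is_state_carrier[OF is_state_bip_power[OF s]] tri_power_carrier
      tri_power_kron_index[OF is_state_carrier[OF \<rho>(1)] is_state_carrier[OF \<rho>'(1)] s s']
    by metis
  show ?thesis unfolding rel_ent_entanglement_def
  proof (rule INF_greatest)
    fix \<sigma> assume "\<sigma> \<in> {\<sigma>. is_separable (dA ^ n) (dCA ^ n) \<sigma>}"
    then have sep: "is_separable (dA ^ n) (dCA ^ n) \<sigma>" by simp
    have "Re (pairing ?d \<Theta> \<sigma>) \<le> 1 / 2 ^ m" by (rule pairing_separable_le[OF prod sep])
    then have "ereal ((1 - 2 * (\<epsilon> + c * (1 / 2 ^ m))) * log 2 c - 2) \<le> rel_entropy ?P \<sigma>"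
      using t(2) unfolding eq by (intro rel_entropy_ge_test[OF is_state_bip_power[OF s] is_separable_state[OF sep] E _ _ c])
    then show "ereal ((1 - 2 * (\<epsilon> + c / 2 ^ m)) * log 2 c - 2) \<le> rel_entropy ?P \<sigma>" by simp
  qed
qed

section \<open>From bounds for single protocols to the rate\<close>

theorem corollary6:
  fixes dA dCA dCB dB :: nat and \<rho> \<rho>' :: "complex mat"
  assumes "is_state (dA * dCA) \<rho>" and "is_psd (dA * dCA) (ptranspose_snd dA dCA \<rho>)"
    and "is_state (dCB * dB) \<rho>'" and "is_psd (dCB * dB) (ptranspose_fst dCB dB \<rho>')"
  shows "key_repeater_rate dA (dCA * dCB) dB (kron \<rho> \<rho>')
    \<le> reg_rel_ent_entanglement dA dCA (ptranspose_snd dA dCA \<rho>)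
      + reg_rel_ent_entanglement dCB dB (ptranspose_fst dCB dB \<rho>')"
proof -
  note s = is_state_ptranspose_snd[OF assms(1,2)] and s' = is_state_ptranspose_fst[OF assms(3,4)]
  let ?K = "key_repeater_rate dA (dCA * dCB) dB (kron \<rho> \<rho>')"
  obtain L e where L: "0 \<le> L" "reg_rel_ent_entanglement dA dCA (ptranspose_snd dA dCA \<rho>) = ereal L"
    and e: "\<And>n. rel_ent_entanglement (dA ^ n) (dCA ^ n) (bip_power dA dCA (ptranspose_snd dA dCA \<rho>) n) = ereal (e n)"
    and lim: "(\<lambda>n. e n / real n) \<longlonglongrightarrow> L"
    using reg_rel_ent_entanglement_limit[OF s] by blast
  obtain L' e' where L': "0 \<le> L'" "reg_rel_ent_entanglement dCB dB (ptranspose_fst dCB dB \<rho>') = ereal L'"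
    using reg_rel_ent_entanglement_limit[OF s'] by blast
  have e0: "0 \<le> e n" for n
    using rel_ent_entanglement_nonneg[OF is_state_bip_power[OF s], of n] by (simp add: e)
  have bound: "real m \<le> (e n + 2) / (1 - 4 * \<epsilon>) - log 2 \<epsilon>"
    if \<epsilon>: "0 < \<epsilon>" "\<epsilon> < 1 / 4" and ach: "key_repeater_achievable dA (dCA * dCB) dB (kron \<rho> \<rho>') \<epsilon> n m" for \<epsilon> n m
  proof (cases "1 \<le> \<epsilon> * 2 ^ m")
    case True
    have l: "log 2 (\<epsilon> * 2 ^ m) = log 2 \<epsilon> + real m" using \<epsilon> by (simp add: log_mult log_nat_power)
    have "(1 - 2 * (\<epsilon> + \<epsilon> * 2 ^ m / 2 ^ m)) * log 2 (\<epsilon> * 2 ^ m) - 2 \<le> e n"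
      using key_repeater_achievable_bound[OF assms ach True] by (simp add: e)
    then have "(1 - 4 * \<epsilon>) * (log 2 \<epsilon> + real m) \<le> e n + 2" unfolding l by simp
    then have "log 2 \<epsilon> + real m \<le> (e n + 2) / (1 - 4 * \<epsilon>)" using \<epsilon> by (simp add: pos_le_divide_eq mult.commute)
    then show ?thesis by simp
  next
    case False
    \<comment> \<open>Here the threshold \<open>\<epsilon> * 2 ^ m\<close> would be below 1 and the
      testing bound does not apply, but then \<open>m\<close> is at most
      \<open>- log 2 \<epsilon>\<close>, a constant independent of \<open>n\<close>.\<close>
    then have "log 2 (\<epsilon> * 2 ^ m) \<le> 0" using \<epsilon> by (simp add: log_le_zero_cancel_iff)
    then have "real m \<le> - log 2 \<epsilon>" using \<epsilon> by (simp add: log_mult log_nat_power)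
    moreover have "0 \<le> (e n + 2) / (1 - 4 * \<epsilon>)" using e0[of n] \<epsilon> by simp
    ultimately show ?thesis by simp
  qed
  \<comment> \<open>With \<epsilon> fixed and \<open>n\<close> growing, the constants 2 and
    \<open>log 2 \<epsilon>\<close> disappear; the limit of small \<epsilon> is taken only
    afterwards.\<close>
  have K: "?K \<le> ereal (L / (1 - 4 * \<epsilon>))" if \<epsilon>: "0 < \<epsilon>" "\<epsilon> < 1 / 4" for \<epsilon>
  proof -
    define B where "B n = (e n / real n) / (1 - 4 * \<epsilon>) + (2 / (1 - 4 * \<epsilon>) - log 2 \<epsilon>) * inverse (real n)" for n
    have "B \<longlonglongrightarrow> L / (1 - 4 * \<epsilon>) + (2 / (1 - 4 * \<epsilon>) - log 2 \<epsilon>) * 0"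
      unfolding B_def[abs_def] using \<epsilon> by (intro tendsto_intros lim lim_inverse_n) auto
    then have B: "(\<lambda>n. ereal (B n)) \<longlonglongrightarrow> ereal (L / (1 - 4 * \<epsilon>))" by simp
    have "?K \<le> limsup (\<lambda>n. SUP m\<in>{m. key_repeater_achievable dA (dCA * dCB) dB (kron \<rho> \<rho>') \<epsilon> n m}. ereal (real m / real n))"
      unfolding key_repeater_rate_def using \<epsilon> by (intro INF_lower) simp
    also have "\<dots> \<le> limsup (\<lambda>n. ereal (B n))"
    proof (rule Limsup_mono)
      show "\<forall>\<^sub>F n in sequentially. (SUP m\<in>{m. key_repeater_achievable dA (dCA * dCB) dB (kron \<rho> \<rho>') \<epsilon> n m}. ereal (real m / real n)) \<le> ereal (B n)"
        using eventually_gt_at_top[of 0]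
      proof eventually_elim
        case (elim n)
        show ?case
        proof (rule SUP_least)
          fix m assume "m \<in> {m. key_repeater_achievable dA (dCA * dCB) dB (kron \<rho> \<rho>') \<epsilon> n m}"
          then have "real m / real n \<le> ((e n + 2) / (1 - 4 * \<epsilon>) - log 2 \<epsilon>) / real n"
            using bound[OF \<epsilon>] by (intro divide_right_mono) auto
          also have "\<dots> = B n" by (simp add: B_def field_simps add_divide_distrib diff_divide_distrib)
          finally show "ereal (real m / real n) \<le> ereal (B n)" by simp
        qed
      qed
    qed
    also have "\<dots> = ereal (L / (1 - 4 * \<epsilon>))" by (rule lim_imp_Limsup[OF sequentially_bot B])
    finally show ?thesis .
  qed
  have "?K \<le> ereal L"
  proof (rule LIMSEQ_le_const)
    \<comment> \<open>The values \<open>1 / (8 * (k + 1))\<close> of \<epsilon> stay below the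
      required \<open>1 / 4\<close> and tend to 0.\<close>
    have "(\<lambda>k. L / (1 - 4 * (inverse (real (Suc k)) / 8))) \<longlonglongrightarrow> L / (1 - 4 * (0 / 8))"
      by (intro tendsto_intros LIMSEQ_inverse_real_of_nat) auto
    then show "(\<lambda>k. ereal (L / (1 - 4 * (inverse (real (Suc k)) / 8)))) \<longlonglongrightarrow> ereal L" by simp
    show "\<exists>N. \<forall>k\<ge>N. ?K \<le> ereal (L / (1 - 4 * (inverse (real (Suc k)) / 8)))"
      by (intro exI allI impI K) (auto simp: field_simps)
  qed
  also have "\<dots> \<le> ereal L + ereal L'" using L'(1) by simp
  finally show ?thesis unfolding L(2) L'(2) .
qed

end
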